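(* Let $A$ be a $2\times 2$ real symmetric positive-semidefinite matrix and let $f:\mathbb{H}\times\mathbb{R}^2\to\mathbb{R}$ satisfy: (A1) there exists $L_1>0$ such that $|f(p,w_1)-f(p,w_2)|\le L_1|w_1-w_2|$ for all $p\in\mathbb{H}$ and $w_1,w_2\in\mathbb{R}^2$; (A2) for every $\rho>0$ there exists $L_2(\rho)>0$ such that $|f(p,w)-f(q,w)|\le L_2(\rho)\,|p\cdot q^{-1}|_G$ for all $p,q\in\mathbb{H}$ with $|p|,|q|\le\rho$ and all $w\in\mathbb{R}^2$. Let $u,v:\mathbb{H}\times[0,\infty)\to\mathbb{R}$ be respectively an upper semicontinuous viscosity subsolution and a lower semicontinuous viscosity supersolution of $$u_t-\operatorname{tr}\left(A(\nabla_H^2u)^\ast\right)+f(p,\nabla_Hu)=0\quad\text{in }\mathbb{H}\times(0,\infty).$$ Assume that for any fixed $T>0$ there exist $k>0$ and $C_T>0$ depending on $T$ such that $$u(p,t)-v(p,t)\le C_Te^{k\langle p\rangle}\quad\text{for all }(p,t)\in\mathbb{H}\times[0,T].$$ If $u(p,0)\le v(p,0)$ for all $p\in\mathbb{H}$, then $u\le v$ in $\mathbb{H}\times[0,\infty)$.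
   Context: The Heisenberg group $\mathbb{H}$ is $\mathbb{R}^3$ with the group law $(x_p,y_p,z_p)\cdot(x_q,y_q,z_q)=\left(x_p+x_q,\,y_p+y_q,\,z_p+z_q+\tfrac12(x_py_q-x_qy_p)\right)$; the inverse of $p=(x,y,z)$ is $p^{-1}=(-x,-y,-z)$. The Korányi gauge is $|p|_G=\left((x^2+y^2)^2+16z^2\right)^{1/4}$ for $p=(x,y,z)$; $|p|$ denotes the Euclidean norm of $p$; and $\langle p\rangle=(1+x^4+y^4+16z^2)^{1/4}$. Left-invariant vector fields: $X_1=\partial_x-\tfrac y2\partial_z$, $X_2=\partial_y+\tfrac x2\partial_z$. The horizontal gradient is $\nabla_Hu=(X_1u,X_2u)$, and the symmetrized horizontal Hessian $(\nabla_H^2u)^\ast$ is the symmetric $2\times2$ matrix with diagonal entries $X_1^2u$, $X_2^2u$ and off-diagonal entries $\tfrac12(X_1X_2u+X_2X_1u)$ (derivatives in the space variable only). Viscosity notions: an upper semicontinuous (resp. lower semicontinuous) function $u$ is a viscosity subsolution (resp. supersolution) of $u_t-\operatorname{tr}(A(\nabla_H^2u)^\ast)+f(p,\nabla_Hu)=0$ in $\mathbb{H}\times(0,\infty)$ if, whenever $\phi$ is $C^2$ near $(p_0,t_0)\in\mathbb{H}\times(0,\infty)$ and $u-\phi$ has a local maximum (resp. minimum) at $(p_0,t_0)$, one has $\phi_t-\operatorname{tr}(A(\nabla_H^2\phi)^\ast)+f(p_0,\nabla_H\phi)\le0$ (resp. $\ge0$) at $(p_0,t_0)$. *)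

theory Defs
  imports "HOL-Analysis.Analysis"
begin

section \<open>The Heisenberg group\<close>

text \<open>The product type carries the Euclidean norm, so \<^term>\<open>norm\<close> on \<open>heis\<close> is the
  Euclidean norm of three-dimensional space, and the topology is the usual one.\<close>

type_synonym heis = "real \<times> real \<times> real"

fun heis_mult :: "heis \<Rightarrow> heis \<Rightarrow> heis" (infixl "\<cdot>\<^sub>H" 70) where
  "(x, y, z) \<cdot>\<^sub>H (x', y', z') = (x + x', y + y', z + z' + (1/2) * (x * y' - x' * y))"

fun heis_inv :: "heis \<Rightarrow> heis" where
  "heis_inv (x, y, z) = (- x, - y, - z)"

fun koranyi_gauge :: "heis \<Rightarrow> real" where
  "koranyi_gauge (x, y, z) = root 4 ((x\<^sup>2 + y\<^sup>2)\<^sup>2 + 16 * z\<^sup>2)"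

fun heis_bracket :: "heis \<Rightarrow> real" where
  "heis_bracket (x, y, z) = root 4 (1 + x ^ 4 + y ^ 4 + 16 * z\<^sup>2)"

section \<open>Horizontal derivatives\<close>

fun partial_x :: "(heis \<Rightarrow> real) \<Rightarrow> heis \<Rightarrow> real" where
  "partial_x g (x, y, z) = deriv (\<lambda>s. g (s, y, z)) x"

fun partial_y :: "(heis \<Rightarrow> real) \<Rightarrow> heis \<Rightarrow> real" where
  "partial_y g (x, y, z) = deriv (\<lambda>s. g (x, s, z)) y"

fun partial_z :: "(heis \<Rightarrow> real) \<Rightarrow> heis \<Rightarrow> real" where
  "partial_z g (x, y, z) = deriv (\<lambda>s. g (x, y, s)) z"

fun X1 :: "(heis \<Rightarrow> real) \<Rightarrow> heis \<Rightarrow> real" where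
  "X1 g (x, y, z) = partial_x g (x, y, z) - y / 2 * partial_z g (x, y, z)"

fun X2 :: "(heis \<Rightarrow> real) \<Rightarrow> heis \<Rightarrow> real" where
  "X2 g (x, y, z) = partial_y g (x, y, z) + x / 2 * partial_z g (x, y, z)"

definition hgrad :: "(heis \<Rightarrow> real) \<Rightarrow> heis \<Rightarrow> real ^ 2" where
  "hgrad g p = vector [X1 g p, X2 g p]"

definition hhess_sym :: "(heis \<Rightarrow> real) \<Rightarrow> heis \<Rightarrow> real ^ 2 ^ 2" where
  "hhess_sym g p =
     vector [vector [X1 (X1 g) p, (X1 (X2 g) p + X2 (X1 g) p) / 2],
             vector [(X1 (X2 g) p + X2 (X1 g) p) / 2, X2 (X2 g) p]]"

section \<open>Semicontinuity and twice continuous differentiability\<close>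

definition usc_on :: "'a::topological_space set \<Rightarrow> ('a \<Rightarrow> real) \<Rightarrow> bool" where
  "usc_on S g \<longleftrightarrow> (\<forall>x\<in>S. \<forall>c>g x. \<forall>\<^sub>F y in at x within S. g y < c)"

definition lsc_on :: "'a::topological_space set \<Rightarrow> ('a \<Rightarrow> real) \<Rightarrow> bool" where
  "lsc_on S g \<longleftrightarrow> (\<forall>x\<in>S. \<forall>c<g x. \<forall>\<^sub>F y in at x within S. c < g y)"

definition C2_on :: "'a::real_normed_vector set \<Rightarrow> ('a \<Rightarrow> real) \<Rightarrow> bool" where
  "C2_on U g \<longleftrightarrow>
     (\<exists>(g' :: 'a \<Rightarrow> 'a \<Rightarrow>\<^sub>L real) (g'' :: 'a \<Rightarrow> 'a \<Rightarrow>\<^sub>L ('a \<Rightarrow>\<^sub>L real)).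
        (\<forall>x\<in>U. (g has_derivative blinfun_apply (g' x)) (at x)) \<and>
        (\<forall>x\<in>U. (g' has_derivative blinfun_apply (g'' x)) (at x)) \<and>
        continuous_on U g'')"

section \<open>Viscosity solutions\<close>

definition pde_lhs ::
    "real ^ 2 ^ 2 \<Rightarrow> (heis \<Rightarrow> real ^ 2 \<Rightarrow> real) \<Rightarrow> (heis \<times> real \<Rightarrow> real) \<Rightarrow> heis \<Rightarrow> real \<Rightarrow> real"
where
  "pde_lhs A f \<phi> p t =
     deriv (\<lambda>s. \<phi> (p, s)) t
     - trace (A ** hhess_sym (\<lambda>q. \<phi> (q, t)) p)
     + f p (hgrad (\<lambda>q. \<phi> (q, t)) p)"

text \<open>Functions on space-time are total; only their values for times \<open>t > 0\<close> enter the two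
  definitions below, since a neighbourhood of a point with \<open>t\<^sub>0 > 0\<close> can be shrunk to such times.\<close>

definition viscosity_subsolution ::
    "real ^ 2 ^ 2 \<Rightarrow> (heis \<Rightarrow> real ^ 2 \<Rightarrow> real) \<Rightarrow> (heis \<times> real \<Rightarrow> real) \<Rightarrow> bool"
where
  "viscosity_subsolution A f u \<longleftrightarrow>
     usc_on (UNIV \<times> {0<..}) u \<and>
     (\<forall>p\<^sub>0 t\<^sub>0 \<phi> U. t\<^sub>0 > 0 \<longrightarrow> open U \<longrightarrow> (p\<^sub>0, t\<^sub>0) \<in> U \<longrightarrow> C2_on U \<phi> \<longrightarrow>
        (\<forall>\<^sub>F w in nhds (p\<^sub>0, t\<^sub>0). u w - \<phi> w \<le> u (p\<^sub>0, t\<^sub>0) - \<phi> (p\<^sub>0, t\<^sub>0)) \<longrightarrow>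
        pde_lhs A f \<phi> p\<^sub>0 t\<^sub>0 \<le> 0)"

definition viscosity_supersolution ::
    "real ^ 2 ^ 2 \<Rightarrow> (heis \<Rightarrow> real ^ 2 \<Rightarrow> real) \<Rightarrow> (heis \<times> real \<Rightarrow> real) \<Rightarrow> bool"
where
  "viscosity_supersolution A f v \<longleftrightarrow>
     lsc_on (UNIV \<times> {0<..}) v \<and>
     (\<forall>p\<^sub>0 t\<^sub>0 \<phi> U. t\<^sub>0 > 0 \<longrightarrow> open U \<longrightarrow> (p\<^sub>0, t\<^sub>0) \<in> U \<longrightarrow> C2_on U \<phi> \<longrightarrow>
        (\<forall>\<^sub>F w in nhds (p\<^sub>0, t\<^sub>0). v (p\<^sub>0, t\<^sub>0) - \<phi> (p\<^sub>0, t\<^sub>0) \<le> v w - \<phi> w) \<longrightarrow>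
        pde_lhs A f \<phi> p\<^sub>0 t\<^sub>0 \<ge> 0)"

end

theory Submission
  imports Defs
begin

text \<open>
  The increments \<open>z\<^sup>-\<^sup>1 \<cdot> w\<close> turn the left-invariant operator into one with constant coefficients
  acting on second-order jets, and left translation preserves jets; the argument therefore lives
  on an abstract step-two group. To show that \<open>u - v\<close> is a subsolution of the extremal equation
  \<open>w\<^sub>t - tr(A (\<nabla>\<^sub>H\<^sup>2 w)\<^sup>*) = L \<bar>\<nabla>\<^sub>H w\<bar>\<close>, replace \<open>u\<close> and \<open>- v\<close> by sup-convolutions over left translations.
  Their jets are jets of \<open>u\<close> and \<open>- v\<close> at nearby points, so by (A2) the space argument of \<open>f\<close> can
  be frozen; as they are semiconvex, their gradients are continuous at a point where their sum is
  touched from above, so the gradient can be frozen as well. What remains are two inequalities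
  for a linear operator with constant right-hand sides. Neither Alexandrov's theorem nor Jensen's
  lemma is needed to add them: both functions are compared with one smooth function \<open>h\<close> that
  nearly solves the resolvent equation \<open>h + \<mu> (h\<^sub>t - tr(A (\<nabla>\<^sub>H\<^sup>2 h)\<^sup>*)) = g\<close>, with \<open>g\<close> a smooth
  approximation of the first of them. The function \<open>h\<close> comes from a random walk on the group,
  which preserves regularity because it averages right translates.
  Finally, \<open>exp (2 k \<langle>p\<rangle> + K t) + 1 / (T - t)\<close> is a strict supersolution of the extremal equation
  that beats the growth of \<open>u - v\<close>.
\<close>

section \<open>Jets on step-two groups\<close>

text \<open>The two sides of the group have different roles. \<open>X1\<close> and \<open>X2\<close>
  are derivatives along right increments \<open>z \<odot> \<eta>\<close>, so superjets are taken in
  these, and left translation carries a superjet unchanged to another point. The regularity of the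
  resolvent is measured along left increments \<open>\<zeta> \<odot> z\<close>, which commute with
  the right translations that the random walk averages. Conjugation by \<open>z\<close> turns one
  kind of increment into the other and is linear, because commutators are central; it costs the
  factor \<open>1 + norm z\<close>, which is harmless on a ball. Time is treated as one more central
  coordinate, so that the parabolic operator is a linear form on jets and one step of the walk also
  moves back in time. Factoring \<open>A\<close> as a sum of two squares turns the second-order part
  into two pure second derivatives, along directions that may vanish; the operator may be fully
  degenerate and then smooths nothing. This is why the resolvent is given a smooth right-hand side
  and solved only approximately, and why the comparison is localised by an explicit polynomial,
  whose cost must be of smaller order in \<mu> than the gain.\<close>

lemma bounded_bilinear_add:
  assumes "bounded_bilinear f" "bounded_bilinear g"
  shows "bounded_bilinear (\<lambda>x y. f x y + g x y)"
proof -
  interpret f: bounded_bilinear f by fact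
  interpret g: bounded_bilinear g by fact
  obtain K L where K: "\<And>a b. norm (f a b) \<le> norm a * norm b * K"
    and L: "\<And>a b. norm (g a b) \<le> norm a * norm b * L"
    using f.bounded g.bounded by blast
  show ?thesis
  proof
    have "norm (f a b + g a b) \<le> norm a * norm b * (K + L)" for a b
      using norm_triangle_ineq[of "f a b" "g a b"] K[of a b] L[of a b]
      by (simp add: algebra_simps)
    then show "\<exists>K. \<forall>a b. norm (f a b + g a b) \<le> norm a * norm b * K" by blast
  qed (simp_all add: f.add_left g.add_left f.add_right g.add_right f.scaleR_left
      g.scaleR_left f.scaleR_right g.scaleR_right scaleR_right_distrib)
qed

lemma bounded_bilinear_const_mult:
  fixes f :: "'a::real_normed_vector \<Rightarrow> 'b::real_normed_vector \<Rightarrow> real"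
  assumes "bounded_bilinear f"
  shows "bounded_bilinear (\<lambda>x y. k * f x y)"
proof -
  interpret f: bounded_bilinear f by fact
  obtain K where K: "\<And>a b. norm (f a b) \<le> norm a * norm b * K"
    using f.bounded by blast
  show ?thesis
  proof
    have "norm (k * f a b) \<le> norm a * norm b * (\<bar>k\<bar> * K)" for a b
      using mult_left_mono[OF K[of a b], of "\<bar>k\<bar>"]
      by (simp add: abs_mult algebra_simps)
    then show "\<exists>K. \<forall>a b. norm (k * f a b) \<le> norm a * norm b * K" by blast
  qed (simp_all add: f.add_left f.add_right f.scaleR_left f.scaleR_right algebra_simps)
qed

lemma bounded_bilinear_minus:
  fixes f :: "'a::real_normed_vector \<Rightarrow> 'b::real_normed_vector \<Rightarrow> real"
  shows "bounded_bilinear f \<Longrightarrow> bounded_bilinear (\<lambda>x y. - f x y)"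
  using bounded_bilinear_const_mult[of f "-1"] by simp

lemma bounded_bilinear_product:
  fixes f g :: "'a::real_normed_vector \<Rightarrow> real"
  shows "bounded_linear f \<Longrightarrow> bounded_linear g \<Longrightarrow> bounded_bilinear (\<lambda>x y. f x * g y)"
  by (rule bounded_bilinear.comp[OF bounded_bilinear_mult])

lemma bounded_bilinear_zero: "bounded_bilinear (\<lambda>x y. 0)"
  by standard (auto intro: exI[of _ 0])

text \<open>The product is the Baker-Campbell-Hausdorff formula in exponential coordinates: the
  commutator \<open>om x y *\<^sub>R c\<close> is central, so the series stops after its half, the
  identity is 0 and inverses are negatives. The two norm bounds are normalisations under which a
  translation by \<open>x\<close> costs at most a factor \<open>1 + norm x\<close>.\<close>

locale step_two_group =
  fixes om :: "'a::euclidean_space \<Rightarrow> 'a \<Rightarrow> real" and c :: 'a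
  assumes om_bilinear: "bounded_bilinear om"
    and om_self [simp]: "om x x = 0"
    and om_center [simp]: "om x c = 0"
    and om_le: "\<bar>om x y\<bar> \<le> norm x * norm y"
    and norm_c: "norm c \<le> 1"
begin

sublocale om: bounded_bilinear om by (rule om_bilinear)

definition gmult :: "'a \<Rightarrow> 'a \<Rightarrow> 'a"  (infixl \<open>\<odot>\<close> 70)
  where "x \<odot> y = x + y + (om x y / 2) *\<^sub>R c"

text \<open>The differential of left translation by \<open>x\<close>. As left translation is affine
  in these coordinates, expansions along right increments reduce to substituting this linear
  map.\<close>

definition ltr :: "'a \<Rightarrow> 'a \<Rightarrow> 'a"
  where "ltr x y = y + (om x y / 2) *\<^sub>R c"

text \<open>The conjugate \<open>x \<odot> y \<odot> - x\<close>, linear in \<open>y\<close>. It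
  rewrites a right increment as a left one.\<close>

definition conj_inc :: "'a \<Rightarrow> 'a \<Rightarrow> 'a"
  where "conj_inc x y = y + om x y *\<^sub>R c"

lemma om_swap: "om y x = - om x y"
  using om_self[of x] om_self[of y] om_self[of "x + y"]
  unfolding om.add_left om.add_right by linarith

lemma om_center_left [simp]: "om c x = 0"
  using om_swap[of c x] by simp

lemma gmult_ltr: "x \<odot> y = x + ltr x y"
  by (simp add: gmult_def ltr_def)

lemma gmult_assoc: "(x \<odot> y) \<odot> z = x \<odot> (y \<odot> z)"
  by (simp add: gmult_def om.add_left om.add_right om.scaleR_left om.scaleR_right
      algebra_simps add_divide_distrib)

lemma gmult_0 [simp]: "0 \<odot> x = x" "x \<odot> 0 = x"
  by (simp_all add: gmult_def om.zero_left om.zero_right)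

lemma gmult_minus [simp]: "x \<odot> (- x) = 0" "(- x) \<odot> x = 0"
  by (simp_all add: gmult_def om.minus_left om.minus_right)

lemma gmult_cancel [simp]: "x \<odot> (- x \<odot> y) = y" "- x \<odot> (x \<odot> y) = y"
  by (simp_all add: gmult_assoc [symmetric])

lemma gmult_cancel_right [simp]: "x \<odot> y \<odot> - y = x" "x \<odot> - y \<odot> y = x"
  by (simp_all add: gmult_assoc)

lemma minus_gmult: "- (x \<odot> y) = - y \<odot> - x"
  by (simp add: gmult_def om.minus_left om.minus_right om_swap[of y x])

lemma conj_inc: "x \<odot> y = conj_inc x y \<odot> x"
proof -
  have "om x y *\<^sub>R c = (om x y / 2) *\<^sub>R c + (om x y / 2) *\<^sub>R c"
    by (simp flip: scaleR_add_left)
  then show ?thesis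
    by (simp add: gmult_def conj_inc_def om.add_left om.scaleR_left om_swap[of y x])
qed

lemma bounded_linear_ltr [bounded_linear]: "bounded_linear (ltr x)"
  unfolding ltr_def
  by (intro bounded_linear_add bounded_linear_ident
      bounded_linear_compose[OF bounded_linear_scaleR_left]
      bounded_linear_divide[THEN bounded_linear_compose] om.bounded_linear_right)

lemma bounded_linear_conj_inc [bounded_linear]: "bounded_linear (conj_inc x)"
  unfolding conj_inc_def
  by (intro bounded_linear_add bounded_linear_ident
      bounded_linear_compose[OF bounded_linear_scaleR_left] om.bounded_linear_right)

lemma norm_om_c: "norm (om x y *\<^sub>R c) \<le> norm x * norm y"
proof -
  have "norm (om x y *\<^sub>R c) \<le> \<bar>om x y\<bar> * 1"
    unfolding norm_scaleR by (intro mult_left_mono norm_c) auto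
  then show ?thesis using om_le[of x y] by simp
qed

lemma norm_ltr: "norm (ltr x y) \<le> (1 + norm x) * norm y"
proof -
  have "norm (ltr x y) \<le> norm y + norm ((om x y / 2) *\<^sub>R c)"
    unfolding ltr_def by (rule norm_triangle_ineq)
  also have "norm ((om x y / 2) *\<^sub>R c) \<le> norm (om x y *\<^sub>R c)"
    by (simp add: mult_right_mono)
  also have "\<dots> \<le> norm x * norm y" by (rule norm_om_c)
  finally show ?thesis by (simp add: algebra_simps)
qed

lemma norm_conj_inc: "norm (conj_inc x y) \<le> (1 + norm x) * norm y"
  using norm_triangle_ineq[of y "om x y *\<^sub>R c"] norm_om_c[of x y]
  by (simp add: conj_inc_def algebra_simps)

lemma norm_gmult: "norm (x \<odot> y) \<le> norm x + (1 + norm x) * norm y"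
  using norm_triangle_ineq[of x "ltr x y"] norm_ltr[of x y] by (simp add: gmult_ltr)

text \<open>The twist of the product is at most half of \<open>norm y\<close>, so a factor from the
  unit ball cannot bring a far point close to the origin. This controls supports under left
  increments.\<close>

lemma norm_gmult_ge: "norm y / 2 - 1 \<le> norm (x \<odot> y)" if "norm x \<le> 1"
proof -
  have "norm y = norm (x \<odot> y - (x + (om x y / 2) *\<^sub>R c))"
    by (simp add: gmult_def)
  also have "\<dots> \<le> norm (x \<odot> y) + (norm x + norm ((om x y / 2) *\<^sub>R c))"
    by (rule order_trans[OF norm_triangle_ineq4]) (intro add_left_mono norm_triangle_ineq)
  also have "norm ((om x y / 2) *\<^sub>R c) = norm (om x y *\<^sub>R c) / 2" by simp
  also have "norm (om x y *\<^sub>R c) / 2 \<le> norm y / 2"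
    using norm_om_c[of x y] mult_right_mono[OF that, of "norm y"] by simp
  finally show ?thesis using that by simp
qed

lemma continuous_on_gmult [continuous_intros]:
  "continuous_on S f \<Longrightarrow> continuous_on S g \<Longrightarrow> continuous_on S (\<lambda>x. f x \<odot> g x)"
  unfolding gmult_def by (intro continuous_intros om.continuous_on) auto

lemma tendsto_gmult [tendsto_intros]:
  "(f \<longlongrightarrow> a) F \<Longrightarrow> (g \<longlongrightarrow> b) F \<Longrightarrow> ((\<lambda>x. f x \<odot> g x) \<longlongrightarrow> a \<odot> b) F"
  unfolding gmult_def by (intro tendsto_intros om.tendsto) auto

text \<open>The increment acts from the right, the side on which left-invariant fields
  differentiate. Here \<beta> is the quadratic part itself, that is half of a Hessian, and only its
  diagonal values are constrained.\<close>

definition superjet :: "('a \<Rightarrow> real) \<Rightarrow> 'a \<Rightarrow> ('a \<Rightarrow> real) \<Rightarrow> ('a \<Rightarrow> 'a \<Rightarrow> real) \<Rightarrow> bool"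
  where "superjet u z \<alpha> \<beta> \<longleftrightarrow> bounded_linear \<alpha> \<and> bounded_bilinear \<beta> \<and>
    (\<forall>\<epsilon>>0. \<forall>\<^sub>F \<eta> in nhds 0. u (z \<odot> \<eta>) \<le> u z + \<alpha> \<eta> + \<beta> \<eta> \<eta> + \<epsilon> * (norm \<eta>)\<^sup>2)"

definition jet :: "('a \<Rightarrow> real) \<Rightarrow> 'a \<Rightarrow> ('a \<Rightarrow> real) \<Rightarrow> ('a \<Rightarrow> 'a \<Rightarrow> real) \<Rightarrow> bool"
  where "jet u z \<alpha> \<beta> \<longleftrightarrow> superjet u z \<alpha> \<beta> \<and>
    superjet (\<lambda>x. - u x) z (\<lambda>\<eta>. - \<alpha> \<eta>) (\<lambda>\<eta> \<xi>. - \<beta> \<eta> \<xi>)"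

lemma superjetD:
  assumes "superjet u z \<alpha> \<beta>"
  shows "bounded_linear \<alpha>" "bounded_bilinear \<beta>"
    "\<epsilon> > 0 \<Longrightarrow> \<forall>\<^sub>F \<eta> in nhds 0. u (z \<odot> \<eta>) \<le> u z + \<alpha> \<eta> + \<beta> \<eta> \<eta> + \<epsilon> * (norm \<eta>)\<^sup>2"
  using assms by (auto simp: superjet_def)

lemma superjet_add:
  assumes "superjet u z \<alpha> \<beta>" "superjet v z \<alpha>' \<beta>'"
  shows "superjet (\<lambda>x. u x + v x) z (\<lambda>\<eta>. \<alpha> \<eta> + \<alpha>' \<eta>) (\<lambda>\<eta> \<xi>. \<beta> \<eta> \<xi> + \<beta>' \<eta> \<xi>)"
  unfolding superjet_def
proof (intro conjI allI impI)
  show "bounded_linear (\<lambda>\<eta>. \<alpha> \<eta> + \<alpha>' \<eta>)" "bounded_bilinear (\<lambda>\<eta> \<xi>. \<beta> \<eta> \<xi> + \<beta>' \<eta> \<xi>)"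
    using assms by (auto simp: superjet_def intro: bounded_linear_add bounded_bilinear_add)
  fix \<epsilon> :: real assume "\<epsilon> > 0"
  then have "\<epsilon> / 2 > 0" by simp
  from superjetD(3)[OF assms(1) this] superjetD(3)[OF assms(2) this]
  show "\<forall>\<^sub>F \<eta> in nhds 0. u (z \<odot> \<eta>) + v (z \<odot> \<eta>) \<le>
      u z + v z + (\<alpha> \<eta> + \<alpha>' \<eta>) + (\<beta> \<eta> \<eta> + \<beta>' \<eta> \<eta>) + \<epsilon> * (norm \<eta>)\<^sup>2"
    by eventually_elim (simp add: algebra_simps)
qed

lemma jet_add:
  assumes "jet u z \<alpha> \<beta>" "jet v z \<alpha>' \<beta>'"
  shows "jet (\<lambda>x. u x + v x) z (\<lambda>\<eta>. \<alpha> \<eta> + \<alpha>' \<eta>) (\<lambda>\<eta> \<xi>. \<beta> \<eta> \<xi> + \<beta>' \<eta> \<xi>)"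
  using superjet_add[of u z \<alpha> \<beta> v \<alpha>' \<beta>'] assms
    superjet_add[of "\<lambda>x. - u x" z "\<lambda>\<eta>. - \<alpha> \<eta>" "\<lambda>\<eta> \<xi>. - \<beta> \<eta> \<xi>"
      "\<lambda>x. - v x" "\<lambda>\<eta>. - \<alpha>' \<eta>" "\<lambda>\<eta> \<xi>. - \<beta>' \<eta> \<xi>"]
  by (simp add: jet_def)

lemma superjet_const_mult:
  assumes "superjet u z \<alpha> \<beta>" "k > 0"
  shows "superjet (\<lambda>x. k * u x) z (\<lambda>\<eta>. k * \<alpha> \<eta>) (\<lambda>\<eta> \<xi>. k * \<beta> \<eta> \<xi>)"
  unfolding superjet_def
proof (intro conjI allI impI)
  show "bounded_linear (\<lambda>\<eta>. k * \<alpha> \<eta>)" "bounded_bilinear (\<lambda>\<eta> \<xi>. k * \<beta> \<eta> \<xi>)"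
    using assms by (auto simp: superjet_def bounded_bilinear_const_mult
        intro: bounded_linear_const_mult)
  fix \<epsilon> :: real assume "\<epsilon> > 0"
  then have "\<epsilon> / k > 0" using assms by simp
  from superjetD(3)[OF assms(1) this]
  show "\<forall>\<^sub>F \<eta> in nhds 0. k * u (z \<odot> \<eta>) \<le>
      k * u z + k * \<alpha> \<eta> + k * \<beta> \<eta> \<eta> + \<epsilon> * (norm \<eta>)\<^sup>2"
  proof eventually_elim
    case (elim \<eta>)
    from mult_left_mono[OF this, of k] assms(2) show ?case by (simp add: algebra_simps)
  qed
qed

text \<open>Only increments are compared, so the two functions may be based at different points
  \<open>x\<close> and \<open>z\<close>. Thus one rule serves touching from above, left translation
  and the addition of constants.\<close>

lemma superjet_touch:
  assumes "superjet F z \<alpha> \<beta>" "\<forall>\<^sub>F \<eta> in nhds 0. u (x \<odot> \<eta>) - u x \<le> F (z \<odot> \<eta>) - F z"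
  shows "superjet u x \<alpha> \<beta>"
  unfolding superjet_def
proof (intro conjI allI impI)
  fix \<epsilon> :: real assume "\<epsilon> > 0"
  from superjetD(3)[OF assms(1) this] assms(2)
  show "\<forall>\<^sub>F \<eta> in nhds 0. u (x \<odot> \<eta>) \<le> u x + \<alpha> \<eta> + \<beta> \<eta> \<eta> + \<epsilon> * (norm \<eta>)\<^sup>2"
    by eventually_elim linarith
qed (use assms in \<open>auto simp: superjet_def\<close>)

lemma eventually_cubic_le:
  assumes "\<epsilon> > 0"
  shows "\<forall>\<^sub>F \<eta>::'a in nhds 0. K * (norm \<eta>)^3 \<le> \<epsilon> * (norm \<eta>)\<^sup>2"
proof -
  have "\<forall>\<^sub>F \<eta>::'a in nhds 0. K * norm \<eta> < \<epsilon>"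
  proof (rule order_tendstoD)
    show "((\<lambda>\<eta>::'a. K * norm \<eta>) \<longlongrightarrow> K * norm (0::'a)) (nhds 0)"
      by (intro tendsto_intros filterlim_ident)
  qed (use assms in auto)
  then show ?thesis
  proof eventually_elim
    case (elim \<eta>)
    from mult_right_mono[OF less_imp_le[OF this], of "(norm \<eta>)\<^sup>2"]
    show ?case by (simp add: power2_eq_square power3_eq_cube mult_ac)
  qed
qed

lemma jet_cubicI:
  assumes "bounded_linear \<alpha>" "bounded_bilinear \<beta>" "d > 0"
    and "\<And>\<eta>. norm \<eta> \<le> d \<Longrightarrow> \<bar>u (z \<odot> \<eta>) - u z - \<alpha> \<eta> - \<beta> \<eta> \<eta>\<bar> \<le> K * (norm \<eta>)^3"
  shows "jet u z \<alpha> \<beta>"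
proof -
  have ball: "\<forall>\<^sub>F \<eta>::'a in nhds 0. norm \<eta> \<le> d"
    using eventually_nhds_ball[OF assms(3), of 0]
    by (rule eventually_mono) auto
  have *: "\<forall>\<^sub>F \<eta> in nhds 0. \<bar>u (z \<odot> \<eta>) - u z - \<alpha> \<eta> - \<beta> \<eta> \<eta>\<bar> \<le> \<epsilon> * (norm \<eta>)\<^sup>2"
    if "\<epsilon> > 0" for \<epsilon>
    using ball eventually_cubic_le[OF that, of K]
    by eventually_elim (use assms(4) in \<open>fastforce intro: order_trans\<close>)
  show ?thesis
    unfolding jet_def superjet_def
    using assms(1,2)
    by (auto intro!: bounded_linear_minus bounded_bilinear_minus elim: eventually_mono[OF *])
qed

text \<open>Right increments enter through the linear map \<open>ltr z\<close>, so the expansion is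
  exact and the cubic remainder has constant 0.\<close>

lemma jet_quadratic:
  assumes "bounded_linear \<alpha>" "bounded_bilinear \<beta>"
  shows "jet (\<lambda>x. \<alpha> x + \<beta> x x) z
    (\<lambda>\<eta>. \<alpha> (ltr z \<eta>) + \<beta> z (ltr z \<eta>) + \<beta> (ltr z \<eta>) z) (\<lambda>\<eta> \<xi>. \<beta> (ltr z \<eta>) (ltr z \<xi>))"
proof (rule jet_cubicI[where d = 1 and K = 0])
  interpret a: bounded_linear \<alpha> by fact
  interpret b: bounded_bilinear \<beta> by fact
  show "bounded_linear (\<lambda>\<eta>. \<alpha> (ltr z \<eta>) + \<beta> z (ltr z \<eta>) + \<beta> (ltr z \<eta>) z)"
    by (intro bounded_linear_add bounded_linear_compose[OF assms(1)] bounded_linear_ltr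
        b.bounded_linear_right[THEN bounded_linear_compose]
        b.bounded_linear_left[THEN bounded_linear_compose])
  show "bounded_bilinear (\<lambda>\<eta> \<xi>. \<beta> (ltr z \<eta>) (ltr z \<xi>))"
    by (intro b.comp bounded_linear_ltr)
qed (simp_all add: gmult_ltr linear_add[OF bounded_linear.linear[OF assms(1)]]
    bounded_bilinear.add_left[OF assms(2)] bounded_bilinear.add_right[OF assms(2)])

end

section \<open>The approximate resolvent\<close>

context step_two_group
begin

text \<open>A uniform third-order Taylor bound along left increments. Right translation keeps both
  constants because \<open>(\<zeta> \<odot> z) \<odot> \<eta>\<close> is again a left increment of
  \<open>z \<odot> \<eta>\<close>. The linear part carries no bound: the consistency of the walk
  sees only the quadratic part and the remainder.\<close>

definition left_jets :: "real \<Rightarrow> real \<Rightarrow> ('a \<Rightarrow> real) \<Rightarrow> bool"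
  where "left_jets K \<kappa> h \<longleftrightarrow> (\<forall>z. \<exists>\<alpha> \<beta>. bounded_linear \<alpha> \<and> bounded_bilinear \<beta> \<and>
    (\<forall>\<zeta>. \<bar>\<beta> \<zeta> \<zeta>\<bar> \<le> K * (norm \<zeta>)\<^sup>2) \<and>
    (\<forall>\<zeta>. norm \<zeta> \<le> \<kappa> \<longrightarrow> \<bar>h (\<zeta> \<odot> z) - h z - \<alpha> \<zeta> - \<beta> \<zeta> \<zeta>\<bar> \<le> K * (norm \<zeta>)^3))"

lemma left_jets_translate: "left_jets K \<kappa> h \<Longrightarrow> left_jets K \<kappa> (\<lambda>z. h (z \<odot> \<eta>))"
  unfolding left_jets_def by (simp add: gmult_assoc)

lemma left_jets_convex:
  assumes "left_jets K \<kappa> g" "left_jets K \<kappa> h" "0 \<le> a" "0 \<le> b" "a + b = 1"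
  shows "left_jets K \<kappa> (\<lambda>z. a * g z + b * h z)"
  unfolding left_jets_def
proof
  fix z
  obtain \<alpha> \<beta> where g: "bounded_linear \<alpha>" "bounded_bilinear \<beta>"
    "\<And>\<zeta>. \<bar>\<beta> \<zeta> \<zeta>\<bar> \<le> K * (norm \<zeta>)\<^sup>2"
    "\<And>\<zeta>. norm \<zeta> \<le> \<kappa> \<Longrightarrow> \<bar>g (\<zeta> \<odot> z) - g z - \<alpha> \<zeta> - \<beta> \<zeta> \<zeta>\<bar> \<le> K * (norm \<zeta>)^3"
    using assms(1) unfolding left_jets_def by metis
  obtain \<alpha>' \<beta>' where h: "bounded_linear \<alpha>'" "bounded_bilinear \<beta>'"
    "\<And>\<zeta>. \<bar>\<beta>' \<zeta> \<zeta>\<bar> \<le> K * (norm \<zeta>)\<^sup>2"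
    "\<And>\<zeta>. norm \<zeta> \<le> \<kappa> \<Longrightarrow> \<bar>h (\<zeta> \<odot> z) - h z - \<alpha>' \<zeta> - \<beta>' \<zeta> \<zeta>\<bar> \<le> K * (norm \<zeta>)^3"
    using assms(2) unfolding left_jets_def by metis
  have conv: "\<bar>a * p + b * q\<bar> \<le> r" if "\<bar>p\<bar> \<le> r" "\<bar>q\<bar> \<le> r" for p q r :: real
  proof -
    have "\<bar>a * p + b * q\<bar> \<le> a * \<bar>p\<bar> + b * \<bar>q\<bar>"
      using abs_triangle_ineq[of "a * p" "b * q"] assms by (simp add: abs_mult)
    also have "\<dots> \<le> a * r + b * r"
      using that assms by (intro add_mono mult_left_mono) auto
    finally show ?thesis using assms(5) by (simp flip: distrib_right)
  qed
  show "\<exists>\<alpha> \<beta>. bounded_linear \<alpha> \<and> bounded_bilinear \<beta> \<and> (\<forall>\<zeta>. \<bar>\<beta> \<zeta> \<zeta>\<bar> \<le> K * (norm \<zeta>)\<^sup>2) \<and>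
    (\<forall>\<zeta>. norm \<zeta> \<le> \<kappa> \<longrightarrow> \<bar>a * g (\<zeta> \<odot> z) + b * h (\<zeta> \<odot> z) - (a * g z + b * h z) - \<alpha> \<zeta> - \<beta> \<zeta> \<zeta>\<bar>
      \<le> K * (norm \<zeta>)^3)"
  proof (intro exI conjI allI impI)
    show "bounded_linear (\<lambda>\<zeta>. a * \<alpha> \<zeta> + b * \<alpha>' \<zeta>)"
      using g h by (intro bounded_linear_add bounded_linear_const_mult)
    show "bounded_bilinear (\<lambda>\<zeta> \<xi>. a * \<beta> \<zeta> \<xi> + b * \<beta>' \<zeta> \<xi>)"
      using g h by (intro bounded_bilinear_add bounded_bilinear_const_mult)
    fix \<zeta>
    show "\<bar>a * \<beta> \<zeta> \<zeta> + b * \<beta>' \<zeta> \<zeta>\<bar> \<le> K * (norm \<zeta>)\<^sup>2"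
      using g h by (intro conv)
    assume "norm \<zeta> \<le> \<kappa>"
    from conv[OF g(4)[OF this] h(4)[OF this]]
    show "\<bar>a * g (\<zeta> \<odot> z) + b * h (\<zeta> \<odot> z) - (a * g z + b * h z) -
      (a * \<alpha> \<zeta> + b * \<alpha>' \<zeta>) - (a * \<beta> \<zeta> \<zeta> + b * \<beta>' \<zeta> \<zeta>)\<bar> \<le> K * (norm \<zeta>)^3"
      by (simp add: algebra_simps)
  qed
qed

end

text \<open>The vectors \<open>s1\<close> and \<open>s2\<close> stand for the columns of a factor of
  the diffusion matrix, and \<open>e\<close> for the direction of time.\<close>

locale parabolic_group = step_two_group om c
  for om :: "'a::euclidean_space \<Rightarrow> 'a \<Rightarrow> real" and c :: 'a +
  fixes s1 s2 e :: 'a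
begin

text \<open>The linear part of the equation evaluated on a jet. The factor 2 turns the quadratic
  part \<beta> back into second derivatives.\<close>

definition par :: "('a \<Rightarrow> real) \<Rightarrow> ('a \<Rightarrow> 'a \<Rightarrow> real) \<Rightarrow> real"
  where "par \<alpha> \<beta> = \<alpha> e - 2 * (\<beta> s1 s1 + \<beta> s2 s2)"

text \<open>Four equally likely steps with drift \<open>- \<tau> *\<^sub>R e\<close>. Each of the
  two directions has probability 1/2 and squared length 4 \<tau>, so the averaged quadratic part is
  \<open>2 * \<tau> * (\<beta> s1 s1 + \<beta> s2 s2)\<close>, and
  \<open>walk \<tau> h z - h z\<close> is about \<open>- \<tau> * par \<alpha> \<beta>\<close>. The
  nested halves reduce closure properties to averages of two functions.\<close>

definition walk :: "real \<Rightarrow> ('a \<Rightarrow> real) \<Rightarrow> 'a \<Rightarrow> real"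
  where "walk \<tau> h z =
    1/2 * (1/2 * h (z \<odot> ((2 * sqrt \<tau>) *\<^sub>R s1 - \<tau> *\<^sub>R e)) + 1/2 * h (z \<odot> (- (2 * sqrt \<tau>) *\<^sub>R s1 - \<tau> *\<^sub>R e)))
    + 1/2 * (1/2 * h (z \<odot> ((2 * sqrt \<tau>) *\<^sub>R s2 - \<tau> *\<^sub>R e)) + 1/2 * h (z \<odot> (- (2 * sqrt \<tau>) *\<^sub>R s2 - \<tau> *\<^sub>R e)))"

lemma left_jets_walk:
  assumes "left_jets K \<kappa> h"
  shows "left_jets K \<kappa> (walk \<tau> h)"
proof -
  note T = left_jets_translate[OF assms]
  have avg: "left_jets K \<kappa> (\<lambda>z. 1/2 * f z + 1/2 * g z)"
    if "left_jets K \<kappa> f" "left_jets K \<kappa> g" for f g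
    using left_jets_convex[OF that, of "1/2" "1/2"] by simp
  show ?thesis
    unfolding walk_def [abs_def] by (rule avg[OF avg[OF T T] avg[OF T T]])
qed

lemma continuous_walk:
  assumes "continuous_on UNIV h"
  shows "continuous_on UNIV (walk \<tau> h)"
proof -
  have T: "continuous_on UNIV (\<lambda>z. h (z \<odot> \<eta>))" for \<eta>
    by (rule continuous_on_compose2[OF assms continuous_on_gmult[OF continuous_on_id continuous_on_const]]) simp
  show ?thesis
    unfolding walk_def [abs_def] by (intro continuous_on_add continuous_on_mult continuous_on_const T)
qed

lemma walk_bound:
  assumes "\<And>z. \<bar>h z\<bar> \<le> M"
  shows "\<bar>walk \<tau> h z\<bar> \<le> M"
proof -
  have *: "\<bar>1/2 * p + 1/2 * q\<bar> \<le> M" if "\<bar>p\<bar> \<le> M" "\<bar>q\<bar> \<le> M" for p q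
    using that by (auto simp: abs_le_iff field_simps)
  show ?thesis unfolding walk_def by (rule *[OF *[OF assms assms] *[OF assms assms]])
qed

lemma walk_diff: "walk \<tau> g z - walk \<tau> h z = walk \<tau> (\<lambda>x. g x - h x) z"
  by (simp add: walk_def algebra_simps)

text \<open>Conjugation turns the left expansion of \<open>h\<close> into a right one. Terms odd in
  the step length cancel between opposite steps, and those of order \<tau> form \<open>par\<close>.
  What is left is the cubic remainder and the drift term
  \<open>\<tau> * \<tau> * \<beta> e e\<close>, each at most
  \<open>K * D^3 * (\<tau> * sqrt \<tau>)\<close>; \<open>D * sqrt \<tau>\<close> dominates every
  conjugated step.\<close>

lemma walk_consistent:
  assumes h: "left_jets K \<kappa> h" and "0 \<le> K" "norm z \<le> \<rho>" "0 < \<tau>" "\<tau> \<le> 1"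
    and D: "D = (1 + \<rho>) * (1 + 2 * norm s1 + 2 * norm s2 + norm e)" "D * sqrt \<tau> \<le> \<kappa>"
  shows "\<exists>\<alpha> \<beta>. jet h z \<alpha> \<beta> \<and> \<bar>walk \<tau> h z - h z + \<tau> * par \<alpha> \<beta>\<bar> \<le> 2 * K * D^3 * (\<tau> * sqrt \<tau>)"
proof -
  obtain a b where ab: "bounded_linear a" "bounded_bilinear b"
    "\<And>\<zeta>. \<bar>b \<zeta> \<zeta>\<bar> \<le> K * (norm \<zeta>)\<^sup>2"
    "\<And>\<zeta>. norm \<zeta> \<le> \<kappa> \<Longrightarrow> \<bar>h (\<zeta> \<odot> z) - h z - a \<zeta> - b \<zeta> \<zeta>\<bar> \<le> K * (norm \<zeta>)^3"
    using h unfolding left_jets_def by metis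
  interpret b: bounded_bilinear b by fact
  define \<alpha> where "\<alpha> \<eta> = a (conj_inc z \<eta>)" for \<eta>
  define \<beta> where "\<beta> \<eta> \<xi> = b (conj_inc z \<eta>) (conj_inc z \<xi>)" for \<eta> \<xi>
  have \<alpha>: "bounded_linear \<alpha>"
    unfolding \<alpha>_def by (intro bounded_linear_compose[OF ab(1)] bounded_linear_conj_inc)
  have \<beta>: "bounded_bilinear \<beta>"
    unfolding \<beta>_def by (intro b.comp bounded_linear_conj_inc)
  interpret \<alpha>: bounded_linear \<alpha> by (rule \<alpha>)
  interpret \<beta>: bounded_bilinear \<beta> by (rule \<beta>)
  have \<rho>: "0 \<le> \<rho>" using assms(3) norm_ge_zero order_trans by blast
  have "1 \<le> (1 + \<rho>) * 1" using \<rho> by simp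
  also have "\<dots> \<le> D" unfolding D using \<rho> by (intro mult_left_mono) auto
  finally have D1: "1 \<le> D" .
  have cle: "norm (conj_inc z \<eta>) \<le> (1 + \<rho>) * norm \<eta>" for \<eta>
    using norm_conj_inc[of z \<eta>] mult_right_mono[of "1 + norm z" "1 + \<rho>" "norm \<eta>"] assms(3)
    by simp
  have rem: "\<bar>h (z \<odot> \<eta>) - h z - \<alpha> \<eta> - \<beta> \<eta> \<eta>\<bar> \<le> K * r^3"
    if "(1 + \<rho>) * norm \<eta> \<le> r" "r \<le> \<kappa>" for \<eta> r
  proof -
    have "norm (conj_inc z \<eta>) \<le> r" using cle[of \<eta>] that by linarith
    then have "K * norm (conj_inc z \<eta>) ^ 3 \<le> K * r ^ 3"
      using \<open>0 \<le> K\<close> by (intro mult_left_mono power_mono) auto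
    moreover have "norm (conj_inc z \<eta>) \<le> \<kappa>" using \<open>norm (conj_inc z \<eta>) \<le> r\<close> that by linarith
    from ab(4)[OF this] have "\<bar>h (z \<odot> \<eta>) - h z - \<alpha> \<eta> - \<beta> \<eta> \<eta>\<bar> \<le> K * norm (conj_inc z \<eta>) ^ 3"
      by (simp add: conj_inc[of z \<eta>] \<alpha>_def \<beta>_def)
    ultimately show ?thesis by linarith
  qed
  have \<kappa>: "0 < \<kappa>" using D(2) D1 \<open>0 < \<tau>\<close>
    by (smt (verit) mult_pos_pos real_sqrt_gt_zero)
  have jet: "jet h z \<alpha> \<beta>"
  proof (rule jet_cubicI[OF \<alpha> \<beta>, where d = "\<kappa> / (1 + \<rho>)" and K = "K * (1 + \<rho>)^3"])
    fix \<eta> :: 'a assume "norm \<eta> \<le> \<kappa> / (1 + \<rho>)"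
    then have "(1 + \<rho>) * norm \<eta> \<le> \<kappa>" using \<rho> by (simp add: field_simps)
    from rem[OF _ this] show "\<bar>h (z \<odot> \<eta>) - h z - \<alpha> \<eta> - \<beta> \<eta> \<eta>\<bar> \<le> K * (1 + \<rho>)^3 * (norm \<eta>)^3"
      by (simp add: power_mult_distrib mult_ac)
  qed (use \<kappa> \<rho> in auto)
  define t where "t = sqrt \<tau>"
  have t: "0 < t" "t \<le> 1" "\<tau> = t * t" using assms by (auto simp: t_def)
  have tt: "\<tau> \<le> t" using mult_right_mono[OF t(2), of t] t by simp
  have sq: "(D * t)^3 = D^3 * (\<tau> * t)" using t by (simp add: power3_eq_cube mult_ac)
  have step: "\<bar>h (z \<odot> (k *\<^sub>R s - \<tau> *\<^sub>R e)) - h z - \<alpha> (k *\<^sub>R s - \<tau> *\<^sub>R e)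
      - \<beta> (k *\<^sub>R s - \<tau> *\<^sub>R e) (k *\<^sub>R s - \<tau> *\<^sub>R e)\<bar> \<le> K * (D^3 * (\<tau> * t))"
    if "k = 2 * t \<or> k = - (2 * t)" "s = s1 \<or> s = s2" for k s
    unfolding sq[symmetric]
  proof (rule rem)
    have "norm (k *\<^sub>R s - \<tau> *\<^sub>R e) \<le> 2 * t * norm s + \<tau> * norm e"
      using norm_triangle_ineq4[of "k *\<^sub>R s" "\<tau> *\<^sub>R e"] that t \<open>0 < \<tau>\<close> by auto
    also have "\<dots> \<le> 2 * t * norm s + t * norm e"
      using tt by (intro add_left_mono mult_right_mono) auto
    also have "\<dots> = t * (2 * norm s + norm e)" by (simp add: algebra_simps)
    also have "\<dots> \<le> t * (1 + 2 * norm s1 + 2 * norm s2 + norm e)"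
      using that(2) t by (intro mult_left_mono) auto
    finally have "(1 + \<rho>) * norm (k *\<^sub>R s - \<tau> *\<^sub>R e) \<le>
      (1 + \<rho>) * (t * (1 + 2 * norm s1 + 2 * norm s2 + norm e))"
      using \<rho> by (intro mult_left_mono) auto
    then show "(1 + \<rho>) * norm (k *\<^sub>R s - \<tau> *\<^sub>R e) \<le> D * t" unfolding D by (simp add: mult_ac)
    show "D * t \<le> \<kappa>" using D by (simp add: t_def)
  qed
  have "\<bar>\<beta> e e\<bar> \<le> K * ((1 + \<rho>) * norm e)\<^sup>2"
    using order_trans[OF ab(3)[of "conj_inc z e"] mult_left_mono[OF power_mono[OF cle[of e]] \<open>0 \<le> K\<close>]]
    by (simp add: \<beta>_def)
  also have "\<dots> \<le> K * D\<^sup>2"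
    unfolding D using \<rho> \<open>0 \<le> K\<close> by (intro mult_left_mono power_mono) auto
  also have "\<dots> \<le> K * D^3"
    using \<open>0 \<le> K\<close> D1 by (intro mult_left_mono power_increasing) auto
  finally have "\<tau> * \<tau> * \<bar>\<beta> e e\<bar> \<le> (\<tau> * t) * (K * D^3)"
    using tt \<open>0 < \<tau>\<close> t by (intro mult_mono) auto
  then have bee: "\<bar>\<tau> * \<tau> * \<beta> e e\<bar> \<le> K * (D^3 * (\<tau> * t))"
    by (simp add: abs_mult mult_ac)
  have ex: "\<alpha> (k *\<^sub>R s - \<tau> *\<^sub>R e) = k * \<alpha> s - \<tau> * \<alpha> e"
    "\<beta> (k *\<^sub>R s - \<tau> *\<^sub>R e) (k *\<^sub>R s - \<tau> *\<^sub>R e) =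
      k * k * \<beta> s s - k * \<tau> * \<beta> s e - k * \<tau> * \<beta> e s + \<tau> * \<tau> * \<beta> e e" for k s
    by (simp_all add: \<alpha>.diff \<alpha>.scaleR \<beta>.diff_left \<beta>.diff_right \<beta>.scaleR_left \<beta>.scaleR_right algebra_simps)
  have kk: "2 * t * (2 * t) = 4 * \<tau>" "- (2 * t) * - (2 * t) = 4 * \<tau>" using t by auto
  define R where "R k s = h (z \<odot> (k *\<^sub>R s - \<tau> *\<^sub>R e)) - h z - (k * \<alpha> s - \<tau> * \<alpha> e)
      - (k * k * \<beta> s s - k * \<tau> * \<beta> s e - k * \<tau> * \<beta> e s + \<tau> * \<tau> * \<beta> e e)" for k s
  have R: "\<bar>R k s\<bar> \<le> K * (D^3 * (\<tau> * t))"
    if "k = 2 * t \<or> k = - (2 * t)" "s = s1 \<or> s = s2" for k s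
    using step[OF that] unfolding ex R_def .
  have R4: "\<bar>R (2 * t) s1\<bar> \<le> K * (D^3 * (\<tau> * t))" "\<bar>R (- (2 * t)) s1\<bar> \<le> K * (D^3 * (\<tau> * t))"
    "\<bar>R (2 * t) s2\<bar> \<le> K * (D^3 * (\<tau> * t))" "\<bar>R (- (2 * t)) s2\<bar> \<le> K * (D^3 * (\<tau> * t))"
    by (simp_all add: R)
  have hR: "h (z \<odot> (k *\<^sub>R s - \<tau> *\<^sub>R e)) = R k s + h z + k * \<alpha> s - \<tau> * \<alpha> e
      + k * k * \<beta> s s - k * \<tau> * \<beta> s e - k * \<tau> * \<beta> e s + \<tau> * \<tau> * \<beta> e e" for k s
    by (simp add: R_def)
  have "walk \<tau> h z - h z + \<tau> * par \<alpha> \<beta> = (R (2 * t) s1 + R (- (2 * t)) s1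
      + R (2 * t) s2 + R (- (2 * t)) s2) / 4 + \<tau> * \<tau> * \<beta> e e"
    unfolding walk_def par_def t_def[symmetric] hR kk by (simp add: field_simps)
  moreover have "\<bar>(p + q + r + w) / 4 + x\<bar> \<le> 2 * B"
    if "\<bar>p\<bar> \<le> B" "\<bar>q\<bar> \<le> B" "\<bar>r\<bar> \<le> B" "\<bar>w\<bar> \<le> B" "\<bar>x\<bar> \<le> B" for p q r w x B :: real
    using that by (auto simp: abs_le_iff field_simps)
  ultimately have "\<bar>walk \<tau> h z - h z + \<tau> * par \<alpha> \<beta>\<bar> \<le> 2 * (K * (D^3 * (\<tau> * t)))"
    using bee R4 by presburger
  then show ?thesis using jet by (intro exI[of _ \<alpha>] exI[of _ \<beta>]) (simp add: t_def mult_ac)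
qed

text \<open>Since \<open>walk\<close> averages right translates, the iteration solving the discrete resolvent
  equation stays in the convex, right-invariant class \<open>left_jets\<close>; this replaces all regularity
  theory for the degenerate operator.\<close>

lemma approximate_resolvent:
  assumes g: "left_jets K \<kappa> g" "continuous_on UNIV g" "\<And>z. \<bar>g z\<bar> \<le> M"
    and pos: "0 \<le> K" "0 < \<kappa>" "0 < \<mu>" "0 < \<delta>" "0 \<le> \<rho>"
  shows "\<exists>h. continuous_on UNIV h \<and> (\<forall>z. \<bar>h z\<bar> \<le> M) \<and>
    (\<forall>z. norm z \<le> \<rho> \<longrightarrow> (\<exists>\<alpha> \<beta>. jet h z \<alpha> \<beta> \<and> \<bar>h z + \<mu> * par \<alpha> \<beta> - g z\<bar> \<le> \<delta>))"
proof -
  define D where "D = (1 + \<rho>) * (1 + 2 * norm s1 + 2 * norm s2 + norm e)"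
  have "1 \<le> (1 + \<rho>) * 1" using pos by simp
  also have "\<dots> \<le> D" unfolding D_def using pos by (intro mult_left_mono) auto
  finally have D1: "1 \<le> D" .
  \<comment> \<open>This is the square root of the time step. The entry \<open>\<kappa> / D\<close>
    keeps all steps within the range of the Taylor bound; the last one makes the consistency error,
    multiplied by \<mu> / \<tau>, at most \<delta> / 2.\<close>
  define t where "t = Min {1, \<kappa> / D, \<delta> / (2 * (\<mu> * (2 * K * D^3) + 1))}"
  have den: "0 < \<mu> * (2 * K * D^3) + 1"
    using pos D1 by (smt (verit) mult_nonneg_nonneg zero_le_power)
  have t: "0 < t" "t \<le> 1" "t \<le> \<kappa> / D" "t \<le> \<delta> / (2 * (\<mu> * (2 * K * D^3) + 1))"
    using pos D1 den by (auto simp: t_def)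
  define \<tau> where "\<tau> = t * t"
  have \<tau>: "0 < \<tau>" "\<tau> \<le> 1" "sqrt \<tau> = t" using t by (auto simp: \<tau>_def mult_le_one)
  have Dt: "D * sqrt \<tau> \<le> \<kappa>" using t D1 \<tau> by (simp add: field_simps)
  have small: "\<mu> * (2 * K * D^3 * t) \<le> \<delta> / 2"
  proof -
    have "t * (2 * (\<mu> * (2 * K * D^3) + 1)) \<le> \<delta>"
      using t(4) den by (simp add: field_simps)
    then show ?thesis using t by (simp add: algebra_simps)
  qed
  \<comment> \<open>Replacing \<open>par\<close> by the difference quotient
    \<open>(h - walk \<tau> h) / \<tau>\<close> turns the resolvent equation into the fixed point
    equation \<open>h = (1 - q) * g + q * walk \<tau> h\<close>, a contraction with ratio
    \<open>q\<close> in the supremum norm.\<close>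
  define q where "q = \<mu> / (\<mu> + \<tau>)"
  have q: "0 < q" "q < 1" using pos \<tau> by (auto simp: q_def)
  define H where "H n = ((\<lambda>h z. (1 - q) * g z + q * walk \<tau> h z) ^^ n) g" for n
  have H0: "H 0 = g" and HS: "H (Suc n) = (\<lambda>z. (1 - q) * g z + q * walk \<tau> (H n) z)" for n
    by (simp_all add: H_def)
  have Hj: "left_jets K \<kappa> (H n)" for n
    by (induction n) (use g q in \<open>auto simp: H0 HS intro!: left_jets_convex left_jets_walk\<close>)
  have Hc: "continuous_on UNIV (H n)" for n
    by (induction n) (use g in \<open>auto simp: H0 HS intro!: continuous_intros continuous_walk\<close>)
  have Hb: "\<bar>H n z\<bar> \<le> M" for n z
  proof (induction n arbitrary: z)
    case (Suc n)
    have "\<bar>H (Suc n) z\<bar> \<le> (1 - q) * \<bar>g z\<bar> + q * \<bar>walk \<tau> (H n) z\<bar>"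
      unfolding HS using abs_triangle_ineq[of "(1 - q) * g z" "q * walk \<tau> (H n) z"] q
      by (simp add: abs_mult)
    also have "\<dots> \<le> (1 - q) * M + q * M"
      using q g Suc by (intro add_mono mult_left_mono walk_bound) auto
    finally show ?case by (simp add: algebra_simps)
  qed (simp add: H0 g)
  have Hd: "\<bar>H (Suc n) z - H n z\<bar> \<le> q ^ n * (2 * M)" for n z
  proof (induction n arbitrary: z)
    case 0
    show ?case using Hb[of "Suc 0" z] Hb[of 0 z] by (auto simp: abs_le_iff)
  next
    case (Suc n)
    have "H (Suc (Suc n)) z - H (Suc n) z = q * walk \<tau> (\<lambda>x. H (Suc n) x - H n x) z"
      by (subst (1 2) HS) (simp flip: walk_diff add: algebra_simps)
    then have "\<bar>H (Suc (Suc n)) z - H (Suc n) z\<bar> = q * \<bar>walk \<tau> (\<lambda>x. H (Suc n) x - H n x) z\<bar>"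
      using q by (simp add: abs_mult)
    also have "\<dots> \<le> q * (q ^ n * (2 * M))"
      using q Suc by (intro mult_left_mono walk_bound) auto
    finally show ?case by (simp add: mult_ac)
  qed
  \<comment> \<open>A finite iterate is enough, and it inherits the constants of \<open>g\<close>:
    the defect in the fixed point equation, magnified by (\<mu> + \<tau>) / \<tau>, only has to drop
    below \<delta> / 2.\<close>
  have "(\<lambda>n. (\<mu> + \<tau>) / \<tau> * (q ^ n * (2 * M))) \<longlonglongrightarrow> (\<mu> + \<tau>) / \<tau> * (0 * (2 * M))"
    using q by (intro tendsto_intros LIMSEQ_power_zero) auto
  then have "\<forall>\<^sub>F n in sequentially. (\<mu> + \<tau>) / \<tau> * (q ^ n * (2 * M)) < \<delta> / 2"
    using pos by (intro order_tendstoD) auto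
  then obtain n where n: "(\<mu> + \<tau>) / \<tau> * (q ^ n * (2 * M)) < \<delta> / 2"
    by (auto simp: eventually_sequentially)
  show ?thesis
  proof (rule exI[of _ "H n"], intro conjI allI impI Hc Hb)
    fix z :: 'a assume z: "norm z \<le> \<rho>"
    obtain \<alpha> \<beta> where jet: "jet (H n) z \<alpha> \<beta>"
      and c: "\<bar>walk \<tau> (H n) z - H n z + \<tau> * par \<alpha> \<beta>\<bar> \<le> 2 * K * D^3 * (\<tau> * t)"
      using walk_consistent[OF Hj pos(1) z \<tau>(1,2) D_def Dt, unfolded \<tau>(3)] by blast
    have "\<mu> / \<tau> * \<bar>walk \<tau> (H n) z - H n z + \<tau> * par \<alpha> \<beta>\<bar> \<le> \<mu> / \<tau> * (2 * K * D^3 * (\<tau> * t))"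
      using c pos \<tau> by (intro mult_left_mono) auto
    also have "\<dots> = \<mu> * (2 * K * D^3 * t)" using \<tau> by simp
    finally have 1: "\<mu> / \<tau> * \<bar>walk \<tau> (H n) z - H n z + \<tau> * par \<alpha> \<beta>\<bar> \<le> \<delta> / 2" using small by linarith
    have "(\<mu> + \<tau>) / \<tau> * \<bar>H (Suc n) z - H n z\<bar> \<le> (\<mu> + \<tau>) / \<tau> * (q ^ n * (2 * M))"
      using Hd pos \<tau> by (intro mult_left_mono) auto
    with n have 2: "(\<mu> + \<tau>) / \<tau> * \<bar>H (Suc n) z - H n z\<bar> \<le> \<delta> / 2" by linarith
    have "(\<mu> + \<tau>) * H (Suc n) z = \<tau> * g z + \<mu> * walk \<tau> (H n) z"
    proof -
      have qm: "(\<mu> + \<tau>) * q = \<mu>" using pos \<tau> by (simp add: q_def)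
      have "(\<mu> + \<tau>) * H (Suc n) z =
        ((\<mu> + \<tau>) - (\<mu> + \<tau>) * q) * g z + ((\<mu> + \<tau>) * q) * walk \<tau> (H n) z"
        by (simp add: HS algebra_simps)
      then show ?thesis unfolding qm by simp
    qed
    then have eq: "H n z + \<mu> * par \<alpha> \<beta> - g z =
      \<mu> / \<tau> * (walk \<tau> (H n) z - H n z + \<tau> * par \<alpha> \<beta>) - (\<mu> + \<tau>) / \<tau> * (H (Suc n) z - H n z)"
      using \<tau> by (simp add: field_simps)
    have "\<bar>H n z + \<mu> * par \<alpha> \<beta> - g z\<bar> \<le> \<mu> / \<tau> * \<bar>walk \<tau> (H n) z - H n z + \<tau> * par \<alpha> \<beta>\<bar>
        + (\<mu> + \<tau>) / \<tau> * \<bar>H (Suc n) z - H n z\<bar>"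
      unfolding eq using abs_triangle_ineq4[of "\<mu> / \<tau> * (walk \<tau> (H n) z - H n z + \<tau> * par \<alpha> \<beta>)"
          "(\<mu> + \<tau>) / \<tau> * (H (Suc n) z - H n z)"] pos \<tau>
      by (simp add: abs_mult)
    with 1 2 have "\<bar>H n z + \<mu> * par \<alpha> \<beta> - g z\<bar> \<le> \<delta>" by linarith
    with jet show "\<exists>\<alpha> \<beta>. jet (H n) z \<alpha> \<beta> \<and> \<bar>H n z + \<mu> * par \<alpha> \<beta> - g z\<bar> \<le> \<delta>" by blast
  qed
qed

end

section \<open>Approximation of continuous functions\<close>

text \<open>The Euclidean counterpart of \<open>left_jets\<close>, for base points in a ball. Values
  and linear parts are bounded as well, which makes the class stable under products.\<close>

definition local_jets :: "real \<Rightarrow> real \<Rightarrow> ('a::real_normed_vector \<Rightarrow> real) \<Rightarrow> bool"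
  where "local_jets K R F \<longleftrightarrow> (\<forall>z. norm z \<le> R \<longrightarrow> \<bar>F z\<bar> \<le> K \<and>
    (\<exists>\<alpha> \<beta>. bounded_linear \<alpha> \<and> bounded_bilinear \<beta> \<and>
      (\<forall>e. \<bar>\<alpha> e\<bar> \<le> K * norm e) \<and> (\<forall>e. \<bar>\<beta> e e\<bar> \<le> K * (norm e)\<^sup>2) \<and>
      (\<forall>e. norm e \<le> 1 \<longrightarrow> \<bar>F (z + e) - F z - \<alpha> e - \<beta> e e\<bar> \<le> K * (norm e)^3)))"

lemma local_jetsE:
  assumes "local_jets K R F" "norm z \<le> R"
  obtains \<alpha> \<beta> where "\<bar>F z\<bar> \<le> K" "bounded_linear \<alpha>" "bounded_bilinear \<beta>"
    "\<And>e. \<bar>\<alpha> e\<bar> \<le> K * norm e" "\<And>e. \<bar>\<beta> e e\<bar> \<le> K * (norm e)\<^sup>2"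
    "\<And>e. norm e \<le> 1 \<Longrightarrow> \<bar>F (z + e) - F z - \<alpha> e - \<beta> e e\<bar> \<le> K * (norm e)^3"
  using assms unfolding local_jets_def by auto

lemma local_jets_mono: "local_jets K R F \<Longrightarrow> K \<le> K' \<Longrightarrow> local_jets K' R F"
  unfolding local_jets_def
  by (smt (verit) mult_right_mono norm_ge_zero zero_le_power)

lemma local_jets_add:
  assumes "local_jets K R F" "local_jets L R G"
  shows "local_jets (K + L) R (\<lambda>z. F z + G z)"
  unfolding local_jets_def
proof (intro allI impI)
  fix z :: 'a assume z: "norm z \<le> R"
  obtain \<alpha> \<beta> where F: "\<bar>F z\<bar> \<le> K" "bounded_linear \<alpha>" "bounded_bilinear \<beta>"
    "\<And>e. \<bar>\<alpha> e\<bar> \<le> K * norm e" "\<And>e. \<bar>\<beta> e e\<bar> \<le> K * (norm e)\<^sup>2"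
    "\<And>e. norm e \<le> 1 \<Longrightarrow> \<bar>F (z + e) - F z - \<alpha> e - \<beta> e e\<bar> \<le> K * (norm e)^3"
    by (rule local_jetsE[OF assms(1) z]) auto
  obtain \<alpha>' \<beta>' where G: "\<bar>G z\<bar> \<le> L" "bounded_linear \<alpha>'" "bounded_bilinear \<beta>'"
    "\<And>e. \<bar>\<alpha>' e\<bar> \<le> L * norm e" "\<And>e. \<bar>\<beta>' e e\<bar> \<le> L * (norm e)\<^sup>2"
    "\<And>e. norm e \<le> 1 \<Longrightarrow> \<bar>G (z + e) - G z - \<alpha>' e - \<beta>' e e\<bar> \<le> L * (norm e)^3"
    by (rule local_jetsE[OF assms(2) z]) auto
  have tri: "\<bar>a + b\<bar> \<le> (K + L) * x" if "\<bar>a\<bar> \<le> K * x" "\<bar>b\<bar> \<le> L * x" for a b x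
    using that abs_triangle_ineq[of a b] by (simp add: distrib_right)
  show "\<bar>F z + G z\<bar> \<le> K + L \<and> (\<exists>\<alpha> \<beta>. bounded_linear \<alpha> \<and> bounded_bilinear \<beta> \<and>
      (\<forall>e. \<bar>\<alpha> e\<bar> \<le> (K + L) * norm e) \<and> (\<forall>e. \<bar>\<beta> e e\<bar> \<le> (K + L) * (norm e)\<^sup>2) \<and>
      (\<forall>e. norm e \<le> 1 \<longrightarrow> \<bar>F (z + e) + G (z + e) - (F z + G z) - \<alpha> e - \<beta> e e\<bar> \<le> (K + L) * (norm e)^3))"
  proof (rule conjI, use F(1) G(1) in linarith, rule exI[of _ "\<lambda>e. \<alpha> e + \<alpha>' e"],
      rule exI[of _ "\<lambda>e d. \<beta> e d + \<beta>' e d"], intro conjI allI impI)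
    fix e :: 'a assume "norm e \<le> 1"
    from tri[OF F(6)[OF this] G(6)[OF this]]
    show "\<bar>F (z + e) + G (z + e) - (F z + G z) - (\<alpha> e + \<alpha>' e) - (\<beta> e e + \<beta>' e e)\<bar> \<le> (K + L) * norm e ^ 3"
      by (simp add: algebra_simps)
  qed (use F G in \<open>auto intro: tri bounded_linear_add bounded_bilinear_add\<close>)
qed

lemma jet_increment_bounds:
  fixes a b r K n :: real
  assumes "\<bar>a\<bar> \<le> K * n" "\<bar>b\<bar> \<le> K * n\<^sup>2" "\<bar>r\<bar> \<le> K * n^3" "0 \<le> n" "n \<le> 1" "0 \<le> K"
  shows "\<bar>a + b + r\<bar> \<le> 3 * K * n" "\<bar>b + r\<bar> \<le> 2 * K * n\<^sup>2"
proof -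
  have "n^3 \<le> n\<^sup>2" "n\<^sup>2 \<le> n"
    using assms power_decreasing[of 2 3 n] power_decreasing[of 1 2 n] by auto
  then have "K * n^3 \<le> K * n\<^sup>2" "K * n\<^sup>2 \<le> K * n"
    using assms by (auto intro: mult_left_mono)
  then show "\<bar>a + b + r\<bar> \<le> 3 * K * n" "\<bar>b + r\<bar> \<le> 2 * K * n\<^sup>2"
    using assms by linarith+
qed

lemma abs_mult_le:
  fixes a b A B :: real
  assumes "\<bar>a\<bar> \<le> A" "\<bar>b\<bar> \<le> B"
  shows "\<bar>a * b\<bar> \<le> A * B"
  unfolding abs_mult by (intro mult_mono assms) (use assms in auto)

text \<open>After the jet of the product has been removed, four terms of third order remain; their
  constants 1, 1, 6 and 2 add up to 10.\<close>

lemma local_jets_mult: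
  assumes "local_jets K R F" "local_jets K R G" "0 \<le> K"
  shows "local_jets (10 * K\<^sup>2) R (\<lambda>z. F z * G z)"
  unfolding local_jets_def
proof (intro allI impI)
  fix z :: 'a assume z: "norm z \<le> R"
  obtain \<alpha> \<beta> where F: "\<bar>F z\<bar> \<le> K" "bounded_linear \<alpha>" "bounded_bilinear \<beta>"
    "\<And>e. \<bar>\<alpha> e\<bar> \<le> K * norm e" "\<And>e. \<bar>\<beta> e e\<bar> \<le> K * (norm e)\<^sup>2"
    "\<And>e. norm e \<le> 1 \<Longrightarrow> \<bar>F (z + e) - F z - \<alpha> e - \<beta> e e\<bar> \<le> K * (norm e)^3"
    by (rule local_jetsE[OF assms(1) z]) auto
  obtain \<alpha>' \<beta>' where G: "\<bar>G z\<bar> \<le> K" "bounded_linear \<alpha>'" "bounded_bilinear \<beta>'"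
    "\<And>e. \<bar>\<alpha>' e\<bar> \<le> K * norm e" "\<And>e. \<bar>\<beta>' e e\<bar> \<le> K * (norm e)\<^sup>2"
    "\<And>e. norm e \<le> 1 \<Longrightarrow> \<bar>G (z + e) - G z - \<alpha>' e - \<beta>' e e\<bar> \<le> K * (norm e)^3"
    by (rule local_jetsE[OF assms(2) z]) auto
  note prod = abs_mult_le
  have FG: "\<bar>F z * y\<bar> \<le> K * Y" "\<bar>G z * y\<bar> \<le> K * Y" if "\<bar>y\<bar> \<le> Y" for y Y
    using prod[OF F(1) that] prod[OF G(1) that] by auto
  show "\<bar>F z * G z\<bar> \<le> 10 * K\<^sup>2 \<and> (\<exists>\<alpha> \<beta>. bounded_linear \<alpha> \<and> bounded_bilinear \<beta> \<and>
      (\<forall>e. \<bar>\<alpha> e\<bar> \<le> 10 * K\<^sup>2 * norm e) \<and> (\<forall>e. \<bar>\<beta> e e\<bar> \<le> 10 * K\<^sup>2 * (norm e)\<^sup>2) \<and>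
      (\<forall>e. norm e \<le> 1 \<longrightarrow> \<bar>F (z + e) * G (z + e) - F z * G z - \<alpha> e - \<beta> e e\<bar> \<le> 10 * K\<^sup>2 * (norm e)^3))"
  proof (rule conjI, goal_cases)
    case 1
    have "\<bar>F z * G z\<bar> \<le> K\<^sup>2" using FG(1)[OF G(1)] by (simp add: power2_eq_square)
    then show ?case by (smt (verit) zero_le_power2)
  next
    case 2
    show ?case
    proof (rule exI[of _ "\<lambda>e. F z * \<alpha>' e + G z * \<alpha> e"],
        rule exI[of _ "\<lambda>e d. F z * \<beta>' e d + G z * \<beta> e d + \<alpha> e * \<alpha>' d"], intro conjI allI impI)
      show "bounded_linear (\<lambda>e. F z * \<alpha>' e + G z * \<alpha> e)"
        using F G by (intro bounded_linear_add bounded_linear_const_mult)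
      show "bounded_bilinear (\<lambda>e d. F z * \<beta>' e d + G z * \<beta> e d + \<alpha> e * \<alpha>' d)"
        using F G by (intro bounded_bilinear_add bounded_bilinear_const_mult bounded_bilinear_product)
      fix e :: 'a
      let ?n = "norm e"
      have nn: "0 \<le> K\<^sup>2 * ?n" "0 \<le> K\<^sup>2 * ?n\<^sup>2" by auto
      have "\<bar>F z * \<alpha>' e + G z * \<alpha> e\<bar> \<le> K * (K * ?n) + K * (K * ?n)"
        using FG(1)[OF G(4)[of e]] FG(2)[OF F(4)[of e]] by linarith
      then show "\<bar>F z * \<alpha>' e + G z * \<alpha> e\<bar> \<le> 10 * K\<^sup>2 * ?n"
        using nn by (simp add: power2_eq_square mult_ac)
      have "\<bar>F z * \<beta>' e e + G z * \<beta> e e + \<alpha> e * \<alpha>' e\<bar> \<le> K * (K * ?n\<^sup>2) + K * (K * ?n\<^sup>2) + K * ?n * (K * ?n)"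
        using FG(1)[OF G(5)[of e]] FG(2)[OF F(5)[of e]] prod[OF F(4)[of e] G(4)[of e]] by linarith
      then show "\<bar>F z * \<beta>' e e + G z * \<beta> e e + \<alpha> e * \<alpha>' e\<bar> \<le> 10 * K\<^sup>2 * ?n\<^sup>2"
        using nn by (simp add: power2_eq_square mult_ac)
      assume e1: "?n \<le> 1"
      define r where "r = F (z + e) - F z - \<alpha> e - \<beta> e e"
      define r' where "r' = G (z + e) - G z - \<alpha>' e - \<beta>' e e"
      note rF = F(6)[OF e1, folded r_def] and rG = G(6)[OF e1, folded r'_def]
      note bF = jet_increment_bounds[OF F(4) F(5) rF norm_ge_zero e1 assms(3)]
      note bG = jet_increment_bounds[OF G(4) G(5) rG norm_ge_zero e1 assms(3)]
      have "F (z + e) * G (z + e) - F z * G z - (F z * \<alpha>' e + G z * \<alpha> e)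
          - (F z * \<beta>' e e + G z * \<beta> e e + \<alpha> e * \<alpha>' e)
        = F z * r' + G z * r + (\<beta> e e + r) * (\<alpha>' e + \<beta>' e e + r') + \<alpha> e * (\<beta>' e e + r')"
        by (simp add: r_def r'_def algebra_simps)
      also have "\<bar>\<dots>\<bar> \<le> K * (K * ?n^3) + K * (K * ?n^3) + 2 * K * ?n\<^sup>2 * (3 * K * ?n) + K * ?n * (2 * K * ?n\<^sup>2)"
        using FG(1)[OF rG] FG(2)[OF rF] prod[OF bF(2) bG(1)] prod[OF F(4)[of e] bG(2)] by linarith
      also have "\<dots> = 10 * K\<^sup>2 * ?n^3"
        by (simp add: power2_eq_square power3_eq_cube)
      finally show "\<bar>F (z + e) * G (z + e) - F z * G z - (F z * \<alpha>' e + G z * \<alpha> e)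
          - (F z * \<beta>' e e + G z * \<beta> e e + \<alpha> e * \<alpha>' e)\<bar> \<le> 10 * K\<^sup>2 * ?n^3" .
    qed
  qed
qed

text \<open>The second derivative of the cubed positive part is 6 times the positive part, hence
  Lipschitz with constant 6 even across the kink. This is the smallest integer power with a cubic
  Taylor remainder.\<close>

lemma cube_pos_part_taylor:
  fixes s d :: real
  shows "\<bar>(max 0 (s + d))^3 - (max 0 s)^3 - 3 * (max 0 s)\<^sup>2 * d - 3 * max 0 s * d\<^sup>2\<bar> \<le> \<bar>d\<bar>^3"
proof -
  have mono: "x^3 \<le> y^3" if "0 \<le> x" "x \<le> y" for x y :: real
    using that by (intro power_mono)
  have cube: "(s + d)^3 = s^3 + 3 * s\<^sup>2 * d + 3 * s * d\<^sup>2 + d^3"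
    by (simp add: power3_eq_cube power2_eq_square algebra_simps)
  consider "0 \<le> s" "0 \<le> s + d" | "0 \<le> s" "s + d < 0" | "s < 0" "0 \<le> s + d" | "s < 0" "s + d < 0"
    by linarith
  then show ?thesis
  proof cases
    case 1
    then have "(max 0 (s + d))^3 - (max 0 s)^3 - 3 * (max 0 s)\<^sup>2 * d - 3 * max 0 s * d\<^sup>2 = d^3"
      using cube by simp
    then show ?thesis by (simp add: power_abs)
  next
    case 2
    have "(max 0 (s + d))^3 - (max 0 s)^3 - 3 * (max 0 s)\<^sup>2 * d - 3 * max 0 s * d\<^sup>2 = d^3 - (s + d)^3"
      using 2 cube by simp
    also have "\<dots> = (- (s + d))^3 - (- d)^3"
      by (simp add: power3_eq_cube algebra_simps)
    finally have eq: "(max 0 (s + d))^3 - (max 0 s)^3 - 3 * (max 0 s)\<^sup>2 * d - 3 * max 0 s * d\<^sup>2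
      = (- (s + d))^3 - (- d)^3" .
    have "(- (s + d))^3 \<le> (- d)^3" "0 \<le> (- (s + d))^3" "\<bar>d\<bar>^3 = (- d)^3"
      using 2 by (auto intro!: mono simp del: power_minus_odd)
    then show ?thesis unfolding eq by linarith
  next
    case 3
    then have "(s + d)^3 \<le> \<bar>d\<bar>^3" "0 \<le> (s + d)^3" by (auto intro!: mono)
    then show ?thesis using 3 by (simp add: max_def)
  qed simp
qed

text \<open>The constant is 27 + 3 + 24: the cube of the increment bound \<open>3 * K\<close>, the
  remainder of \<open>F\<close>, and the error made by replacing the squared increment by the
  squared linear part.\<close>

lemma local_jets_cube_pos_part:
  assumes "local_jets K R F" "0 \<le> K"
  shows "local_jets (54 * K^3) R (\<lambda>z. (max 0 (F z))^3)"
  unfolding local_jets_def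
proof (intro allI impI)
  fix z :: 'a assume z: "norm z \<le> R"
  obtain \<alpha> \<beta> where F: "\<bar>F z\<bar> \<le> K" "bounded_linear \<alpha>" "bounded_bilinear \<beta>"
    "\<And>e. \<bar>\<alpha> e\<bar> \<le> K * norm e" "\<And>e. \<bar>\<beta> e e\<bar> \<le> K * (norm e)\<^sup>2"
    "\<And>e. norm e \<le> 1 \<Longrightarrow> \<bar>F (z + e) - F z - \<alpha> e - \<beta> e e\<bar> \<le> K * (norm e)^3"
    by (rule local_jetsE[OF assms(1) z]) auto
  define s where "s = max 0 (F z)"
  have s: "0 \<le> s" "s \<le> K" using F(1) by (auto simp: s_def)
  note prod = abs_mult_le
  have s3: "\<bar>3 * s * y\<bar> \<le> 3 * K * Y" "\<bar>3 * s\<^sup>2 * y\<bar> \<le> 3 * K\<^sup>2 * Y" if "\<bar>y\<bar> \<le> Y" for y Y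
    using s that power_mono[OF s(2,1), of 2] by (auto intro!: prod)
  have K3: "0 \<le> K^3" using assms(2) by simp
  show "\<bar>(max 0 (F z))^3\<bar> \<le> 54 * K^3 \<and> (\<exists>\<alpha> \<beta>. bounded_linear \<alpha> \<and> bounded_bilinear \<beta> \<and>
      (\<forall>e. \<bar>\<alpha> e\<bar> \<le> 54 * K^3 * norm e) \<and> (\<forall>e. \<bar>\<beta> e e\<bar> \<le> 54 * K^3 * (norm e)\<^sup>2) \<and>
      (\<forall>e. norm e \<le> 1 \<longrightarrow> \<bar>(max 0 (F (z + e)))^3 - (max 0 (F z))^3 - \<alpha> e - \<beta> e e\<bar> \<le> 54 * K^3 * (norm e)^3))"
    unfolding s_def[symmetric]
  proof (rule conjI, goal_cases)
    case 1
    have "\<bar>s^3\<bar> \<le> K^3" using s by (simp add: power_mono)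
    then show ?case using K3 by linarith
  next
    case 2
    show ?case
    proof (rule exI[of _ "\<lambda>e. 3 * s\<^sup>2 * \<alpha> e"],
        rule exI[of _ "\<lambda>e d. 3 * s\<^sup>2 * \<beta> e d + 3 * s * (\<alpha> e * \<alpha> d)"], intro conjI allI impI)
      show "bounded_linear (\<lambda>e. 3 * s\<^sup>2 * \<alpha> e)"
        using F by (intro bounded_linear_const_mult)
      show "bounded_bilinear (\<lambda>e d. 3 * s\<^sup>2 * \<beta> e d + 3 * s * (\<alpha> e * \<alpha> d))"
        using F by (intro bounded_bilinear_add bounded_bilinear_const_mult bounded_bilinear_product)
      fix e :: 'a
      let ?n = "norm e"
      have nn: "0 \<le> K^3 * ?n" "0 \<le> K^3 * ?n\<^sup>2" using K3 by auto
      show "\<bar>3 * s\<^sup>2 * \<alpha> e\<bar> \<le> 54 * K^3 * ?n"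
        using s3(2)[OF F(4)[of e]] nn by (simp add: power2_eq_square power3_eq_cube mult_ac)
      have "\<bar>3 * s\<^sup>2 * \<beta> e e + 3 * s * (\<alpha> e * \<alpha> e)\<bar> \<le> 3 * K\<^sup>2 * (K * ?n\<^sup>2) + 3 * K * (K * ?n * (K * ?n))"
        using s3(2)[OF F(5)[of e]] s3(1)[OF prod[OF F(4)[of e] F(4)[of e]]] by linarith
      then show "\<bar>3 * s\<^sup>2 * \<beta> e e + 3 * s * (\<alpha> e * \<alpha> e)\<bar> \<le> 54 * K^3 * ?n\<^sup>2"
        using nn by (simp add: power2_eq_square power3_eq_cube mult_ac)
      assume e1: "?n \<le> 1"
      define r where "r = F (z + e) - F z - \<alpha> e - \<beta> e e"
      note rF = F(6)[OF e1, folded r_def]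
      note bF = jet_increment_bounds[OF F(4) F(5) rF norm_ge_zero e1 assms(2)]
      define f where "f = \<alpha> e + \<beta> e e + r"
      have Ff: "F (z + e) = F z + f" by (simp add: f_def r_def)
      define E where "E = (max 0 (F z + f))^3 - s^3 - 3 * s\<^sup>2 * f - 3 * s * f\<^sup>2"
      have "\<bar>E\<bar> \<le> \<bar>f\<bar>^3" unfolding E_def s_def by (rule cube_pos_part_taylor)
      also have "\<dots> \<le> (3 * K * ?n)^3" using bF(1) unfolding f_def by (intro power_mono) auto
      finally have E: "\<bar>E\<bar> \<le> 27 * (K^3 * ?n^3)" by (simp add: power_mult_distrib)
      have ff: "\<bar>(\<beta> e e + r) * (\<alpha> e + (\<alpha> e + \<beta> e e + r))\<bar> \<le> 2 * K * ?n\<^sup>2 * (K * ?n + 3 * K * ?n)"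
        using bF F(4)[of e] by (intro prod) linarith+
      have "(max 0 (F z + f))^3 - s^3 - 3 * s\<^sup>2 * \<alpha> e - (3 * s\<^sup>2 * \<beta> e e + 3 * s * (\<alpha> e * \<alpha> e))
        = E + 3 * s\<^sup>2 * r + 3 * s * ((\<beta> e e + r) * (\<alpha> e + (\<alpha> e + \<beta> e e + r)))"
        by (simp add: E_def f_def algebra_simps power2_eq_square)
      also have "\<bar>\<dots>\<bar> \<le> 27 * (K^3 * ?n^3) + 3 * K\<^sup>2 * (K * ?n^3)
        + 3 * K * (2 * K * ?n\<^sup>2 * (K * ?n + 3 * K * ?n))"
        using E s3(2)[OF rF] s3(1)[OF ff] by linarith
      also have "\<dots> = 54 * K^3 * ?n^3"
        by (simp add: power2_eq_square power3_eq_cube algebra_simps)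
      finally show "\<bar>(max 0 (F (z + e)))^3 - s^3 - 3 * s\<^sup>2 * \<alpha> e - (3 * s\<^sup>2 * \<beta> e e + 3 * s * (\<alpha> e * \<alpha> e))\<bar>
        \<le> 54 * K^3 * ?n^3" unfolding Ff .
    qed
  qed
qed

lemma local_jets_polynomial:
  assumes "real_polynomial_function p"
  shows "\<exists>K\<ge>0. local_jets K R p"
  using assms
proof induction
  case (linear f)
  then obtain B where B: "0 \<le> B" "\<And>x. norm (f x) \<le> norm x * B"
    using bounded_linear.nonneg_bounded by blast
  define K where "K = B + B * \<bar>R\<bar>"
  have "B \<le> K" using B by (simp add: K_def)
  have "\<bar>f z\<bar> \<le> K" if "norm z \<le> R" for z
  proof -
    have "\<bar>f z\<bar> \<le> norm z * B" using B(2)[of z] by simp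
    also have "\<dots> \<le> \<bar>R\<bar> * B" using that B by (intro mult_right_mono) auto
    finally show ?thesis using B by (simp add: K_def mult.commute)
  qed
  moreover have "\<bar>f e\<bar> \<le> K * norm e" for e
    using B(2)[of e] mult_right_mono[OF \<open>B \<le> K\<close>, of "norm e"] by (simp add: mult.commute)
  moreover have "0 \<le> K" using B \<open>B \<le> K\<close> by linarith
  moreover have "f (z + e) = f z + f e" for z e
    using linear by (simp add: bounded_linear.linear linear_add)
  ultimately have "local_jets K R f"
    unfolding local_jets_def using linear
    by (intro allI impI conjI exI[of _ f] exI[of _ "\<lambda>x y. 0"]) (auto simp: bounded_bilinear_zero)
  with \<open>0 \<le> K\<close> show ?case by blast
next
  case (const k)
  have "local_jets \<bar>k\<bar> R (\<lambda>x::'a. k)"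
    unfolding local_jets_def
    by (intro allI impI conjI exI[of _ "\<lambda>x. 0"] exI[of _ "\<lambda>x y. 0"])
      (auto simp: bounded_bilinear_zero)
  then show ?case using abs_ge_zero by blast
next
  case (add f g)
  then obtain K L where "K \<ge> 0" "L \<ge> 0" "local_jets K R f" "local_jets L R g" by blast
  then show ?case using local_jets_add by (intro exI[of _ "K + L"]) auto
next
  case (mult f g)
  then obtain K L where "K \<ge> 0" "L \<ge> 0" "local_jets K R f" "local_jets L R g" by blast
  then have "local_jets (10 * (max K L)\<^sup>2) R (\<lambda>z. f z * g z)"
    by (intro local_jets_mult) (auto elim: local_jets_mono)
  then show ?case by (intro exI[of _ "10 * (max K L)\<^sup>2"]) auto
qed

context step_two_group
begin

text \<open>For fixed \<open>z\<close> the map \<open>\<zeta> \<mapsto> \<zeta> \<odot> z\<close> is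
  affine, so a Euclidean expansion becomes a left one with a loss depending on
  \<open>norm z\<close>. Compact support removes that dependence: beyond radius
  \<open>2 * R + 2\<close> a left increment from the unit ball stays outside the ball of radius
  \<open>R\<close>, where \<open>g\<close> vanishes.\<close>

lemma left_jets_of_local_jets:
  assumes "local_jets K (2 * R + 2) g" "0 \<le> K" "0 \<le> R" "\<And>z. R \<le> norm z \<Longrightarrow> g z = 0"
  shows "\<exists>K' \<kappa>. 0 \<le> K' \<and> 0 < \<kappa> \<and> left_jets K' \<kappa> g"
proof -
  define S where "S = 1 + (2 * R + 2)"
  have S: "1 \<le> S" using assms by (simp add: S_def)
  have ltr: "norm (ltr (- z) \<zeta>) \<le> S * norm \<zeta>" if "norm z \<le> 2 * R + 2" for z \<zeta>
  proof -
    have "norm (ltr (- z) \<zeta>) \<le> (1 + norm (- z)) * norm \<zeta>" by (rule norm_ltr)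
    also have "\<dots> \<le> S * norm \<zeta>" using that by (intro mult_right_mono) (auto simp: S_def)
    finally show ?thesis using that by simp
  qed
  have gm: "\<zeta> \<odot> z = z + ltr (- z) \<zeta>" for z \<zeta>
    by (simp add: gmult_def ltr_def om.minus_left om_swap[of z \<zeta>])
  have "left_jets (K * S^3) (1 / S) g"
    unfolding left_jets_def
  proof
    fix z :: 'a
    show "\<exists>\<alpha> \<beta>. bounded_linear \<alpha> \<and> bounded_bilinear \<beta> \<and>
      (\<forall>\<zeta>. \<bar>\<beta> \<zeta> \<zeta>\<bar> \<le> K * S^3 * (norm \<zeta>)\<^sup>2) \<and>
      (\<forall>\<zeta>. norm \<zeta> \<le> 1 / S \<longrightarrow> \<bar>g (\<zeta> \<odot> z) - g z - \<alpha> \<zeta> - \<beta> \<zeta> \<zeta>\<bar> \<le> K * S^3 * (norm \<zeta>)^3)"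
    proof (cases "norm z \<le> 2 * R + 2")
      case True
      obtain \<alpha> \<beta> where g: "bounded_linear \<alpha>" "bounded_bilinear \<beta>"
        "\<And>e. \<bar>\<beta> e e\<bar> \<le> K * (norm e)\<^sup>2"
        "\<And>e. norm e \<le> 1 \<Longrightarrow> \<bar>g (z + e) - g z - \<alpha> e - \<beta> e e\<bar> \<le> K * (norm e)^3"
        by (rule local_jetsE[OF assms(1) True]) auto
      interpret b: bounded_bilinear \<beta> by fact
      have le: "norm (ltr (- z) \<zeta>) \<le> S * norm \<zeta>" for \<zeta>
        by (rule ltr[OF True])
      have pw: "K * norm (ltr (- z) \<zeta>) ^ k \<le> K * (S ^ k * norm \<zeta> ^ k)" for \<zeta> k
        using power_mono[OF le norm_ge_zero, of \<zeta> k] assms(2)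
        by (simp add: power_mult_distrib mult_left_mono)
      show ?thesis
      proof (rule exI[of _ "\<lambda>\<zeta>. \<alpha> (ltr (- z) \<zeta>)"],
          rule exI[of _ "\<lambda>\<zeta> \<xi>. \<beta> (ltr (- z) \<zeta>) (ltr (- z) \<xi>)"], intro conjI allI impI)
        show "bounded_linear (\<lambda>\<zeta>. \<alpha> (ltr (- z) \<zeta>))"
          by (intro bounded_linear_compose[OF g(1)] bounded_linear_ltr)
        show "bounded_bilinear (\<lambda>\<zeta> \<xi>. \<beta> (ltr (- z) \<zeta>) (ltr (- z) \<xi>))"
          by (intro b.comp bounded_linear_ltr)
        fix \<zeta> :: 'a
        have "K * (S\<^sup>2 * (norm \<zeta>)\<^sup>2) \<le> K * (S^3 * (norm \<zeta>)\<^sup>2)"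
          using assms(2) S power_increasing[of 2 3 S] by (intro mult_left_mono mult_right_mono) auto
        then show "\<bar>\<beta> (ltr (- z) \<zeta>) (ltr (- z) \<zeta>)\<bar> \<le> K * S^3 * (norm \<zeta>)\<^sup>2"
          using g(3)[of "ltr (- z) \<zeta>"] pw[of \<zeta> 2] by (simp add: mult.assoc)
        assume "norm \<zeta> \<le> 1 / S"
        then have "S * norm \<zeta> \<le> 1" using S by (simp add: field_simps)
        then have "norm (ltr (- z) \<zeta>) \<le> 1" using le[of \<zeta>] by linarith
        from g(4)[OF this] show "\<bar>g (\<zeta> \<odot> z) - g z - \<alpha> (ltr (- z) \<zeta>) - \<beta> (ltr (- z) \<zeta>) (ltr (- z) \<zeta>)\<bar>
          \<le> K * S^3 * (norm \<zeta>)^3"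
          using pw[of \<zeta> 3] by (simp add: gm mult.assoc)
      qed
    next
      case False
      have "g (\<zeta> \<odot> z) = 0" if "norm \<zeta> \<le> 1 / S" for \<zeta>
      proof (rule assms(4))
        have "1 / S \<le> 1" using S by simp
        with that have "norm \<zeta> \<le> 1" by linarith
        from norm_gmult_ge[OF this, of z] False show "R \<le> norm (\<zeta> \<odot> z)" by simp
      qed
      moreover have "g z = 0" using False assms(3) by (intro assms(4)) auto
      ultimately show ?thesis
        using assms(2) S
        by (intro exI[of _ "\<lambda>\<zeta>. 0"] exI[of _ "\<lambda>\<zeta> \<xi>. 0"]) (auto simp: bounded_bilinear_zero)
    qed
  qed
  then show ?thesis using S assms(2) by (intro exI[of _ "K * S^3"] exI[of _ "1 / S"]) auto
qed

text \<open>Polynomials approximate well but grow. So the quotient of a truncation of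
  \<open>u\<close> by a cutoff \<psi> is approximated by a polynomial, which is then multiplied by
  \<psi>: the product has compact support, and the smoothness of \<psi> suffices for a uniform cubic
  remainder.\<close>

lemma left_jets_approximation:
  fixes u :: "'a \<Rightarrow> real"
  assumes u: "continuous_on (cball 0 (2 * r)) u" "\<And>z. z \<in> cball 0 (2 * r) \<Longrightarrow> \<bar>u z\<bar> \<le> M"
    and "0 < r" "0 < \<delta>"
  shows "\<exists>g K \<kappa>. 0 \<le> K \<and> 0 < \<kappa> \<and> left_jets K \<kappa> g \<and> continuous_on UNIV g \<and>
    (\<forall>z. \<bar>g z\<bar> \<le> M + \<delta>) \<and> (\<forall>z\<in>cball 0 r. \<bar>g z - u z\<bar> \<le> \<delta>)"
proof -
  define q where "q z = (2 * r)\<^sup>2 - norm z ^ 2" for z :: 'a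
  define \<psi> where "\<psi> z = (max 0 (q z))^3" for z
  \<comment> \<open>The truncation equals \<open>u\<close> up to radius \<open>r\<close> and
    vanishes from 3/2 r on, well before \<psi> does at 2 r.\<close>
  define w where "w z = max 0 (min 1 (3 - 2 * norm z / r)) * u z" for z
  define B where "B = ((2 * r)\<^sup>2)^3"
  have B: "0 < B" using \<open>0 < r\<close> by (simp add: B_def)
  have \<psi>: "0 \<le> \<psi> z" "\<psi> z \<le> B" for z
  proof -
    show "0 \<le> \<psi> z" by (simp add: \<psi>_def)
    show "\<psi> z \<le> B" unfolding \<psi>_def B_def by (intro power_mono) (auto simp: q_def)
  qed
  have \<psi>0: "\<psi> z = 0" if "2 * r \<le> norm z" for z
    using that \<open>0 < r\<close> power_mono[OF that, of 2] by (simp add: \<psi>_def q_def)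
  have \<psi>p: "0 < \<psi> z" if "norm z < 2 * r" for z
  proof -
    have "norm z ^ 2 < (2 * r)\<^sup>2" using that by (intro power_strict_mono) auto
    then show ?thesis by (simp add: \<psi>_def q_def)
  qed
  have wu: "w z = u z" if "norm z \<le> r" for z
  proof -
    have "2 * norm z / r \<le> 2" using that \<open>0 < r\<close> by (simp add: field_simps)
    then show ?thesis by (simp add: w_def)
  qed
  have w0: "w z = 0" if "3 / 2 * r \<le> norm z" for z
  proof -
    have "3 \<le> 2 * norm z / r" using that \<open>0 < r\<close> by (simp add: field_simps)
    then show ?thesis by (simp add: w_def)
  qed
  have M: "0 \<le> M" using u(2)[of 0] \<open>0 < r\<close> by simp
  have wM: "\<bar>w z\<bar> \<le> M" for z
  proof (cases "norm z \<le> 2 * r")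
    case True
    have "\<bar>w z\<bar> = max 0 (min 1 (3 - 2 * norm z / r)) * \<bar>u z\<bar>" by (simp add: w_def abs_mult)
    also have "\<dots> \<le> 1 * M" using u(2)[of z] True by (intro mult_mono) auto
    finally show ?thesis by simp
  next
    case False
    then show ?thesis using w0[of z] M \<open>0 < r\<close> by simp
  qed
  have qc: "continuous_on S q" for S unfolding q_def [abs_def] by (intro continuous_intros)
  have \<psi>c: "continuous_on S \<psi>" for S unfolding \<psi>_def [abs_def] by (intro continuous_intros qc)
  have wc: "continuous_on (cball 0 (2 * r)) w"
    unfolding w_def [abs_def] using u(1) \<open>0 < r\<close> by (intro continuous_intros) auto
  have quot: "continuous_on (cball 0 (2 * r)) (\<lambda>z. w z / \<psi> z)"
  proof -
    \<comment> \<open>Two overlapping closed sets: on the first \<psi> is positive, on the second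
      \<open>w\<close> vanishes. On the sphere of radius 2 r the quotient is 0 / 0, which is
      0.\<close>
    have "continuous_on (cball 0 (7/4 * r) \<union> (cball 0 (2 * r) - ball 0 (3/2 * r))) (\<lambda>z. w z / \<psi> z)"
    proof (rule continuous_on_closed_Un)
      show "continuous_on (cball 0 (7/4 * r)) (\<lambda>z. w z / \<psi> z)"
      proof (intro continuous_intros \<psi>c)
        show "continuous_on (cball 0 (7 / 4 * r)) w"
          using \<open>0 < r\<close> by (intro continuous_on_subset[OF wc]) auto
        show "\<forall>z\<in>cball 0 (7 / 4 * r). \<psi> z \<noteq> 0"
        proof
          fix z :: 'a assume "z \<in> cball 0 (7 / 4 * r)"
          then have "norm z < 2 * r" using \<open>0 < r\<close> by auto
          from \<psi>p[OF this] show "\<psi> z \<noteq> 0" by simp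
        qed
      qed
      show "continuous_on (cball 0 (2 * r) - ball 0 (3/2 * r)) (\<lambda>z. w z / \<psi> z)"
        by (rule continuous_on_eq[where f = "\<lambda>_. 0"]) (auto simp: w0)
    qed (auto intro: closed_Diff)
    then show ?thesis
      by (rule continuous_on_subset) (use \<open>0 < r\<close> in auto)
  qed
  obtain p where p: "real_polynomial_function p"
    "\<And>z. z \<in> cball 0 (2 * r) \<Longrightarrow> \<bar>w z / \<psi> z - p z\<bar> < \<delta> / B"
    using Stone_Weierstrass_real_polynomial_function[OF compact_cball quot, of "\<delta> / B"] \<open>0 < \<delta>\<close> B
    by (metis divide_pos_pos)
  define g where "g z = \<psi> z * p z" for z
  have gw: "\<bar>g z - w z\<bar> \<le> \<delta>" for z
  proof (cases "norm z < 2 * r")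
    case True
    have "w z - g z = \<psi> z * (w z / \<psi> z - p z)"
      using \<psi>p[OF True] by (simp add: g_def right_diff_distrib)
    then have "\<bar>w z - g z\<bar> = \<psi> z * \<bar>w z / \<psi> z - p z\<bar>"
      using \<psi>[of z] by (simp add: abs_mult)
    also have "\<dots> \<le> B * (\<delta> / B)"
      using \<psi>[of z] p(2)[of z] True B by (intro mult_mono) auto
    finally show ?thesis using B by (simp add: abs_minus_commute)
  next
    case False
    then show ?thesis using \<psi>0[of z] w0[of z] \<open>0 < \<delta>\<close> \<open>0 < r\<close> by (simp add: g_def)
  qed
  have "real_polynomial_function (\<lambda>z::'a. \<Sum>b\<in>Basis. (z \<bullet> b) * (z \<bullet> b))"
    by (intro real_polynomial_function_sum real_polynomial_function.intros(4,1)
        bounded_linear_inner_left finite_Basis)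
  then have "real_polynomial_function (\<lambda>z::'a. norm z ^ 2)"
    by (simp add: power2_norm_eq_inner flip: euclidean_inner)
  then have rp: "real_polynomial_function q"
    unfolding q_def [abs_def] by (intro real_polynomial_function_diff real_polynomial_function.intros(2))
  obtain K1 where K1: "K1 \<ge> 0" "local_jets K1 (2 * (2 * r) + 2) q"
    using local_jets_polynomial[OF rp] by blast
  obtain K2 where K2: "K2 \<ge> 0" "local_jets K2 (2 * (2 * r) + 2) p"
    using local_jets_polynomial[OF p(1)] by blast
  define K where "K = max (54 * K1^3) K2"
  have K: "local_jets (10 * K\<^sup>2) (2 * (2 * r) + 2) g"
    unfolding g_def [abs_def] \<psi>_def
    using K1 K2 local_jets_cube_pos_part[OF K1(2,1)]
    by (intro local_jets_mult) (auto simp: K_def elim: local_jets_mono)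
  have "\<exists>K' \<kappa>. 0 \<le> K' \<and> 0 < \<kappa> \<and> left_jets K' \<kappa> g"
    by (rule left_jets_of_local_jets[OF K]) (use \<open>0 < r\<close> \<psi>0 in \<open>auto simp: g_def\<close>)
  moreover have "continuous_on UNIV g"
    unfolding g_def [abs_def]
    using continuous_real_polymonial_function[OF p(1)]
    by (intro continuous_intros \<psi>c continuous_at_imp_continuous_on) auto
  moreover have "\<bar>g z\<bar> \<le> M + \<delta>" for z using gw[of z] wM[of z] by linarith
  moreover have "\<bar>g z - u z\<bar> \<le> \<delta>" if "z \<in> cball 0 r" for z
    using gw[of z] wu[of z] that by simp
  ultimately show ?thesis by blast
qed

end

section \<open>Sums of subsolutions of linear equations\<close>

context parabolic_group
begin

lemma par_add: "par (\<lambda>\<eta>. \<alpha> \<eta> + \<alpha>' \<eta>) (\<lambda>\<eta> \<xi>. \<beta> \<eta> \<xi> + \<beta>' \<eta> \<xi>) = par \<alpha> \<beta> + par \<alpha>' \<beta>'"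
  by (simp add: par_def algebra_simps)

lemma par_const_mult: "par (\<lambda>\<eta>. k * \<alpha> \<eta>) (\<lambda>\<eta> \<xi>. k * \<beta> \<eta> \<xi>) = k * par \<alpha> \<beta>"
  by (simp add: par_def algebra_simps)

lemma par_minus: "par (\<lambda>\<eta>. - \<alpha> \<eta>) (\<lambda>\<eta> \<xi>. - \<beta> \<eta> \<xi>) = - par \<alpha> \<beta>"
  by (simp add: par_def)

lemma eventually_gmult_in:
  assumes "open S" "z \<in> S"
  shows "\<forall>\<^sub>F \<eta> in nhds 0. z \<odot> \<eta> \<in> S"
proof -
  have "((\<lambda>\<eta>. z \<odot> \<eta>) \<longlongrightarrow> z \<odot> 0) (nhds 0)"
    by (intro tendsto_intros filterlim_ident)
  then show ?thesis using assms by (simp add: topological_tendstoD)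
qed

text \<open>At a maximum point of \<open>w - F\<close> the superjet of \<open>F\<close> is one of
  \<open>w\<close>, so its \<open>par\<close> is at most \<open>k\<close>. The hypothesis on
  \<open>F\<close> then says directly that \<open>w \<le> F + d\<close> there: the zeroth-order term
  of the resolvent equation takes the place of strictness.\<close>

lemma comparison:
  assumes "0 < r" and cont: "continuous_on (cball 0 r) w" "continuous_on (cball 0 r) F"
    and bdry: "\<And>z. norm z = r \<Longrightarrow> w z \<le> F z + d"
    and sub: "\<And>z \<alpha> \<beta>. norm z < r \<Longrightarrow> superjet w z \<alpha> \<beta> \<Longrightarrow> par \<alpha> \<beta> \<le> k"
    and F: "\<And>z. norm z < r \<Longrightarrow> \<exists>\<alpha> \<beta>. superjet F z \<alpha> \<beta> \<and> w z + \<mu> * k - d \<le> F z + \<mu> * par \<alpha> \<beta>"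
    and "0 < \<mu>" "norm x \<le> r"
  shows "w x \<le> F x + d"
proof -
  have "\<exists>z\<in>cball 0 r. \<forall>y\<in>cball 0 r. w y - F y \<le> w z - F z"
    using cont \<open>0 < r\<close>
    by (intro continuous_attains_sup continuous_on_diff) auto
  then obtain z where z: "norm z \<le> r" "\<And>y. norm y \<le> r \<Longrightarrow> w y - F y \<le> w z - F z"
    by auto
  have "w z \<le> F z + d"
  proof (cases "norm z = r")
    case False
    then have zr: "norm z < r" using z by simp
    from F[OF this] obtain \<alpha> \<beta> where F: "superjet F z \<alpha> \<beta>"
      "w z + \<mu> * k - d \<le> F z + \<mu> * par \<alpha> \<beta>" by blast
    have "\<forall>\<^sub>F \<eta> in nhds 0. z \<odot> \<eta> \<in> ball 0 r"
      using zr by (intro eventually_gmult_in) auto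
    then have "\<forall>\<^sub>F \<eta> in nhds 0. w (z \<odot> \<eta>) - w z \<le> F (z \<odot> \<eta>) - F z"
    proof eventually_elim
      case (elim \<eta>)
      then show ?case using z(2)[of "z \<odot> \<eta>"] by simp
    qed
    from sub[OF zr superjet_touch[OF F(1) this]] have "\<mu> * par \<alpha> \<beta> \<le> \<mu> * k"
      using \<open>0 < \<mu>\<close> by simp
    with F(2) show ?thesis by linarith
  qed (rule bdry)
  with z(2)[OF \<open>norm x \<le> r\<close>] show ?thesis by linarith
qed

text \<open>With \<open>q = norm z ^ 2\<close> this is \<open>q\<^sup>2 + k * q + k\<^sup>2\<close>,
  where \<open>k\<close> will be \<open>\<mu> * C\<close>. The last two terms exactly absorb the
  lower bound \<open>- (k * q) - k\<^sup>2\<close> for \<mu> times its \<open>par\<close>.\<close>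

definition penalty :: "real \<Rightarrow> 'a \<Rightarrow> real"
  where "penalty k z = (norm z ^ 2)\<^sup>2 + k * norm z ^ 2 + k\<^sup>2"

lemma jet_norm_sq:
  "jet (\<lambda>x. norm x ^ 2) z (\<lambda>\<eta>. 2 * (z \<bullet> ltr z \<eta>)) (\<lambda>\<eta> \<xi>. ltr z \<eta> \<bullet> ltr z \<xi>)"
  using jet_quadratic[of "\<lambda>_. 0" inner z] bounded_bilinear_inner
  by (simp add: power2_norm_eq_inner inner_commute)

text \<open>The quartic growth is what makes the penalty of size \<open>\<mu>\<^sup>2\<close>, rather than \<open>\<mu>\<close>,
  at the centre.\<close>

lemma penalty_supersolution:
  assumes "0 \<le> r"
  shows "\<exists>C\<ge>0. \<forall>\<mu>>0. \<forall>z. norm z \<le> r \<longrightarrow>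
    (\<exists>\<alpha> \<beta>. jet (penalty (\<mu> * C)) z \<alpha> \<beta> \<and> 0 \<le> penalty (\<mu> * C) z + \<mu> * par \<alpha> \<beta>)"
proof -
  define S where "S = 1 + r"
  define N where "N = norm s1 ^ 2 + norm s2 ^ 2"
  \<comment> \<open>\<open>C1\<close> bounds \<open>par\<close> of the squared norm from below by
    \<open>- C1\<close>; \<open>C2\<close> accounts for the squared gradient that appears when the
    squared norm is squared again, and that term is proportional to \<open>q\<close>.\<close>
  define C1 where "C1 = 2 * r * (S * norm e) + 2 * S\<^sup>2 * N"
  define C2 where "C2 = 8 * S\<^sup>2 * N"
  define C where "C = 2 * C1 + C2"
  have N: "0 \<le> N" by (simp add: N_def)
  have C12: "0 \<le> C1" "0 \<le> C2" using assms N by (auto simp: C1_def C2_def S_def)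
  then have C: "0 \<le> C" "C1 \<le> C" by (auto simp: C_def)
  have "\<exists>\<alpha> \<beta>. jet (penalty (\<mu> * C)) z \<alpha> \<beta> \<and> 0 \<le> penalty (\<mu> * C) z + \<mu> * par \<alpha> \<beta>"
    if "0 < \<mu>" "norm z \<le> r" for \<mu> z
  proof -
    define q where "q = norm z ^ 2"
    define a where "a \<eta> = 2 * (z \<bullet> ltr z \<eta>)" for \<eta>
    define b where "b \<eta> \<xi> = ltr z \<eta> \<bullet> ltr z \<xi>" for \<eta> \<xi>
    define k where "k = \<mu> * C"
    have ab: "jet (\<lambda>x. norm x ^ 2) z a b"
      using jet_norm_sq[of z] by (simp add: a_def[abs_def] b_def[abs_def])
    then have bl: "bounded_linear a" "bounded_bilinear b"
      by (auto simp: jet_def superjet_def)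
    have q0: "0 \<le> q" by (simp add: q_def)
    have ltr: "norm (ltr z \<eta>) \<le> S * norm \<eta>" for \<eta>
      using norm_ltr[of z \<eta>] mult_right_mono[of "1 + norm z" S "norm \<eta>"] that(2)
      by (simp add: S_def)
    have a_le: "\<bar>a \<eta>\<bar> \<le> 2 * (norm z * (S * norm \<eta>))" for \<eta>
    proof -
      have "\<bar>z \<bullet> ltr z \<eta>\<bar> \<le> norm z * norm (ltr z \<eta>)" by (rule Cauchy_Schwarz_ineq2)
      also have "\<dots> \<le> norm z * (S * norm \<eta>)" by (intro mult_left_mono ltr) simp
      finally show ?thesis by (simp add: a_def abs_mult)
    qed
    have b_le: "b \<eta> \<eta> \<le> S\<^sup>2 * norm \<eta> ^ 2" and b0: "0 \<le> b \<eta> \<eta>" for \<eta>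
      using power_mono[OF ltr[of \<eta>], of 2]
      by (simp_all add: b_def power_mult_distrib flip: power2_norm_eq_inner)
    have exp: "norm (z \<odot> \<eta>) ^ 2 = q + a \<eta> + b \<eta> \<eta>" for \<eta>
      unfolding q_def a_def b_def gmult_ltr power2_norm_eq_inner
      by (simp add: inner_add inner_commute)
    have "jet (\<lambda>x. (norm x ^ 2)\<^sup>2) z (\<lambda>\<eta>. 2 * q * a \<eta>) (\<lambda>\<eta> \<xi>. 2 * q * b \<eta> \<xi> + a \<eta> * a \<xi>)"
    proof (rule jet_cubicI[where d = 1 and K = "2 * (2 * (norm z * S)) * S\<^sup>2 + S\<^sup>2 * S\<^sup>2"])
      show "bounded_linear (\<lambda>\<eta>. 2 * q * a \<eta>)" "bounded_bilinear (\<lambda>\<eta> \<xi>. 2 * q * b \<eta> \<xi> + a \<eta> * a \<xi>)"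
        by (intro bounded_linear_const_mult bounded_bilinear_add bounded_bilinear_const_mult
            bounded_bilinear_product bl)+
      fix \<eta> :: 'a assume n1: "norm \<eta> \<le> 1"
      have 1: "\<bar>a \<eta> * b \<eta> \<eta>\<bar> \<le> 2 * (norm z * (S * norm \<eta>)) * (S\<^sup>2 * norm \<eta> ^ 2)"
        using a_le b_le b0 by (intro abs_mult_le) auto
      have 2: "\<bar>b \<eta> \<eta> * b \<eta> \<eta>\<bar> \<le> S\<^sup>2 * norm \<eta> ^ 2 * (S\<^sup>2 * norm \<eta> ^ 2)"
        using b_le b0 by (intro abs_mult_le) auto
      have "norm \<eta> ^ 4 \<le> norm \<eta> ^ 3" using n1 by (intro power_decreasing) auto
      then have 3: "S\<^sup>2 * norm \<eta> ^ 2 * (S\<^sup>2 * norm \<eta> ^ 2) \<le> S\<^sup>2 * S\<^sup>2 * norm \<eta> ^ 3"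
        using mult_left_mono[of "norm \<eta> ^ 4" "norm \<eta> ^ 3" "S\<^sup>2 * S\<^sup>2"]
        by (simp add: mult_ac flip: power_add)
      have "(norm (z \<odot> \<eta>) ^ 2)\<^sup>2 - (norm z ^ 2)\<^sup>2 - 2 * q * a \<eta> - (2 * q * b \<eta> \<eta> + a \<eta> * a \<eta>)
        = 2 * (a \<eta> * b \<eta> \<eta>) + b \<eta> \<eta> * b \<eta> \<eta>"
        unfolding exp q_def[symmetric] by (simp add: power2_eq_square algebra_simps)
      also have "\<bar>\<dots>\<bar> \<le> 2 * (2 * (norm z * (S * norm \<eta>)) * (S\<^sup>2 * norm \<eta> ^ 2)) + S\<^sup>2 * S\<^sup>2 * norm \<eta> ^ 3"
        using 1 2 3 by linarith
      also have "\<dots> = (2 * (2 * (norm z * S)) * S\<^sup>2 + S\<^sup>2 * S\<^sup>2) * norm \<eta> ^ 3"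
        by (simp add: algebra_simps power2_eq_square power3_eq_cube)
      finally show "\<bar>(norm (z \<odot> \<eta>) ^ 2)\<^sup>2 - (norm z ^ 2)\<^sup>2 - 2 * q * a \<eta> - (2 * q * b \<eta> \<eta> + a \<eta> * a \<eta>)\<bar>
        \<le> (2 * (2 * (norm z * S)) * S\<^sup>2 + S\<^sup>2 * S\<^sup>2) * norm \<eta> ^ 3" .
    qed simp
    moreover have "jet (\<lambda>x. k * norm x ^ 2 + k\<^sup>2) z (\<lambda>\<eta>. k * a \<eta>) (\<lambda>\<eta> \<xi>. k * b \<eta> \<xi>)"
    proof (rule jet_cubicI[where d = 1 and K = 0])
      show "bounded_linear (\<lambda>\<eta>. k * a \<eta>)" "bounded_bilinear (\<lambda>\<eta> \<xi>. k * b \<eta> \<xi>)"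
        by (intro bounded_linear_const_mult bounded_bilinear_const_mult bl)+
    qed (simp_all add: exp algebra_simps q_def)
    ultimately have jet: "jet (penalty k) z (\<lambda>\<eta>. 2 * q * a \<eta> + k * a \<eta>)
        (\<lambda>\<eta> \<xi>. 2 * q * b \<eta> \<xi> + a \<eta> * a \<xi> + k * b \<eta> \<xi>)"
      using jet_add by (fastforce simp: penalty_def[abs_def] add.assoc)
    have p: "par a b \<ge> - C1"
    proof -
      have "norm z * (S * norm e) \<le> r * (S * norm e)"
        using that(2) assms by (intro mult_right_mono) (auto simp: S_def)
      then have "\<bar>a e\<bar> \<le> 2 * r * (S * norm e)" using a_le[of e] by simp
      moreover have "b s1 s1 + b s2 s2 \<le> S\<^sup>2 * N"
        using b_le[of s1] b_le[of s2] by (simp add: N_def distrib_left)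
      ultimately show ?thesis unfolding par_def C1_def by (simp add: abs_le_iff)
    qed
    have as: "a s * a s \<le> 4 * q * (S\<^sup>2 * norm s ^ 2)" for s
      using power_mono[OF a_le[of s] abs_ge_zero, of 2]
      by (simp add: power_mult_distrib q_def power2_eq_square mult_ac)
    have pq: "2 * (a s1 * a s1 + a s2 * a s2) \<le> q * C2"
      using as[of s1] as[of s2] by (simp add: C2_def N_def algebra_simps)
    have "par (\<lambda>\<eta>. 2 * q * a \<eta> + k * a \<eta>) (\<lambda>\<eta> \<xi>. 2 * q * b \<eta> \<xi> + a \<eta> * a \<xi> + k * b \<eta> \<xi>)
      = (2 * q + k) * par a b - 2 * (a s1 * a s1 + a s2 * a s2)" (is "?P = _")
      by (simp add: par_def algebra_simps)
    also have "\<dots> \<ge> (2 * q + k) * (- C1) - q * C2"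
      using p pq q0 that(1) C by (intro diff_mono mult_left_mono) (auto simp: k_def)
    finally have "?P \<ge> - (q * C) - k * C1" by (simp add: C_def algebra_simps)
    moreover have "k * C1 \<le> k * C" using C that(1) by (auto simp: k_def intro: mult_left_mono)
    ultimately have "- (q * C) - k * C \<le> ?P" by linarith
    then have "\<mu> * (- (q * C) - k * C) \<le> \<mu> * ?P" using that(1) by simp
    moreover have "\<mu> * (- (q * C) - k * C) = - (k * q) - k\<^sup>2"
      by (simp add: k_def power2_eq_square algebra_simps)
    moreover have "penalty k z = q\<^sup>2 + k * q + k\<^sup>2" by (simp add: penalty_def q_def)
    ultimately have "0 \<le> penalty k z + \<mu> * ?P" using zero_le_power2[of q] by linarith
    with jet show ?thesis unfolding k_def by blast
  qed
  with C show ?thesis by blast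
qed

lemma continuous_penalty: "continuous_on S (penalty k)"
  unfolding penalty_def [abs_def] by (intro continuous_intros)

lemma penalty_ge: "0 \<le> k \<Longrightarrow> norm z ^ 4 \<le> penalty k z"
  by (simp add: penalty_def flip: power_mult)

lemma superjet_polynomial_bound:
  assumes "superjet U 0 \<alpha> \<beta>" "0 < \<epsilon>"
  shows "\<exists>r>0. \<forall>z. norm z \<le> r \<longrightarrow> U z \<le> U 0 + \<alpha> z + \<beta> z z + \<epsilon> * norm z ^ 2"
proof -
  from superjetD(3)[OF assms]
  obtain d where d: "d > 0" "\<And>z. dist z 0 < d \<Longrightarrow> U z \<le> U 0 + \<alpha> z + \<beta> z z + \<epsilon> * norm z ^ 2"
    by (auto simp: eventually_nhds_metric)
  show ?thesis by (rule exI[of _ "d / 2"]) (use d in auto)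
qed

text \<open>Adding \<epsilon> times the squared norm to the quadratic part lowers \<open>par\<close>
  by \<epsilon> (N - 1), less than the available excess \<epsilon> N. Half of this \<epsilon> pays
  for the error in the superjet, the other half makes the contact strict.\<close>

lemma superjet_strict_touch:
  assumes jet: "superjet U 0 \<alpha> \<beta>" and k: "k < par \<alpha> \<beta>"
  shows "\<exists>B \<epsilon> r. bounded_bilinear B \<and> k < par \<alpha> B \<and> 0 < \<epsilon> \<and> 0 < r \<and>
    (\<forall>z. norm z \<le> r \<longrightarrow> U z \<le> U 0 + \<alpha> z + B z z - \<epsilon> * norm z ^ 2)"
proof -
  define N where "N = 1 + 2 * (norm s1 ^ 2 + norm s2 ^ 2)"
  have N: "0 < N" unfolding N_def by (intro add_pos_nonneg) auto
  define \<epsilon> where "\<epsilon> = (par \<alpha> \<beta> - k) / N"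
  have \<epsilon>: "0 < \<epsilon>" "\<epsilon> * N = par \<alpha> \<beta> - k" using k N by (auto simp: \<epsilon>_def)
  define B where "B x y = \<beta> x y + \<epsilon> * (x \<bullet> y)" for x y
  have "bounded_bilinear B"
    unfolding B_def[abs_def]
    by (intro bounded_bilinear_add bounded_bilinear_const_mult superjetD(2)[OF jet] bounded_bilinear_inner)
  moreover have "par \<alpha> B = par \<alpha> \<beta> - (\<epsilon> * N - \<epsilon>)"
    by (simp add: par_def B_def N_def algebra_simps power2_norm_eq_inner)
  then have "k < par \<alpha> B" using \<epsilon> by simp
  moreover obtain r where r: "0 < r"
    "\<And>z. norm z \<le> r \<Longrightarrow> U z \<le> U 0 + \<alpha> z + \<beta> z z + \<epsilon> / 2 * norm z ^ 2"
    using superjet_polynomial_bound[OF jet, of "\<epsilon> / 2"] \<epsilon>(1) by auto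
  have "U z \<le> U 0 + \<alpha> z + B z z - \<epsilon> / 2 * norm z ^ 2" if "norm z \<le> r" for z
    using r(2)[OF that] by (simp add: B_def power2_norm_eq_inner field_simps)
  ultimately show ?thesis
    using \<epsilon>(1) r(1) by (intro exI[of _ B] exI[of _ "\<epsilon> / 2"] exI[of _ r]) auto
qed

lemma ltr_tendsto: "((\<lambda>z. ltr z y) \<longlongrightarrow> y) (nhds 0)"
proof -
  have "((\<lambda>z. ltr z y) \<longlongrightarrow> y + (om 0 y / 2) *\<^sub>R c) (nhds 0)"
    unfolding ltr_def by (intro tendsto_intros om.tendsto filterlim_ident) auto
  then show ?thesis by (simp add: om.zero_left)
qed

lemma quadratic_gradient_tendsto:
  assumes "bounded_linear \<alpha>" "bounded_bilinear \<beta>"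
  shows "((\<lambda>z. \<alpha> (ltr z y) + \<beta> z (ltr z y) + \<beta> (ltr z y) z) \<longlongrightarrow> \<alpha> y) (nhds 0)"
proof -
  interpret a: bounded_linear \<alpha> by fact
  interpret b: bounded_bilinear \<beta> by fact
  have "((\<lambda>z. \<alpha> (ltr z y) + \<beta> z (ltr z y) + \<beta> (ltr z y) z) \<longlongrightarrow> \<alpha> y + \<beta> 0 y + \<beta> y 0) (nhds 0)"
    by (intro tendsto_intros a.tendsto b.tendsto ltr_tendsto filterlim_ident)
  then show ?thesis by (simp add: b.zero_left b.zero_right)
qed

lemma quadratic_par_tendsto:
  assumes "bounded_linear \<alpha>" "bounded_bilinear \<beta>"
  shows "((\<lambda>z. par (\<lambda>\<eta>. \<alpha> (ltr z \<eta>) + \<beta> z (ltr z \<eta>) + \<beta> (ltr z \<eta>) z) (\<lambda>\<eta> \<xi>. \<beta> (ltr z \<eta>) (ltr z \<xi>)))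
    \<longlongrightarrow> par \<alpha> \<beta>) (nhds 0)"
proof -
  interpret b: bounded_bilinear \<beta> by fact
  show ?thesis
    unfolding par_def
    by (intro tendsto_intros quadratic_gradient_tendsto[OF assms] b.tendsto ltr_tendsto)
qed

text \<open>Comparing \<open>u\<close> from above and \<open>w\<close> from
  above with the same approximate resolvent \<open>h\<close>, with opposite signs, replaces the theorem on
  sums of Crandall and Ishii.\<close>

lemma linear_sum:
  assumes "0 < r" and cont: "continuous_on (cball 0 r) u" "continuous_on (cball 0 r) w"
    and u: "\<And>z \<alpha> \<beta>. norm z < r \<Longrightarrow> superjet u z \<alpha> \<beta> \<Longrightarrow> par \<alpha> \<beta> \<le> k1"
    and w: "\<And>z \<alpha> \<beta>. norm z < r \<Longrightarrow> superjet w z \<alpha> \<beta> \<Longrightarrow> par \<alpha> \<beta> \<le> k2"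
    and sum: "superjet (\<lambda>z. u z + w z) 0 \<alpha> \<beta>"
  shows "par \<alpha> \<beta> \<le> k1 + k2"
proof (rule ccontr)
  assume "\<not> par \<alpha> \<beta> \<le> k1 + k2"
  define \<theta> where "\<theta> = (par \<alpha> \<beta> - k1 - k2) / 2"
  have \<theta>: "0 < \<theta>" "k1 + k2 + \<theta> < par \<alpha> \<beta>"
    using \<open>\<not> par \<alpha> \<beta> \<le> k1 + k2\<close> by (auto simp: \<theta>_def field_simps)
  obtain B r1 where B: "bounded_bilinear B" and parB: "k1 + k2 + \<theta> < par \<alpha> B" and "r1 > 0"
    and below: "\<And>z. norm z \<le> r1 \<Longrightarrow> u z + w z \<le> u 0 + w 0 + \<alpha> z + B z z"
  proof -
    obtain B \<epsilon> r where B: "bounded_bilinear B" "k1 + k2 + \<theta> < par \<alpha> B" and \<epsilon>: "0 < \<epsilon>"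
      and r: "0 < r" "\<And>z. norm z \<le> r \<Longrightarrow> u z + w z \<le> u 0 + w 0 + \<alpha> z + B z z - \<epsilon> * norm z ^ 2"
      using superjet_strict_touch[OF sum \<theta>(2)] by auto
    have "u z + w z \<le> u 0 + w 0 + \<alpha> z + B z z" if "norm z \<le> r" for z
    proof -
      have "0 \<le> \<epsilon> * norm z ^ 2" using \<epsilon> by simp
      with r(2)[OF that] show ?thesis by linarith
    qed
    from that[OF B r(1) this] show ?thesis .
  qed
  note \<alpha> = superjetD(1)[OF sum]
  define \<alpha>z where "\<alpha>z z \<eta> = \<alpha> (ltr z \<eta>) + B z (ltr z \<eta>) + B (ltr z \<eta>) z" for z \<eta>
  define Bz where "Bz z \<eta> \<xi> = B (ltr z \<eta>) (ltr z \<xi>)" for z \<eta> \<xi>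
  define \<phi> where "\<phi> x = \<alpha> x + B x x" for x
  have \<phi>jet: "jet \<phi> z (\<alpha>z z) (Bz z)" for z
    using jet_quadratic[OF \<alpha> B, of z] by (simp add: \<phi>_def[abs_def] \<alpha>z_def[abs_def] Bz_def[abs_def])
  have "\<forall>\<^sub>F z in nhds 0. par (\<alpha>z z) (Bz z) > k1 + k2 + \<theta>"
    using quadratic_par_tendsto[OF \<alpha> B] parB
    unfolding \<alpha>z_def[abs_def] Bz_def[abs_def] by (rule order_tendstoD(1))
  then obtain d where d: "d > 0" "\<And>z. norm z < d \<Longrightarrow> par (\<alpha>z z) (Bz z) > k1 + k2 + \<theta>"
    by (auto simp: eventually_nhds_metric)
  have r1: "r1 > 0" "\<And>z. norm z \<le> r1 \<Longrightarrow> u z + w z \<le> u 0 + w 0 + \<phi> z"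
    using \<open>r1 > 0\<close> below by (auto simp: \<phi>_def add.assoc)
  define R where "R = min (min r r1) d / 2"
  have R: "0 < R" "2 * R \<le> r" "2 * R \<le> r1" "2 * R \<le> d"
    using \<open>0 < r\<close> r1 d by (auto simp: R_def)
  have contR: "continuous_on (cball 0 (2 * R)) u" "continuous_on (cball 0 (2 * R)) w"
    using R by (auto intro: continuous_on_subset[OF cont(1)] continuous_on_subset[OF cont(2)])
  have \<phi>c: "continuous_on S \<phi>" for S
    unfolding \<phi>_def[abs_def]
    by (intro continuous_intros bounded_linear.continuous_on[OF \<alpha>] bounded_bilinear.continuous_on[OF B])
  have bdd: "\<exists>m. \<forall>z. norm z \<le> 2 * R \<longrightarrow> \<bar>f z\<bar> \<le> m"
    if fc: "continuous_on (cball 0 (2 * R)) f" for f :: "'a \<Rightarrow> real"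
  proof -
    obtain m where "\<forall>z\<in>cball 0 (2 * R). \<bar>f z\<bar> \<le> m"
      using compact_imp_bounded[OF compact_continuous_image[OF fc compact_cball]]
      by (auto simp: bounded_iff)
    then show ?thesis by (intro exI[of _ m]) auto
  qed
  obtain m1 m2 m3 where m: "\<forall>z. norm z \<le> 2 * R \<longrightarrow> \<bar>u z\<bar> \<le> m1"
    "\<forall>z. norm z \<le> 2 * R \<longrightarrow> \<bar>w z\<bar> \<le> m2" "\<forall>z. norm z \<le> 2 * R \<longrightarrow> \<bar>\<phi> z\<bar> \<le> m3"
    using bdd[OF contR(1)] bdd[OF contR(2)] bdd[OF \<phi>c] by blast
  define M0 where "M0 = max m1 (max m2 m3)"
  have M0: "\<bar>u z\<bar> \<le> M0" "\<bar>w z\<bar> \<le> M0" "\<bar>\<phi> z\<bar> \<le> M0" if "norm z \<le> 2 * R" for z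
    using m that by (auto simp: M0_def le_max_iff_disj)
  \<comment> \<open>The room beyond \<open>M0\<close> is for the shift \<open>\<mu> * k1\<close> and
    the approximation error \<delta>, with both \<mu> and \<delta> at most 1.\<close>
  define M where "M = M0 + \<bar>k1\<bar> + 1"
  have M0': "0 \<le> M0" using M0(1)[of 0] R by simp
  obtain C where C: "0 \<le> C" and pen: "\<And>\<mu> z. 0 < \<mu> \<Longrightarrow> norm z \<le> R \<Longrightarrow>
    \<exists>\<alpha> \<beta>. jet (penalty (\<mu> * C)) z \<alpha> \<beta> \<and> 0 \<le> penalty (\<mu> * C) z + \<mu> * par \<alpha> \<beta>"
    using penalty_supersolution[of R] R by auto
  \<comment> \<open>The height that the penalty must reach on the sphere of radius \<open>R\<close>
    for both boundary inequalities below. It is fixed before \<mu>.\<close>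
  define K where "K = (2 * M + 5 * M0 + \<theta> + 1) / R ^ 4"
  have K: "0 < K" "K * R ^ 4 = 2 * M + 5 * M0 + \<theta> + 1"
    using R M0' \<theta> by (auto simp: K_def M_def)
  \<comment> \<open>The contradiction gains \<mu> \<theta>, while the penalty at 0 costs
    \<open>K * (\<mu> * C)\<^sup>2\<close>. The last entry makes this cost at most a quarter of the
    gain.\<close>
  define \<mu> where "\<mu> = min 1 (min (1 / \<theta>) (\<theta> / (4 * K * C\<^sup>2 + 1)))"
  have den2: "0 < 4 * K * C\<^sup>2 + 1" using K by (intro add_nonneg_pos) auto
  have \<mu>: "0 < \<mu>" "\<mu> \<le> 1" "\<mu> \<le> 1 / \<theta>" "\<mu> \<le> \<theta> / (4 * K * C\<^sup>2 + 1)"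
    using \<theta> den2 by (auto simp: \<mu>_def)
  have \<mu>\<theta>: "0 < \<mu> * \<theta>" "\<mu> * \<theta> \<le> 1" using \<mu> \<theta> by (auto simp: field_simps)
  define \<delta> where "\<delta> = \<mu> * \<theta> / 16"
  have \<delta>: "0 < \<delta>" "\<delta> \<le> 1" using \<mu>\<theta> by (auto simp: \<delta>_def)
  have pen0: "4 * (K * penalty (\<mu> * C) 0) \<le> \<mu> * \<theta>"
  proof -
    have "\<mu> * (4 * K * C\<^sup>2 + 1) \<le> \<theta>" using \<mu>(4) den2 by (simp add: field_simps)
    then have "\<mu> * (4 * K * C\<^sup>2) \<le> \<theta>" using \<mu>(1) by (simp add: algebra_simps)
    from mult_left_mono[OF this, of \<mu>] \<mu>(1) show ?thesis
      by (simp add: penalty_def power2_eq_square mult_ac)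
  qed
  obtain g L \<kappa> where g: "0 \<le> L" "0 < \<kappa>" "left_jets L \<kappa> g" "continuous_on UNIV g"
    "\<And>z. \<bar>g z\<bar> \<le> M" "\<And>z. norm z \<le> R \<Longrightarrow> \<bar>g z - (u z + \<mu> * k1)\<bar> \<le> \<delta>"
  proof -
    have bd: "\<bar>u z + \<mu> * k1\<bar> \<le> M0 + \<bar>k1\<bar>" if "z \<in> cball 0 (2 * R)" for z
    proof -
      have "\<bar>\<mu> * k1\<bar> \<le> 1 * \<bar>k1\<bar>"
        unfolding abs_mult using \<mu> by (intro mult_right_mono) auto
      with M0(1)[of z] that show ?thesis by simp
    qed
    have "continuous_on (cball 0 (2 * R)) (\<lambda>z. u z + \<mu> * k1)"
      by (intro continuous_intros contR)
    from left_jets_approximation[OF this bd \<open>0 < R\<close> \<open>0 < \<delta>\<close>]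
    obtain g L \<kappa> where g: "0 \<le> L" "0 < \<kappa>" "left_jets L \<kappa> g" "continuous_on UNIV g"
      "\<And>z. \<bar>g z\<bar> \<le> M0 + \<bar>k1\<bar> + \<delta>" "\<And>z. norm z \<le> R \<Longrightarrow> \<bar>g z - (u z + \<mu> * k1)\<bar> \<le> \<delta>"
      by auto
    have "\<bar>g z\<bar> \<le> M" for z using g(5)[of z] \<delta>(2) by (simp add: M_def)
    from that[OF g(1-4) this g(6)] show ?thesis .
  qed
  obtain h where h: "continuous_on UNIV h" "\<And>z. \<bar>h z\<bar> \<le> M"
    "\<And>z. norm z \<le> R \<Longrightarrow> \<exists>\<alpha> \<beta>. jet h z \<alpha> \<beta> \<and> \<bar>h z + \<mu> * par \<alpha> \<beta> - g z\<bar> \<le> \<delta>"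
    using approximate_resolvent[OF g(3-5,1,2) \<mu>(1) \<delta>(1), of R] R by auto
  define \<psi> where "\<psi> z = K * penalty (\<mu> * C) z" for z
  have \<psi>c: "continuous_on S \<psi>" for S
    unfolding \<psi>_def[abs_def] by (intro continuous_intros continuous_penalty)
  have \<psi>b: "\<psi> z \<ge> 2 * M + 5 * M0 + \<theta> + 1" if "norm z = R" for z
    using mult_left_mono[OF penalty_ge[of "\<mu> * C" z], of K] that K \<mu> C by (simp add: \<psi>_def)
  have \<psi>: "\<exists>\<alpha> \<beta>. superjet \<psi> z \<alpha> \<beta> \<and> 0 \<le> \<psi> z + \<mu> * par \<alpha> \<beta>" if zR: "norm z \<le> R" for z
  proof -
    obtain a b where ab: "jet (penalty (\<mu> * C)) z a b" "0 \<le> penalty (\<mu> * C) z + \<mu> * par a b"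
      using pen[OF \<mu>(1) zR] by blast
    have "superjet \<psi> z (\<lambda>\<eta>. K * a \<eta>) (\<lambda>\<eta> \<xi>. K * b \<eta> \<xi>)"
      unfolding \<psi>_def[abs_def] using ab K by (intro superjet_const_mult) (auto simp: jet_def)
    moreover have "0 \<le> \<psi> z + \<mu> * par (\<lambda>\<eta>. K * a \<eta>) (\<lambda>\<eta> \<xi>. K * b \<eta> \<xi>)"
      using mult_nonneg_nonneg[OF less_imp_le[OF K(1)] ab(2)]
      by (simp add: par_const_mult \<psi>_def algebra_simps)
    ultimately show ?thesis by blast
  qed
  have subR: "norm z \<le> R \<Longrightarrow> norm z \<le> 2 * R" for z :: 'a using R by simp
  have subr: "norm z < R \<Longrightarrow> norm z < r" "norm z < R \<Longrightarrow> norm z < d" for z :: 'a using R by auto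
  \<comment> \<open>Since \<open>g\<close> is close to \<open>u + \<mu> * k1\<close>, the function
    \<open>h + \<psi>\<close> satisfies up to 2 \<delta> the resolvent inequality opposite to that
    of \<open>u\<close>; one \<delta> is for \<open>g\<close>, the other for
    \<open>h\<close>.\<close>
  have "u 0 \<le> (h 0 + \<psi> 0) + 2 * \<delta>"
  proof (rule comparison[where r = R and k = k1 and \<mu> = \<mu>])
    show "continuous_on (cball 0 R) u" using R by (intro continuous_on_subset[OF contR(1)]) auto
    show "continuous_on (cball 0 R) (\<lambda>z. h z + \<psi> z)"
      by (intro continuous_intros \<psi>c continuous_on_subset[OF h(1)]) auto
    show "u z \<le> h z + \<psi> z + 2 * \<delta>" if "norm z = R" for z
      using \<psi>b[OF that] h(2)[of z] M0(1)[of z] that R \<theta> \<delta> M0' by (simp add: abs_le_iff)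
    show "\<exists>\<alpha> \<beta>. superjet (\<lambda>z. h z + \<psi> z) z \<alpha> \<beta> \<and> u z + \<mu> * k1 - 2 * \<delta> \<le> h z + \<psi> z + \<mu> * par \<alpha> \<beta>"
      if zR: "norm z < R" for z
    proof -
      obtain a b where ab: "superjet h z a b" "\<bar>h z + \<mu> * par a b - g z\<bar> \<le> \<delta>"
        using h(3)[of z] zR by (auto simp: jet_def)
      obtain a' b' where ab': "superjet \<psi> z a' b'" "0 \<le> \<psi> z + \<mu> * par a' b'"
        using \<psi>[of z] zR by auto
      have "u z + \<mu> * k1 - 2 * \<delta> \<le> h z + \<psi> z + \<mu> * (par a b + par a' b')"
        using ab(2) ab'(2) g(6)[of z] zR by (simp add: abs_le_iff distrib_left)
      with superjet_add[OF ab(1) ab'(1)] show ?thesis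
        unfolding par_add[symmetric] by blast
    qed
    show "par \<alpha> \<beta> \<le> k1" if "norm z < R" "superjet u z \<alpha> \<beta>" for z \<alpha> \<beta>
      using u[OF subr(1)[OF that(1)] that(2)] .
  qed (use R \<mu> in auto)
  moreover
  \<comment> \<open>The contact value is lowered by \<mu> \<theta>. The excess \<theta> in
    \<open>par\<close> of \<phi> restores exactly this amount, so the comparison for
    \<open>w\<close> still goes through.\<close>
  define W where "W = u 0 + w 0 - \<mu> * \<theta>"
  have "w 0 \<le> (\<phi> 0 + (\<psi> 0 + (- h 0 + W))) + 2 * \<delta>"
  proof (rule comparison[where r = R and k = k2 and \<mu> = \<mu>])
    show "continuous_on (cball 0 R) w" using R by (intro continuous_on_subset[OF contR(2)]) auto
    show "continuous_on (cball 0 R) (\<lambda>z. \<phi> z + (\<psi> z + (- h z + W)))"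
      by (intro continuous_intros \<psi>c \<phi>c continuous_on_subset[OF h(1)]) auto
    show "w z \<le> \<phi> z + (\<psi> z + (- h z + W)) + 2 * \<delta>" if "norm z = R" for z
      using \<psi>b[OF that] h(2)[of z] M0[OF subR, of z] M0(1,2)[of 0] that R \<theta> \<delta> \<mu>\<theta>
        mult_right_mono[OF \<mu>(2), of \<theta>] M0'
      by (simp add: abs_le_iff W_def)
    show "\<exists>\<alpha> \<beta>. superjet (\<lambda>z. \<phi> z + (\<psi> z + (- h z + W))) z \<alpha> \<beta> \<and>
        w z + \<mu> * k2 - 2 * \<delta> \<le> \<phi> z + (\<psi> z + (- h z + W)) + \<mu> * par \<alpha> \<beta>"
      if zR: "norm z < R" for z
    proof -
      obtain a b where ab: "jet h z a b" "\<bar>h z + \<mu> * par a b - g z\<bar> \<le> \<delta>"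
        using h(3)[of z] zR by auto
      have "superjet (\<lambda>z. - h z) z (\<lambda>\<eta>. - a \<eta>) (\<lambda>\<eta> \<xi>. - b \<eta> \<xi>)"
        using ab(1) by (simp add: jet_def)
      then have h': "superjet (\<lambda>z. - h z + W) z (\<lambda>\<eta>. - a \<eta>) (\<lambda>\<eta> \<xi>. - b \<eta> \<xi>)"
        by (rule superjet_touch) simp
      obtain a' b' where ab': "superjet \<psi> z a' b'" "0 \<le> \<psi> z + \<mu> * par a' b'"
        using \<psi>[of z] zR by auto
      have "superjet \<phi> z (\<alpha>z z) (Bz z)" using \<phi>jet by (simp add: jet_def)
      note J = superjet_add[OF this superjet_add[OF ab'(1) h']]
      have "\<mu> * (k1 + k2 + \<theta>) \<le> \<mu> * par (\<alpha>z z) (Bz z)"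
        using d(2)[OF subr(2)[OF zR]] \<mu> by simp
      moreover have "u z + w z \<le> u 0 + w 0 + \<phi> z"
        using zR R by (intro r1(2)) simp
      ultimately have "w z + \<mu> * k2 - 2 * \<delta> \<le>
        \<phi> z + (\<psi> z + (- h z + W)) + \<mu> * (par (\<alpha>z z) (Bz z) + (par a' b' + - par a b))"
        using ab(2) ab'(2) g(6)[of z] zR by (simp add: abs_le_iff distrib_left right_diff_distrib W_def)
      with J show ?thesis
        unfolding par_minus[symmetric] par_add[symmetric] by blast
    qed
    show "par \<alpha> \<beta> \<le> k2" if "norm z < R" "superjet w z \<alpha> \<beta>" for z \<alpha> \<beta>
      using w[OF subr(1)[OF that(1)] that(2)] .
  qed (use R \<mu> in auto)
  moreover have "\<phi> 0 = 0"
    using bounded_linear.linear[OF \<alpha>] by (simp add: \<phi>_def linear_0 bounded_bilinear.zero_left[OF B])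
  \<comment> \<open>Adding the two comparisons at 0 cancels \<open>u\<close>, \<open>w\<close> and
    \<open>h\<close>. The right-hand side is at most three quarters of the left.\<close>
  ultimately have "\<mu> * \<theta> \<le> 2 * \<psi> 0 + 4 * \<delta>" by (simp add: W_def)
  with pen0 \<mu>\<theta> show False by (simp add: \<psi>_def \<delta>_def)
qed

end

section \<open>Semicontinuity and semiconvexity\<close>

text \<open>The point itself satisfies the strict inequality, so punctured neighbourhoods may be
  replaced by full ones.\<close>

lemma usc_on_nhds: "usc_on S g \<longleftrightarrow> (\<forall>x\<in>S. \<forall>k>g x. \<forall>\<^sub>F y in nhds x. y \<in> S \<longrightarrow> g y < k)"
proof -
  have "eventually (\<lambda>y. y \<noteq> x \<longrightarrow> y \<in> S \<longrightarrow> g y < k) (nhds x) \<longleftrightarrow> (\<forall>\<^sub>F y in nhds x. y \<in> S \<longrightarrow> g y < k)"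
    if "g x < k" for x k
    by (rule arg_cong[where f = "\<lambda>P. eventually P (nhds x)"]) (use that in auto)
  then show ?thesis by (simp add: usc_on_def eventually_at_filter)
qed

lemma usc_on_subset: "usc_on S g \<Longrightarrow> T \<subseteq> S \<Longrightarrow> usc_on T g"
  unfolding usc_on_nhds by (fast elim: eventually_mono)

lemma usc_on_add:
  assumes "usc_on S g" "usc_on S h"
  shows "usc_on S (\<lambda>x. g x + h x)"
  unfolding usc_on_nhds
proof (intro ballI allI impI)
  fix x k assume x: "x \<in> S" "g x + h x < k"
  define d where "d = (k - (g x + h x)) / 2"
  have d: "d > 0" "k = g x + d + (h x + d)" using x by (auto simp: d_def field_simps)
  have "\<forall>\<^sub>F y in nhds x. y \<in> S \<longrightarrow> g y < g x + d" "\<forall>\<^sub>F y in nhds x. y \<in> S \<longrightarrow> h y < h x + d"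
    using assms x d(1) unfolding usc_on_nhds by (auto intro: less_add_same_cancel1[THEN iffD2])
  then show "\<forall>\<^sub>F y in nhds x. y \<in> S \<longrightarrow> g y + h y < k"
    by eventually_elim (use d(2) in auto)
qed

lemma continuous_imp_usc_on:
  assumes "continuous_on S g"
  shows "usc_on S g"
  unfolding usc_on_def
  using assms by (auto simp: continuous_on_def intro: order_tendstoD(2))

lemma lsc_on_imp_usc_on_minus:
  assumes "lsc_on S g"
  shows "usc_on S (\<lambda>x. - g x)"
  unfolding usc_on_def
proof (intro ballI allI impI)
  fix x k assume "x \<in> S" "- g x < k"
  then have "\<forall>\<^sub>F y in at x within S. - k < g y"
    using assms unfolding lsc_on_def by simp
  then show "\<forall>\<^sub>F y in at x within S. - g y < k" by eventually_elim simp
qed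

lemma usc_on_compose:
  assumes "usc_on S g" "continuous_on T f" "f ` T \<subseteq> S"
  shows "usc_on T (\<lambda>x. g (f x))"
  unfolding usc_on_def
proof (intro ballI allI impI)
  fix x k assume x: "x \<in> T" "g (f x) < k"
  have "(f \<longlongrightarrow> f x) (at x within T)" using assms(2) x by (auto simp: continuous_on_def)
  moreover have "\<forall>\<^sub>F y in nhds (f x). y \<in> S \<longrightarrow> g y < k"
    using assms(1,3) x unfolding usc_on_nhds by auto
  ultimately have "\<forall>\<^sub>F y in at x within T. f y \<in> S \<longrightarrow> g (f y) < k"
    by (rule eventually_compose_filterlim[rotated])
  moreover have "\<forall>\<^sub>F y in at x within T. y \<in> T" by (auto simp: eventually_at_filter)
  ultimately show "\<forall>\<^sub>F y in at x within T. g (f y) < k"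
    by eventually_elim (use assms(3) in auto)
qed

lemma usc_on_open_nhd:
  assumes "usc_on S g" "x \<in> S" "g x < k"
  shows "\<exists>V. open V \<and> x \<in> V \<and> (\<forall>y\<in>S. y \<in> V \<longrightarrow> g y < k)"
proof -
  have "\<forall>\<^sub>F y in nhds x. y \<in> S \<longrightarrow> g y < k"
    using assms unfolding usc_on_nhds by simp
  then show ?thesis unfolding eventually_nhds by auto
qed

text \<open>Without a maximum, every point would have a neighbourhood on which \<open>g\<close>
  stays below a larger value \<open>g (Y x)\<close>. The largest of the finitely many values from a
  subcover would then lie below another of them.\<close>

lemma usc_attains_sup:
  fixes g :: "'a::topological_space \<Rightarrow> real"
  assumes "compact S" "S \<noteq> {}" "usc_on S g"
  shows "\<exists>x\<in>S. \<forall>y\<in>S. g y \<le> g x"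
proof (rule ccontr)
  assume "\<not> ?thesis"
  then have "\<forall>x\<in>S. \<exists>y\<in>S. g x < g y" by (auto simp: not_le)
  then obtain Y where Y: "\<And>x. x \<in> S \<Longrightarrow> Y x \<in> S" "\<And>x. x \<in> S \<Longrightarrow> g x < g (Y x)" by metis
  have "\<forall>x\<in>S. \<exists>V. open V \<and> x \<in> V \<and> (\<forall>y\<in>S. y \<in> V \<longrightarrow> g y < g (Y x))"
    using usc_on_open_nhd[OF assms(3) _ Y(2)] by simp
  then obtain V where V: "\<And>x. x \<in> S \<Longrightarrow> open (V x)" "\<And>x. x \<in> S \<Longrightarrow> x \<in> V x"
    "\<And>x y. x \<in> S \<Longrightarrow> y \<in> S \<Longrightarrow> y \<in> V x \<Longrightarrow> g y < g (Y x)" by metis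
  have "S \<subseteq> (\<Union>x\<in>S. V x)" using V(2) by blast
  from compactE_image[OF assms(1) V(1) this]
  obtain C where C: "C \<subseteq> S" "finite C" "S \<subseteq> (\<Union>x\<in>C. V x)" by auto
  have ne: "(\<lambda>x. g (Y x)) ` C \<noteq> {}" using C(3) assms(2) by auto
  have "Max ((\<lambda>x. g (Y x)) ` C) \<in> (\<lambda>x. g (Y x)) ` C"
    using C(2) ne by (intro Max_in) auto
  then obtain m where m: "m \<in> C" "Max ((\<lambda>x. g (Y x)) ` C) = g (Y m)" by auto
  have "Y m \<in> S" using m C Y by auto
  then obtain x where x: "x \<in> C" "Y m \<in> V x" using C(3) by auto
  then have "g (Y m) < g (Y x)" using C(1) V(3) \<open>Y m \<in> S\<close> by blast
  also have "g (Y x) \<le> g (Y m)" unfolding m(2)[symmetric] using x C by (intro Max_ge) auto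
  finally show False by simp
qed

text \<open>Away from the zero set of the penalty \<open>D\<close>, a large
  multiple of \<open>D\<close> wins; near it, upper semicontinuity does.\<close>

lemma usc_penalisation:
  fixes G D :: "'a::topological_space \<Rightarrow> real"
  assumes "compact S" "usc_on S G" "continuous_on S D" "\<And>x. x \<in> S \<Longrightarrow> 0 \<le> D x"
    and zero: "\<And>x. x \<in> S \<Longrightarrow> D x = 0 \<Longrightarrow> G x < W"
  shows "\<exists>n>0. \<forall>m\<ge>n. \<forall>x\<in>S. G x - m * D x < W"
proof -
  have "\<exists>n>0. \<exists>V. open V \<and> x \<in> V \<and> (\<forall>y\<in>S. y \<in> V \<longrightarrow> G y - n * D y < W)" if x: "x \<in> S" for x
  proof -
    have "\<exists>n>0. G x - n * D x < W"
    proof (cases "D x = 0")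
      case True
      then show ?thesis using zero[OF x] by (intro exI[of _ 1]) auto
    next
      case False
      then have "0 < D x" using assms(4)[OF x] by simp
      then show ?thesis by (intro exI[of _ "(\<bar>G x - W\<bar> + 1) / D x"]) (auto simp: add_pos_nonneg)
    qed
    then obtain n where n: "n > 0" "G x - n * D x < W" by blast
    have "continuous_on S (\<lambda>x. - (n * D x))" by (intro continuous_intros assms)
    from usc_on_add[OF assms(2) continuous_imp_usc_on[OF this]]
    have "usc_on S (\<lambda>x. G x - n * D x)" by simp
    from usc_on_open_nhd[OF this x n(2)] n(1) show ?thesis by blast
  qed
  then obtain n V where V: "\<And>x. x \<in> S \<Longrightarrow> 0 < n x" "\<And>x. x \<in> S \<Longrightarrow> open (V x)" "\<And>x. x \<in> S \<Longrightarrow> x \<in> V x"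
    "\<And>x y. x \<in> S \<Longrightarrow> y \<in> S \<Longrightarrow> y \<in> V x \<Longrightarrow> G y - n x * D y < W" by metis
  have "S \<subseteq> (\<Union>x\<in>S. V x)" using V(3) by blast
  from compactE_image[OF assms(1) V(2) this]
  obtain C where C: "C \<subseteq> S" "finite C" "S \<subseteq> (\<Union>x\<in>C. V x)" by auto
  show ?thesis
  proof (intro exI[of _ "Max (insert 1 (n ` C))"] conjI allI impI ballI)
    show "0 < Max (insert 1 (n ` C))" using C(2) by (intro less_le_trans[OF zero_less_one Max_ge]) auto
    fix m y assume m: "Max (insert 1 (n ` C)) \<le> m" and y: "y \<in> S"
    obtain x where x: "x \<in> C" "y \<in> V x" using C(3) y by auto
    have "n x \<le> Max (insert 1 (n ` C))" using C(2) x by (intro Max_ge) auto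
    then have "n x * D y \<le> m * D y" using m assms(4)[OF y] by (intro mult_right_mono) auto
    with V(4)[of x y] x C(1) y show "G y - m * D y < W" by fastforce
  qed
qed

text \<open>Evaluation at \<open>t *\<^sub>R x\<close>, division by \<open>t\<close> and the limit
  at 0 from the right give \<open>l x \<le> 0\<close>; the same at \<open>- x\<close> gives
  equality.\<close>

lemma linear_le_quadratic_imp_zero:
  fixes l :: "'a::real_normed_vector \<Rightarrow> real"
  assumes l: "bounded_linear l" and le: "\<forall>\<^sub>F \<xi> in nhds 0. l \<xi> \<le> K * norm \<xi> ^ 2"
  shows "l x = 0"
proof -
  have le0: "l y \<le> 0" for y
  proof (rule tendsto_lowerbound[where F = "at_right (0::real)"])
    have "((\<lambda>t. t *\<^sub>R y) \<longlongrightarrow> 0 *\<^sub>R y) (at_right (0::real))" by (intro tendsto_intros)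
    then have "((\<lambda>t. t *\<^sub>R y) \<longlongrightarrow> 0) (at_right (0::real))" by simp
    with le have "\<forall>\<^sub>F t in at_right (0::real). l (t *\<^sub>R y) \<le> K * norm (t *\<^sub>R y) ^ 2"
      by (rule eventually_compose_filterlim)
    moreover have "\<forall>\<^sub>F t in at_right (0::real). 0 < t" by (rule eventually_at_right_less)
    ultimately show "\<forall>\<^sub>F t in at_right (0::real). l y \<le> t * (K * norm y ^ 2)"
    proof eventually_elim
      case (elim t)
      then have "t * l y \<le> t * (t * (K * norm y ^ 2))"
        using linear_scale[OF bounded_linear.linear[OF l]]
        by (simp add: power_mult_distrib power2_eq_square mult_ac)
      then show ?case using elim by simp
    qed
    have "((\<lambda>t. t * (K * norm y ^ 2)) \<longlongrightarrow> 0 * (K * norm y ^ 2)) (at_right (0::real))"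
      by (intro tendsto_intros)
    then show "((\<lambda>t. t * (K * norm y ^ 2)) \<longlongrightarrow> 0) (at_right (0::real))" by simp
  qed simp
  from le0[of x] le0[of "- x"] show ?thesis
    using linear_neg[OF bounded_linear.linear[OF l]] by simp
qed

section \<open>Semiconvexity along right increments\<close>

context step_two_group
begin

text \<open>Stated through supporting paraboloids from below along right increments, the form in
  which it meets superjets from above. Support is required for increments of every size, and the
  bound on the slope yields continuity.\<close>

definition semiconvex :: "real \<Rightarrow> ('a \<Rightarrow> real) \<Rightarrow> bool"
  where "semiconvex C U \<longleftrightarrow> (\<forall>\<eta>. norm \<eta> \<le> 1 \<longrightarrow> (\<exists>a. bounded_linear a \<and>
    (\<forall>\<xi>. \<bar>a \<xi>\<bar> \<le> C * norm \<xi>) \<and> (\<forall>\<xi>. U \<eta> + a \<xi> - C * norm \<xi> ^ 2 \<le> U (\<eta> \<odot> \<xi>))))"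

lemma semiconvex_mono: "semiconvex C U \<Longrightarrow> C \<le> C' \<Longrightarrow> semiconvex C' U"
  unfolding semiconvex_def
proof (intro allI impI)
  fix \<eta> :: 'a
  assume sc: "\<forall>\<eta>. norm \<eta> \<le> 1 \<longrightarrow> (\<exists>a. bounded_linear a \<and> (\<forall>\<xi>. \<bar>a \<xi>\<bar> \<le> C * norm \<xi>) \<and>
      (\<forall>\<xi>. U \<eta> + a \<xi> - C * norm \<xi> ^ 2 \<le> U (\<eta> \<odot> \<xi>)))" and "C \<le> C'" "norm \<eta> \<le> 1"
  then obtain a where a: "bounded_linear a" "\<And>\<xi>. \<bar>a \<xi>\<bar> \<le> C * norm \<xi>"
    "\<And>\<xi>. U \<eta> + a \<xi> - C * norm \<xi> ^ 2 \<le> U (\<eta> \<odot> \<xi>)" by blast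
  have C: "C * norm \<xi> \<le> C' * norm \<xi>" "C * norm \<xi> ^ 2 \<le> C' * norm \<xi> ^ 2" for \<xi> :: 'a
    using \<open>C \<le> C'\<close> by (auto intro: mult_right_mono)
  show "\<exists>a. bounded_linear a \<and> (\<forall>\<xi>. \<bar>a \<xi>\<bar> \<le> C' * norm \<xi>) \<and>
      (\<forall>\<xi>. U \<eta> + a \<xi> - C' * norm \<xi> ^ 2 \<le> U (\<eta> \<odot> \<xi>))"
  proof (intro exI[of _ a] conjI allI a(1))
    fix \<xi>
    show "\<bar>a \<xi>\<bar> \<le> C' * norm \<xi>" "U \<eta> + a \<xi> - C' * norm \<xi> ^ 2 \<le> U (\<eta> \<odot> \<xi>)"
      using a(2,3)[of \<xi>] C[of \<xi>] by linarith+
  qed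
qed

lemma bilinear_quadratic_bound:
  fixes \<beta> :: "'a \<Rightarrow> 'a \<Rightarrow> real"
  assumes "bounded_bilinear \<beta>"
  shows "\<exists>K\<ge>0. \<forall>\<xi>. \<beta> \<xi> \<xi> \<le> K * norm \<xi> ^ 2"
proof -
  obtain K where "K \<ge> 0" "\<And>a b. norm (\<beta> a b) \<le> norm a * norm b * K"
    using bounded_bilinear.nonneg_bounded[OF assms] by blast
  then show ?thesis
    by (intro exI[of _ K]) (fastforce simp: power2_eq_square mult_ac abs_le_iff)
qed

text \<open>The function lies between a paraboloid below and a superjet above, so the difference of
  the two slopes is a linear form dominated by a quadratic one.\<close>

lemma superjet_gradient_unique:
  assumes "bounded_linear a'" "\<And>\<xi>. U \<eta> + a' \<xi> - C * norm \<xi> ^ 2 \<le> U (\<eta> \<odot> \<xi>)"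
    and "superjet U \<eta> a b"
  shows "a = a'"
proof
  fix x
  obtain K where K: "\<And>\<xi>. b \<xi> \<xi> \<le> K * norm \<xi> ^ 2"
    using bilinear_quadratic_bound[OF superjetD(2)[OF assms(3)]] by blast
  have "a' x - a x = 0"
  proof (rule linear_le_quadratic_imp_zero[where K = "K + 1 + C" and l = "\<lambda>x. a' x - a x"])
    show "bounded_linear (\<lambda>x. a' x - a x)"
      by (intro bounded_linear_sub assms superjetD(1)[OF assms(3)])
    from superjetD(3)[OF assms(3), of 1]
    have "\<forall>\<^sub>F \<xi> in nhds 0. U (\<eta> \<odot> \<xi>) \<le> U \<eta> + a \<xi> + b \<xi> \<xi> + 1 * norm \<xi> ^ 2" by simp
    then show "\<forall>\<^sub>F \<xi> in nhds 0. a' \<xi> - a \<xi> \<le> (K + 1 + C) * norm \<xi> ^ 2"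
    proof eventually_elim
      case (elim \<xi>)
      with assms(2)[of \<xi>] K[of \<xi>] show ?case by (simp add: distrib_right)
    qed
  qed
  then show "a x = a' x" by simp
qed

text \<open>The support at \<open>x\<close> bounds \<open>U y\<close> from below and the support at
  \<open>y\<close> bounds \<open>U x\<close>. The two bounds agree because the increments between
  \<open>x\<close> and \<open>y\<close> are inverse to each other, hence of equal norm.\<close>

lemma semiconvex_continuous:
  assumes sc: "semiconvex C U" and "0 \<le> C"
  shows "continuous_on (cball 0 1) U"
  unfolding continuous_on_def
proof
  fix x :: 'a assume x: "x \<in> cball 0 1"
  have low: "U \<eta> - (C * norm (- \<eta> \<odot> \<zeta>) + C * norm (- \<eta> \<odot> \<zeta>) ^ 2) \<le> U \<zeta>" if \<eta>: "norm \<eta> \<le> 1" for \<eta> \<zeta>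
  proof -
    obtain a where a: "\<And>\<xi>. \<bar>a \<xi>\<bar> \<le> C * norm \<xi>" "\<And>\<xi>. U \<eta> + a \<xi> - C * norm \<xi> ^ 2 \<le> U (\<eta> \<odot> \<xi>)"
      using sc \<eta> unfolding semiconvex_def by blast
    from a(1)[of "- \<eta> \<odot> \<zeta>"] a(2)[of "- \<eta> \<odot> \<zeta>"] show ?thesis by (simp add: abs_le_iff)
  qed
  have sym: "norm (- y \<odot> x) = norm (- x \<odot> y)" for y
    using minus_gmult[of "- x" y] by (metis minus_minus norm_minus_cancel)
  have "((\<lambda>y. - x \<odot> y) \<longlongrightarrow> - x \<odot> x) (at x within cball 0 1)" by (intro tendsto_intros)
  then have n: "((\<lambda>y. norm (- x \<odot> y)) \<longlongrightarrow> 0) (at x within cball 0 1)"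
    by (simp add: tendsto_norm_zero)
  have "((\<lambda>y. U y - U x) \<longlongrightarrow> 0) (at x within cball 0 1)"
  proof (rule Lim_null_comparison)
    have "((\<lambda>y. C * norm (- x \<odot> y) + C * norm (- x \<odot> y) ^ 2) \<longlongrightarrow> C * 0 + C * 0 ^ 2)
      (at x within cball 0 1)" by (intro tendsto_intros n)
    then show "((\<lambda>y. C * norm (- x \<odot> y) + C * norm (- x \<odot> y) ^ 2) \<longlongrightarrow> 0) (at x within cball 0 1)"
      by simp
    have "\<forall>\<^sub>F y in at x within cball 0 1. y \<in> cball 0 1" by (auto simp: eventually_at_filter)
    then show "\<forall>\<^sub>F y in at x within cball 0 1. norm (U y - U x) \<le> C * norm (- x \<odot> y) + C * norm (- x \<odot> y) ^ 2"
    proof eventually_elim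
      case (elim y)
      then show ?case using low[of x y] low[of y x] x by (auto simp: sym abs_le_iff)
    qed
  qed
  then show "(U \<longlongrightarrow> U x) (at x within cball 0 1)" by (simp add: LIM_zero_iff)
qed

text \<open>Semiconvexity of the other summand puts \<open>U\<close> and \<open>V\<close> between two paraboloids at \<open>0\<close>,
  which forces nearby gradients to be close.\<close>

lemma semiconvex_gradients:
  assumes scU: "semiconvex C U" and scV: "semiconvex C V" and C: "0 \<le> C"
    and sum: "superjet (\<lambda>x. U x + V x) 0 \<alpha> \<beta>"
  shows "\<exists>a0 b0 E r. 0 < r \<and> 0 \<le> E \<and> (\<forall>\<xi>. a0 \<xi> + b0 \<xi> = \<alpha> \<xi>) \<and>
    (\<forall>\<eta> a b. norm \<eta> \<le> r \<longrightarrow> superjet U \<eta> a b \<longrightarrow> (\<forall>\<xi>. \<bar>a \<xi> - a0 \<xi>\<bar> \<le> E * norm \<eta> * norm \<xi>)) \<and>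
    (\<forall>\<eta> a b. norm \<eta> \<le> r \<longrightarrow> superjet V \<eta> a b \<longrightarrow> (\<forall>\<xi>. \<bar>a \<xi> - b0 \<xi>\<bar> \<le> E * norm \<eta> * norm \<xi>))"
proof -
  obtain a0 where a0: "bounded_linear a0" "\<And>\<xi>. \<bar>a0 \<xi>\<bar> \<le> C * norm \<xi>"
    "\<And>\<xi>. U 0 + a0 \<xi> - C * norm \<xi> ^ 2 \<le> U \<xi>"
    using scU[unfolded semiconvex_def, rule_format, of 0] by auto
  obtain b0 where b0: "bounded_linear b0" "\<And>\<xi>. \<bar>b0 \<xi>\<bar> \<le> C * norm \<xi>"
    "\<And>\<xi>. V 0 + b0 \<xi> - C * norm \<xi> ^ 2 \<le> V \<xi>"
    using scV[unfolded semiconvex_def, rule_format, of 0] by auto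
  have eq: "\<alpha> = (\<lambda>\<xi>. a0 \<xi> + b0 \<xi>)"
  proof (rule superjet_gradient_unique[OF _ _ sum, where C = "2 * C"])
    show "bounded_linear (\<lambda>\<xi>. a0 \<xi> + b0 \<xi>)" by (intro bounded_linear_add a0 b0)
    show "U 0 + V 0 + (a0 \<xi> + b0 \<xi>) - 2 * C * norm \<xi> ^ 2 \<le> U (0 \<odot> \<xi>) + V (0 \<odot> \<xi>)" for \<xi>
      using a0(3)[of \<xi>] b0(3)[of \<xi>] by simp
  qed
  obtain K where K: "0 \<le> K" "\<And>\<xi>. \<beta> \<xi> \<xi> \<le> K * norm \<xi> ^ 2"
    using bilinear_quadratic_bound[OF superjetD(2)[OF sum]] by blast
  obtain d where d: "0 < d"
    "\<And>x. norm x < d \<Longrightarrow> U x + V x \<le> U 0 + V 0 + \<alpha> x + \<beta> x x + 1 * norm x ^ 2"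
    using superjetD(3)[OF sum zero_less_one] by (auto simp: eventually_nhds_metric)
  define C2 where "C2 = K + 1 + C"
  define E where "E = 9 * C2 + 3 * C"
  define r where "r = min 1 (d / 4)"
  have r: "0 < r" "r \<le> 1" "3 * r < d" using d by (auto simp: r_def)
  have E: "0 \<le> E" using C K by (simp add: E_def C2_def)
  have main: "\<bar>a \<xi> - f0 \<xi>\<bar> \<le> E * norm \<eta> * norm \<xi>"
    if f0: "bounded_linear f0" "\<And>\<xi>. \<bar>f0 \<xi>\<bar> \<le> C * norm \<xi>" "\<And>\<xi>. F 0 + f0 \<xi> - C * norm \<xi> ^ 2 \<le> F \<xi>"
      and upper: "\<And>x. norm x < d \<Longrightarrow> F x \<le> F 0 + f0 x + C2 * norm x ^ 2"
      and sc: "semiconvex C F" and \<eta>: "norm \<eta> \<le> r" and jet: "superjet F \<eta> a b" for F f0 \<eta> a b \<xi>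
  proof -
    note f0l = bounded_linear.linear[OF f0(1)]
    note al = bounded_linear.linear[OF superjetD(1)[OF jet]]
    have "norm \<eta> \<le> 1" using \<eta> r by simp
    then obtain a' where a': "bounded_linear a'" "\<And>\<xi>. F \<eta> + a' \<xi> - C * norm \<xi> ^ 2 \<le> F (\<eta> \<odot> \<xi>)"
      using sc unfolding semiconvex_def by blast
    have aa: "a = a'" by (rule superjet_gradient_unique[OF a' jet])
    show ?thesis
    proof (cases "\<eta> = 0")
      case True
      have "a = f0"
        by (rule superjet_gradient_unique[OF f0(1) _ jet[unfolded True]]) (use f0(3) in simp)
      then show ?thesis by (simp add: True)
    next
      case False
      \<comment> \<open>The support at \<eta> is compared with the upper paraboloid at 0 at the
        point \<open>\<eta> \<odot> x\<close>, with \<open>x\<close> no longer than \<eta>: every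
        error is then quadratic in \<open>norm \<eta>\<close>. Rescaling an arbitrary vector to the
        length of \<eta> turns this into a bound linear in both.\<close>
      have le: "a x - f0 x \<le> E * norm \<eta> ^ 2" if x: "norm x \<le> norm \<eta>" for x
      proof -
        have "norm (\<eta> \<odot> x) \<le> norm \<eta> + (1 + norm \<eta>) * norm x" by (rule norm_gmult)
        also have "\<dots> \<le> norm \<eta> + 2 * norm \<eta>"
          using x \<open>norm \<eta> \<le> 1\<close> by (intro add_left_mono mult_mono) auto
        finally have n3: "norm (\<eta> \<odot> x) \<le> 3 * norm \<eta>" by simp
        then have "norm (\<eta> \<odot> x) < d" using \<eta> r by linarith
        from upper[OF this]
        have 1: "F (\<eta> \<odot> x) \<le> F 0 + f0 (\<eta> \<odot> x) + C2 * norm (\<eta> \<odot> x) ^ 2" .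
        have "C2 * norm (\<eta> \<odot> x) ^ 2 \<le> C2 * (3 * norm \<eta>) ^ 2"
          using n3 C K by (intro mult_left_mono power_mono) (auto simp: C2_def)
        then have 2: "C2 * norm (\<eta> \<odot> x) ^ 2 \<le> 9 * C2 * norm \<eta> ^ 2" by (simp add: power_mult_distrib)
        have 3: "C * norm x ^ 2 \<le> C * norm \<eta> ^ 2" using x C by (intro mult_left_mono power_mono) auto
        have "f0 (\<eta> \<odot> x) = f0 \<eta> + f0 x + f0 ((om \<eta> x / 2) *\<^sub>R c)"
          by (simp add: gmult_def linear_add[OF f0l])
        moreover have "f0 ((om \<eta> x / 2) *\<^sub>R c) \<le> C * norm \<eta> ^ 2"
        proof -
          have "f0 ((om \<eta> x / 2) *\<^sub>R c) \<le> C * norm ((om \<eta> x / 2) *\<^sub>R c)"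
            using f0(2)[of "(om \<eta> x / 2) *\<^sub>R c"] by linarith
          also have "norm ((om \<eta> x / 2) *\<^sub>R c) \<le> norm (om \<eta> x *\<^sub>R c)" by (simp add: mult_right_mono)
          also have "\<dots> \<le> norm \<eta> * norm x" by (rule norm_om_c)
          also have "\<dots> \<le> norm \<eta> ^ 2" unfolding power2_eq_square using x by (intro mult_left_mono) auto
          finally show ?thesis using C by (simp add: mult_left_mono)
        qed
        ultimately have "a x - f0 x \<le> 9 * C2 * norm \<eta> ^ 2 + C * norm \<eta> ^ 2 + C * norm \<eta> ^ 2 + C * norm \<eta> ^ 2"
          using a'(2)[of x] f0(3)[of \<eta>] 1 2 3 unfolding aa by linarith
        also have "\<dots> = E * norm \<eta> ^ 2" by (simp add: E_def algebra_simps)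
        finally show ?thesis .
      qed
      have le2: "a x - f0 x \<le> E * norm \<eta> * norm x" for x
      proof (cases "x = 0")
        case True
        then show ?thesis by (simp add: linear_0[OF al] linear_0[OF f0l])
      next
        case False
        define t where "t = norm \<eta> / norm x"
        have t: "0 < t" using False \<open>\<eta> \<noteq> 0\<close> by (simp add: t_def)
        have "norm (t *\<^sub>R x) \<le> norm \<eta>" using False by (simp add: t_def)
        from le[OF this] have "t * (a x - f0 x) \<le> E * norm \<eta> ^ 2"
          by (simp add: linear_scale[OF al] linear_scale[OF f0l] right_diff_distrib)
        also have "\<dots> = t * (E * norm \<eta> * norm x)"
          using False by (simp add: t_def power2_eq_square)
        finally show ?thesis using t by simp
      qed
      from le2[of \<xi>] le2[of "- \<xi>"] show ?thesis
        by (simp add: linear_neg[OF al] linear_neg[OF f0l] abs_le_iff)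
    qed
  qed
  have upU: "U x \<le> U 0 + a0 x + C2 * norm x ^ 2" if "norm x < d" for x
    using d(2)[OF that] b0(3)[of x] K(2)[of x] by (simp add: C2_def eq distrib_right)
  have upV: "V x \<le> V 0 + b0 x + C2 * norm x ^ 2" if "norm x < d" for x
    using d(2)[OF that] a0(3)[of x] K(2)[of x] by (simp add: C2_def eq distrib_right)
  show ?thesis
    using r E main[OF a0 upU scU] main[OF b0 upV scV] eq
    by (intro exI[of _ a0] exI[of _ b0] exI[of _ E] exI[of _ r]) auto
qed

end

section \<open>Sup-convolutions over left translations\<close>

context step_two_group
begin

text \<open>The element \<open>x \<odot> - z\<close> is the left translation that takes
  \<open>z\<close> to \<open>x\<close>. The supremum thus runs over the values of \<open>u\<close>
  at left translates of \<open>z\<close>, penalised by the size of the translation.\<close>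

definition supconv :: "real \<Rightarrow> real \<Rightarrow> ('a \<Rightarrow> real) \<Rightarrow> 'a \<Rightarrow> real"
  where "supconv r m u z = (SUP x\<in>cball 0 r. u x - m * norm (x \<odot> - z) ^ 2)"

lemma supconv_attained:
  assumes "usc_on (cball 0 r) u" "0 \<le> r"
  shows "\<exists>x\<in>cball 0 r. supconv r m u z = u x - m * norm (x \<odot> - z) ^ 2 \<and>
    (\<forall>y\<in>cball 0 r. u y - m * norm (y \<odot> - z) ^ 2 \<le> supconv r m u z)"
proof -
  have "continuous_on (cball 0 r) (\<lambda>x. - (m * norm (x \<odot> - z) ^ 2))"
    by (intro continuous_intros)
  from usc_on_add[OF assms(1) continuous_imp_usc_on[OF this]]
  have "usc_on (cball 0 r) (\<lambda>x. u x - m * norm (x \<odot> - z) ^ 2)" by simp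
  from usc_attains_sup[OF compact_cball _ this] \<open>0 \<le> r\<close>
  obtain x where x: "x \<in> cball 0 r"
    "\<forall>y\<in>cball 0 r. u y - m * norm (y \<odot> - z) ^ 2 \<le> u x - m * norm (x \<odot> - z) ^ 2"
    by fastforce
  have "supconv r m u z = u x - m * norm (x \<odot> - z) ^ 2"
    unfolding supconv_def by (rule cSup_eq_maximum) (use x in auto)
  with x show ?thesis by auto
qed

lemma supconv_ge:
  assumes "usc_on (cball 0 r) u" "norm y \<le> r"
  shows "u y - m * norm (y \<odot> - z) ^ 2 \<le> supconv r m u z"
proof -
  have "0 \<le> r" using assms(2) norm_ge_zero order_trans by blast
  from supconv_attained[OF assms(1) this, of m z] assms(2) show ?thesis by auto
qed

lemma supconv_le:
  assumes "usc_on (cball 0 r) u" "0 \<le> r" "0 \<le> m" "\<And>x. norm x \<le> r \<Longrightarrow> u x \<le> M"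
  shows "supconv r m u z \<le> M"
proof -
  obtain x where x: "norm x \<le> r" "supconv r m u z = u x - m * norm (x \<odot> - z) ^ 2"
    using supconv_attained[OF assms(1,2), of m z] by auto
  moreover have "0 \<le> m * norm (x \<odot> - z) ^ 2" using assms(3) by simp
  ultimately show ?thesis using assms(4)[OF x(1)] by linarith
qed

text \<open>If \<open>x\<close> is a maximiser for \<open>z\<close>, then
  \<open>x \<odot> \<eta>\<close> competes for \<open>z \<odot> \<eta>\<close> with the same
  translating element and hence the same penalty. So the superjet moves from \<open>z\<close> to
  \<open>x\<close> without any change.\<close>

lemma supconv_superjet:
  assumes usc: "usc_on (cball 0 r) u" and jet: "superjet (supconv r m u) z \<alpha> \<beta>"
    and x: "norm x < r" "supconv r m u z = u x - m * norm (x \<odot> - z) ^ 2"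
  shows "superjet u x \<alpha> \<beta>"
proof (rule superjet_touch[OF jet])
  have "\<forall>\<^sub>F \<eta> in nhds 0. x \<odot> \<eta> \<in> ball 0 r"
  proof -
    have "((\<lambda>\<eta>. x \<odot> \<eta>) \<longlongrightarrow> x \<odot> 0) (nhds 0)" by (intro tendsto_intros filterlim_ident)
    then show ?thesis using x(1) by (intro topological_tendstoD[where l = "x \<odot> 0"]) auto
  qed
  then show "\<forall>\<^sub>F \<eta> in nhds 0. u (x \<odot> \<eta>) - u x \<le> supconv r m u (z \<odot> \<eta>) - supconv r m u z"
  proof eventually_elim
    case (elim \<eta>)
    have "(x \<odot> \<eta>) \<odot> - (z \<odot> \<eta>) = x \<odot> - z"
      by (simp add: minus_gmult gmult_assoc flip: gmult_assoc[of \<eta> "- \<eta>"])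
    with supconv_ge[OF usc, of "x \<odot> \<eta>" m "z \<odot> \<eta>"] elim x(2) show ?case by simp
  qed
qed

text \<open>Affine dependence on \<xi> makes the penalty an exact quadratic polynomial in the
  increment.\<close>

lemma gmult_minus_gmult: "x \<odot> - (z \<odot> \<xi>) = x \<odot> - z - ltr (x + z) \<xi>"
  by (simp add: gmult_def ltr_def om.add_left om.add_right om.diff_right om.minus_right om.scaleR_right
      add_divide_distrib diff_divide_distrib algebra_simps)

text \<open>Keeping the maximiser \<open>x\<close> of the base point while the point moves gives a
  lower bound, which is a paraboloid in the increment. Its constants depend only on
  \<open>r\<close>, \<open>m\<close> and the base point.\<close>

lemma supconv_semiconvex:
  assumes usc: "usc_on (cball 0 r) u" and "0 \<le> r" "0 \<le> m"
  shows "\<exists>C\<ge>0. semiconvex C (\<lambda>\<eta>. supconv r m u (z0 \<odot> \<eta>))"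
proof -
  define Z where "Z = norm z0 + (1 + norm z0) * 1"
  define Xb where "Xb = r + (1 + r) * Z"
  define Lb where "Lb = 1 + (r + Z)"
  define C where "C = 2 * m * (Xb * Lb) + m * Lb\<^sup>2"
  have pos: "0 \<le> Z" "0 \<le> Xb" "0 \<le> Lb" using assms by (auto simp: Z_def Xb_def Lb_def)
  then have C: "0 \<le> C" "2 * m * (Xb * Lb) \<le> C" "m * Lb\<^sup>2 \<le> C" using assms by (auto simp: C_def)
  have "semiconvex C (\<lambda>\<eta>. supconv r m u (z0 \<odot> \<eta>))"
    unfolding semiconvex_def
  proof (intro allI impI)
    fix \<eta> :: 'a assume \<eta>: "norm \<eta> \<le> 1"
    define z where "z = z0 \<odot> \<eta>"
    have z: "norm z \<le> Z"
      unfolding z_def Z_def using \<eta>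
      by (intro order_trans[OF norm_gmult] add_left_mono mult_left_mono) auto
    obtain x where x: "norm x \<le> r" "supconv r m u z = u x - m * norm (x \<odot> - z) ^ 2"
      using supconv_attained[OF usc \<open>0 \<le> r\<close>, of m z] by auto
    define X where "X = x \<odot> - z"
    have X: "norm X \<le> Xb"
    proof -
      have "norm X \<le> norm x + (1 + norm x) * norm z" unfolding X_def using norm_gmult[of x "- z"] by simp
      also have "\<dots> \<le> r + (1 + r) * Z" using x z pos assms(2) by (intro add_mono mult_mono) auto
      finally show ?thesis by (simp add: Xb_def)
    qed
    have l: "norm (ltr (x + z) \<xi>) \<le> Lb * norm \<xi>" for \<xi>
    proof -
      have "norm (ltr (x + z) \<xi>) \<le> (1 + norm (x + z)) * norm \<xi>" by (rule norm_ltr)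
      also have "\<dots> \<le> Lb * norm \<xi>"
        using norm_triangle_ineq[of x z] x z by (intro mult_right_mono) (auto simp: Lb_def)
      finally show ?thesis .
    qed
    show "\<exists>a. bounded_linear a \<and> (\<forall>\<xi>. \<bar>a \<xi>\<bar> \<le> C * norm \<xi>) \<and>
      (\<forall>\<xi>. supconv r m u (z0 \<odot> \<eta>) + a \<xi> - C * norm \<xi> ^ 2 \<le> supconv r m u (z0 \<odot> (\<eta> \<odot> \<xi>)))"
    proof (intro exI[of _ "\<lambda>\<xi>. (2 * m) * (X \<bullet> ltr (x + z) \<xi>)"] conjI allI)
      show "bounded_linear (\<lambda>\<xi>. (2 * m) * (X \<bullet> ltr (x + z) \<xi>))"
        by (intro bounded_linear_const_mult bounded_linear_compose[OF bounded_linear_inner_right]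
            bounded_linear_ltr)
      fix \<xi> :: 'a
      have "\<bar>X \<bullet> ltr (x + z) \<xi>\<bar> \<le> norm X * norm (ltr (x + z) \<xi>)" by (rule Cauchy_Schwarz_ineq2)
      also have "\<dots> \<le> Xb * (Lb * norm \<xi>)" using X l pos by (intro mult_mono) auto
      finally have "2 * m * \<bar>X \<bullet> ltr (x + z) \<xi>\<bar> \<le> 2 * m * (Xb * (Lb * norm \<xi>))"
        using \<open>0 \<le> m\<close> by (intro mult_left_mono) auto
      also have "\<dots> = 2 * m * (Xb * Lb) * norm \<xi>" by simp
      also have "\<dots> \<le> C * norm \<xi>" using C by (intro mult_right_mono) auto
      finally show "\<bar>2 * m * (X \<bullet> ltr (x + z) \<xi>)\<bar> \<le> C * norm \<xi>"
        using \<open>0 \<le> m\<close> by (simp add: abs_mult)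
      have "m * norm (ltr (x + z) \<xi>) ^ 2 \<le> m * (Lb * norm \<xi>) ^ 2"
        using l \<open>0 \<le> m\<close> by (intro mult_left_mono power_mono) auto
      also have "\<dots> = m * Lb\<^sup>2 * norm \<xi> ^ 2" by (simp add: power_mult_distrib)
      also have "\<dots> \<le> C * norm \<xi> ^ 2" using C by (intro mult_right_mono) auto
      finally have q: "m * norm (ltr (x + z) \<xi>) ^ 2 \<le> C * norm \<xi> ^ 2" .
      have "norm (x \<odot> - (z \<odot> \<xi>)) ^ 2 = norm X ^ 2 - 2 * (X \<bullet> ltr (x + z) \<xi>) + norm (ltr (x + z) \<xi>) ^ 2"
        unfolding gmult_minus_gmult X_def[symmetric] power2_norm_eq_inner
        by (simp add: inner_diff inner_commute)
      from arg_cong[where f = "\<lambda>t. m * t", OF this]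
      have "m * norm (x \<odot> - (z \<odot> \<xi>)) ^ 2
        = m * norm X ^ 2 - 2 * m * (X \<bullet> ltr (x + z) \<xi>) + m * norm (ltr (x + z) \<xi>) ^ 2"
        by (simp add: algebra_simps)
      with supconv_ge[OF usc x(1), of m "z \<odot> \<xi>"] q x(2)
      show "supconv r m u (z0 \<odot> \<eta>) + 2 * m * (X \<bullet> ltr (x + z) \<xi>) - C * norm \<xi> ^ 2
        \<le> supconv r m u (z0 \<odot> (\<eta> \<odot> \<xi>))"
        by (simp add: z_def[symmetric] X_def[symmetric] gmult_assoc[symmetric])
    qed
  qed
  with C show ?thesis by blast
qed

end

section \<open>Freezing the nonlinearity and adding the two inequalities\<close>

context parabolic_group
begin

text \<open>A value of the sup-convolution within \<open>m * x0\<^sup>2\<close> of the bound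
  \<open>Mu\<close> forces its maximiser to lie within \<open>x0\<close> of the point, in the sense
  of the translating element, and so within 2 \<nu> of 0. Freezing the space argument costs one
  \<kappa>, freezing the gradient another.\<close>

lemma supconv_frozen:
  assumes usc: "usc_on (cball 0 r) u" and pos: "0 < m" "0 < \<nu>" "0 < x0" "0 \<le> L"
    and sub: "\<And>x \<alpha> \<beta>. norm x < r \<Longrightarrow> superjet u x \<alpha> \<beta> \<Longrightarrow> par \<alpha> \<beta> + H x (\<alpha> e1) (\<alpha> e2) \<le> 0"
    and lip: "\<And>x p q p' q'. \<bar>H x p q - H x p' q'\<bar> \<le> L * (\<bar>p - p'\<bar> + \<bar>q - q'\<bar>)"
    and near: "\<And>x p q. norm x < 2 * \<nu> \<Longrightarrow> \<bar>H x p q - H 0 p q\<bar> \<le> \<kappa>"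
    and r: "2 * \<nu> \<le> r" and x0: "x0 * (1 + \<nu>) \<le> \<nu>"
    and Mu: "\<And>x. norm x \<le> r \<Longrightarrow> u x \<le> Mu"
    and z: "norm z < \<nu>" "Mu - m * x0\<^sup>2 \<le> supconv r m u z"
    and grad: "L * (\<bar>\<alpha> e1 - p\<bar> + \<bar>\<alpha> e2 - q\<bar>) \<le> \<kappa>"
    and jet: "superjet (supconv r m u) z \<alpha> \<beta>"
  shows "par \<alpha> \<beta> \<le> - H 0 p q + 2 * \<kappa>"
proof -
  have "0 \<le> r" using pos r by linarith
  then obtain x where x: "norm x \<le> r" "supconv r m u z = u x - m * norm (x \<odot> - z) ^ 2"
    using supconv_attained[OF usc, of m z] by auto
  have "m * norm (x \<odot> - z) ^ 2 \<le> m * x0\<^sup>2" using Mu[OF x(1)] x(2) z(2) by linarith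
  then have "norm (x \<odot> - z) \<le> x0"
    using pos by (simp add: power_mono_iff)
  moreover have "norm x \<le> norm (x \<odot> - z) + (1 + norm (x \<odot> - z)) * norm z"
    using norm_gmult[of "x \<odot> - z" z] by simp
  moreover have "(1 + norm (x \<odot> - z)) * norm z \<le> (1 + x0) * norm z"
    using \<open>norm (x \<odot> - z) \<le> x0\<close> by (intro mult_right_mono) auto
  moreover have "(1 + x0) * norm z < (1 + x0) * \<nu>" using z(1) pos by simp
  moreover have "x0 + (1 + x0) * \<nu> = x0 * (1 + \<nu>) + \<nu>" by (simp add: algebra_simps)
  ultimately have x\<nu>: "norm x < 2 * \<nu>" using x0 by linarith
  have "superjet u x \<alpha> \<beta>"
    by (rule supconv_superjet[OF usc jet _ x(2)]) (use x\<nu> r in linarith)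
  with sub[of x \<alpha> \<beta>] x\<nu> r have "par \<alpha> \<beta> + H x (\<alpha> e1) (\<alpha> e2) \<le> 0" by auto
  with near[OF x\<nu>, of "\<alpha> e1" "\<alpha> e2"] lip[of 0 "\<alpha> e1" "\<alpha> e2" p q] grad
  show ?thesis by (auto simp: abs_le_iff)
qed

text \<open>The choices are nested: \<theta> determines \<kappa>, this determines \<nu>, and then
  comes \<open>m\<close>. The semiconvexity constants depend on \<open>m\<close>, but they enter
  only the radius \<open>R\<close>, which is chosen after them, so their size is harmless.\<close>

lemma sum_superjet_inequality:
  fixes G :: "'a \<Rightarrow> real \<Rightarrow> real \<Rightarrow> real"
  assumes "0 < \<rho>" and usc: "usc_on (cball 0 \<rho>) u" "usc_on (cball 0 \<rho>) w"
    and u: "\<And>z \<alpha> \<beta>. norm z < \<rho> \<Longrightarrow> superjet u z \<alpha> \<beta> \<Longrightarrow> par \<alpha> \<beta> + G z (\<alpha> e1) (\<alpha> e2) \<le> 0"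
    and w: "\<And>z \<alpha> \<beta>. norm z < \<rho> \<Longrightarrow> superjet w z \<alpha> \<beta> \<Longrightarrow> par \<alpha> \<beta> - G z (- \<alpha> e1) (- \<alpha> e2) \<le> 0"
    and "0 \<le> L" and lip: "\<And>z p q p' q'. \<bar>G z p q - G z p' q'\<bar> \<le> L * sqrt ((p - p')\<^sup>2 + (q - q')\<^sup>2)"
    and cont: "\<And>\<kappa>. 0 < \<kappa> \<Longrightarrow> \<exists>\<delta>>0. \<forall>z p q. norm z < \<delta> \<longrightarrow> \<bar>G z p q - G 0 p q\<bar> \<le> \<kappa>"
    and sum: "superjet (\<lambda>z. u z + w z) 0 \<alpha> \<beta>"
  shows "par \<alpha> \<beta> \<le> L * sqrt ((\<alpha> e1)\<^sup>2 + (\<alpha> e2)\<^sup>2)"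
proof (rule ccontr)
  define hn where "hn p q = L * sqrt (p\<^sup>2 + q\<^sup>2)" for p q
  assume "\<not> par \<alpha> \<beta> \<le> L * sqrt ((\<alpha> e1)\<^sup>2 + (\<alpha> e2)\<^sup>2)"
  then have "\<not> par \<alpha> \<beta> \<le> hn (\<alpha> e1) (\<alpha> e2)" by (simp add: hn_def)
  then obtain \<theta> where \<theta>: "0 < \<theta>" "par \<alpha> \<beta> = hn (\<alpha> e1) (\<alpha> e2) + 3 * \<theta>"
    by (intro that[of "(par \<alpha> \<beta> - hn (\<alpha> e1) (\<alpha> e2)) / 3"]) (auto simp: field_simps)
  then have "hn (\<alpha> e1) (\<alpha> e2) + \<theta> < par \<alpha> \<beta>" by simp
  from superjet_strict_touch[OF sum this]
  obtain B \<epsilon> r1 where B: "bounded_bilinear B" and "hn (\<alpha> e1) (\<alpha> e2) + \<theta> < par \<alpha> B"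
    and \<epsilon>: "0 < \<epsilon>" and r1: "0 < r1"
    and touch: "\<And>z. norm z \<le> r1 \<Longrightarrow> u z + w z \<le> u 0 + w 0 + \<alpha> z + B z z - \<epsilon> * norm z ^ 2"
    by blast
  then have parB: "par \<alpha> B - hn (\<alpha> e1) (\<alpha> e2) > \<theta>" by simp
  note \<alpha> = superjetD(1)[OF sum]
  define \<alpha>z where "\<alpha>z z \<eta> = \<alpha> (ltr z \<eta>) + B z (ltr z \<eta>) + B (ltr z \<eta>) z" for z \<eta>
  define Bz where "Bz z \<eta> \<xi> = B (ltr z \<eta>) (ltr z \<xi>)" for z \<eta> \<xi>
  define \<phi> where "\<phi> x = \<alpha> x + B x x" for x
  have \<phi>jet: "jet \<phi> z (\<alpha>z z) (Bz z)" for z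
    using jet_quadratic[OF \<alpha> B, of z] by (simp add: \<phi>_def[abs_def] \<alpha>z_def[abs_def] Bz_def[abs_def])
  have "((\<lambda>z. par (\<alpha>z z) (Bz z) - hn (\<alpha>z z e1) (\<alpha>z z e2)) \<longlongrightarrow> par \<alpha> B - hn (\<alpha> e1) (\<alpha> e2)) (nhds 0)"
  proof -
    have "((\<lambda>z. \<alpha>z z y) \<longlongrightarrow> \<alpha> y) (nhds 0)" for y
      unfolding \<alpha>z_def using quadratic_gradient_tendsto[OF \<alpha> B] .
    then show ?thesis
      using quadratic_par_tendsto[OF \<alpha> B] unfolding \<alpha>z_def[symmetric] Bz_def[symmetric] hn_def
      by (intro tendsto_intros) (simp_all add: \<alpha>z_def[abs_def] Bz_def[abs_def])
  qed
  from order_tendstoD(1)[OF this parB] obtain d where d: "d > 0"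
    "\<And>z. norm z < d \<Longrightarrow> \<theta> < par (\<alpha>z z) (Bz z) - hn (\<alpha>z z e1) (\<alpha>z z e2)"
    by (auto simp: eventually_nhds_metric)
  have below: "u z + w z \<le> u 0 + w 0 + \<phi> z - \<epsilon> * norm z ^ 2" if "norm z \<le> r1" for z
    using touch[OF that] by (simp add: \<phi>_def)
  define r where "r = min \<rho> r1"
  have r: "0 < r" "r \<le> \<rho>" "r \<le> r1" using \<open>0 < \<rho>\<close> r1 by (auto simp: r_def)
  have uscr: "usc_on (cball 0 r) u" "usc_on (cball 0 r) w"
    using r by (auto intro: usc_on_subset[OF usc(1)] usc_on_subset[OF usc(2)])
  have bdd: "\<exists>m. \<forall>z. norm z \<le> r \<longrightarrow> f z \<le> m" if f: "usc_on (cball 0 r) f" for f :: "'a \<Rightarrow> real"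
  proof -
    have "cball (0::'a) r \<noteq> {}" using r by simp
    from usc_attains_sup[OF compact_cball this f] obtain x where "\<forall>y\<in>cball 0 r. f y \<le> f x" by blast
    then show ?thesis by (intro exI[of _ "f x"]) auto
  qed
  have \<phi>c: "continuous_on S \<phi>" for S
    unfolding \<phi>_def[abs_def]
    by (intro continuous_intros bounded_linear.continuous_on[OF \<alpha>] bounded_bilinear.continuous_on[OF B])
  have \<phi>0: "\<phi> 0 = 0"
    using bounded_linear.linear[OF \<alpha>] by (simp add: \<phi>_def linear_0 bounded_bilinear.zero_left[OF B])
  obtain Mu where Mu: "\<And>z. norm z \<le> r \<Longrightarrow> u z \<le> Mu" using bdd[OF uscr(1)] by blast
  obtain Mw where Mw: "\<And>z. norm z \<le> r \<Longrightarrow> w z \<le> Mw" using bdd[OF uscr(2)] by blast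
  have "usc_on (cball 0 r) (\<lambda>z. - \<phi> z)"
    by (intro continuous_imp_usc_on continuous_intros \<phi>c)
  from bdd[OF this] obtain M\<phi> where M\<phi>: "\<And>z. norm z \<le> r \<Longrightarrow> - \<phi> z \<le> M\<phi>" by blast
  \<comment> \<open>Adding the two frozen inequalities loses 4 \<kappa>, half of the excess
    \<theta>.\<close>
  define \<kappa> where "\<kappa> = \<theta> / 8"
  have \<kappa>: "0 < \<kappa>" using \<theta> by (simp add: \<kappa>_def)
  obtain \<delta> where \<delta>: "0 < \<delta>" "\<And>z p q. norm z < \<delta> \<Longrightarrow> \<bar>G z p q - G 0 p q\<bar> \<le> \<kappa>"
    using cont[OF \<kappa>] by blast
  define \<nu> where "\<nu> = min r (min d \<delta>) / 2"
  have \<nu>: "0 < \<nu>" "2 * \<nu> \<le> r" "2 * \<nu> \<le> d" "2 * \<nu> \<le> \<delta>" using r d \<delta> by (auto simp: \<nu>_def)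
  define W where "W = u 0 + w 0"
  \<comment> \<open>How far either sup-convolution can fall below its upper bound at the maximum
    point. The extra 1 leaves room for moving to nearby points, by continuity.\<close>
  define cst where "cst = Mu + Mw + M\<phi> - W + 1"
  have cst: "0 < cst"
    using Mu[of 0] Mw[of 0] M\<phi>[of 0] r \<phi>0 by (simp add: cst_def W_def)
  define x0 where "x0 = \<nu> / (1 + \<nu>)"
  have x0: "0 < x0" "x0 * (1 + \<nu>) \<le> \<nu>" using \<nu> by (auto simp: x0_def)
  define K where "K = cball (0::'a) r \<times> cball (0::'a) r \<times> cball (0::'a) r"
  have K: "compact K" unfolding K_def by (intro compact_Times compact_cball)
  \<comment> \<open>The sum of the sup-convolutions minus \<phi>, written out before the suprema are
    taken: \<open>z\<close> is where they are evaluated, \<open>x\<close> and \<open>y\<close> are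
    the competitors, and \<open>D\<close> collects both penalties.\<close>
  define T where "T = (\<lambda>(z, x, y). u x + w y - \<phi> z)"
  define D where "D = (\<lambda>(z, x, y). norm (x \<odot> - z) ^ 2 + norm (y \<odot> - z) ^ 2)"
  have T: "usc_on K T"
  proof -
    have 1: "usc_on K (\<lambda>p. u (fst (snd p)))"
      by (rule usc_on_compose[OF uscr(1)]) (auto simp: K_def intro!: continuous_intros)
    have 2: "usc_on K (\<lambda>p. w (snd (snd p)))"
      by (rule usc_on_compose[OF uscr(2)]) (auto simp: K_def intro!: continuous_intros)
    have 3: "usc_on K (\<lambda>p. - \<phi> (fst p))"
      by (intro continuous_imp_usc_on continuous_intros continuous_on_compose2[OF \<phi>c[of UNIV]]) auto
    show ?thesis
      using usc_on_add[OF usc_on_add[OF 1 2] 3] by (simp add: T_def case_prod_beta')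
  qed
  have D: "continuous_on K D"
    unfolding D_def case_prod_beta by (intro continuous_intros)
  have D0: "0 \<le> D p" for p by (simp add: D_def case_prod_beta)
  \<comment> \<open>On this set \<open>D = 0\<close> forces \<open>x = y = z\<close> with norm at
    least \<nu>, where strict contact puts \<open>T\<close> below \<open>W\<close>. For large
    \<open>m\<close> the maximum of \<open>T - m * D\<close> must therefore lie in the removed
    product of balls.\<close>
  define S where "S = K - ball 0 \<nu> \<times> ball 0 \<nu> \<times> ball 0 \<nu>"
  have S: "compact S" "S \<subseteq> K"
    unfolding S_def using K by (auto intro: compact_diff open_Times)
  have zero: "T p < W" if p: "p \<in> S" "D p = 0" for p
  proof -
    obtain z x y where pz: "p = (z, x, y)" by (cases p) auto
    have "x \<odot> - z = 0" "y \<odot> - z = 0" using p(2) by (auto simp: pz D_def add_nonneg_eq_0_iff)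
    then have xz: "x = z" and yz: "y = z"
      using gmult_cancel_right(2)[of x z] gmult_cancel_right(2)[of y z]
      by (simp_all del: gmult_cancel_right)
    with p(1) \<nu> have z: "norm z \<le> r" "\<nu> \<le> norm z"
      by (simp_all add: S_def K_def pz)
    have "0 < \<epsilon> * norm z ^ 2" using z(2) \<nu> \<epsilon> by (intro mult_pos_pos zero_less_power) auto
    with below[of z] z r show ?thesis by (simp add: pz T_def xz yz W_def)
  qed
  obtain n where n: "0 < n" "\<And>m p. n \<le> m \<Longrightarrow> p \<in> S \<Longrightarrow> T p - m * D p < W"
    using usc_penalisation[OF S(1) usc_on_subset[OF T S(2)] continuous_on_subset[OF D S(2)] D0 zero]
    by blast
  define m where "m = max n (cst / x0\<^sup>2)"
  have m: "n \<le> m" "0 < m" "cst \<le> m * x0\<^sup>2"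
    using n(1) x0 by (auto simp: m_def less_max_iff_disj pos_divide_le_eq[symmetric])
  have "continuous_on K (\<lambda>p. - (m * D p))" by (intro continuous_intros D)
  from usc_on_add[OF T continuous_imp_usc_on[OF this]] have "usc_on K (\<lambda>p. T p - m * D p)" by simp
  moreover have "K \<noteq> {}" using r by (auto simp: K_def)
  ultimately have "\<exists>p\<in>K. \<forall>p'\<in>K. T p' - m * D p' \<le> T p - m * D p"
    using usc_attains_sup[OF K] by blast
  then obtain p where p: "p \<in> K" "\<And>p'. p' \<in> K \<Longrightarrow> T p' - m * D p' \<le> T p - m * D p"
    by blast
  obtain z x y where pz: "p = (z, x, y)" by (cases p) auto
  have "W \<le> T p - m * D p"
    using p(2)[of "(0, 0, 0)"] r \<phi>0 by (simp add: K_def T_def D_def W_def)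
  with n(2)[OF m(1), of p] have "p \<notin> S" by fastforce
  then have zn: "norm z < \<nu>" using p(1) by (simp add: S_def pz)
  have zxy: "norm z \<le> r" "norm x \<le> r" "norm y \<le> r" using p(1) by (auto simp: K_def pz)
  define U where "U = supconv r m u"
  define V where "V = supconv r m w"
  have UV: "U a + V a - \<phi> a \<le> T p - m * D p" if a: "norm a \<le> r" for a
  proof -
    obtain b where b: "b \<in> cball 0 r" "U a = u b - m * norm (b \<odot> - a) ^ 2"
      unfolding U_def using supconv_attained[OF uscr(1), of m a] r by auto
    obtain b' where b': "b' \<in> cball 0 r" "V a = w b' - m * norm (b' \<odot> - a) ^ 2"
      unfolding V_def using supconv_attained[OF uscr(2), of m a] r by auto
    show ?thesis
      using p(2)[of "(a, b, b')"] a b b' by (simp add: K_def T_def D_def algebra_simps)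
  qed
  have UVz: "T p - m * D p \<le> U z + V z - \<phi> z"
    using supconv_ge[OF uscr(1) zxy(2), of m z] supconv_ge[OF uscr(2) zxy(3), of m z]
    by (simp add: U_def V_def T_def D_def pz algebra_simps)
  have lowU: "Mu - m * x0\<^sup>2 + 1 \<le> U z" and lowV: "Mw - m * x0\<^sup>2 + 1 \<le> V z"
  proof -
    have "U z \<le> Mu" "V z \<le> Mw"
      using supconv_le[OF uscr(1) _ _ Mu] supconv_le[OF uscr(2) _ _ Mw] r m(2) by (simp_all add: U_def V_def)
    with UVz \<open>W \<le> T p - m * D p\<close> M\<phi>[OF zxy(1)] m(3)
    show "Mu - m * x0\<^sup>2 + 1 \<le> U z" "Mw - m * x0\<^sup>2 + 1 \<le> V z" by (auto simp: cst_def)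
  qed
  \<comment> \<open>Both functions are recentred at the maximum point by a left translation, so that
    the gradient estimate and the linear sum can be applied at 0.\<close>
  define U' where "U' \<eta> = U (z \<odot> \<eta>)" for \<eta>
  define V' where "V' \<eta> = V (z \<odot> \<eta>)" for \<eta>
  obtain C1 where C1: "0 \<le> C1" "semiconvex C1 U'"
    using supconv_semiconvex[OF uscr(1), of m z] r m unfolding U'_def[abs_def] U_def by auto
  obtain C2 where C2: "0 \<le> C2" "semiconvex C2 V'"
    using supconv_semiconvex[OF uscr(2), of m z] r m unfolding V'_def[abs_def] V_def by auto
  define C where "C = max C1 C2"
  have C: "0 \<le> C" "semiconvex C U'" "semiconvex C V'"
    using C1 C2 by (auto simp: C_def intro: semiconvex_mono)
  have jetU: "superjet U (z \<odot> \<eta>) a b" if "superjet U' \<eta> a b" for \<eta> a b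
    by (rule superjet_touch[OF that]) (simp add: U'_def gmult_assoc)
  have jetV: "superjet V (z \<odot> \<eta>) a b" if "superjet V' \<eta> a b" for \<eta> a b
    by (rule superjet_touch[OF that]) (simp add: V'_def gmult_assoc)
  have sumUV: "superjet (\<lambda>\<eta>. U' \<eta> + V' \<eta>) 0 (\<alpha>z z) (Bz z)"
  proof (rule superjet_touch)
    show "superjet \<phi> z (\<alpha>z z) (Bz z)" using \<phi>jet by (simp add: jet_def)
    have "\<forall>\<^sub>F \<eta> in nhds 0. z \<odot> \<eta> \<in> ball 0 r"
      using zn \<nu> by (intro eventually_gmult_in) auto
    then show "\<forall>\<^sub>F \<eta> in nhds 0. U' (0 \<odot> \<eta>) + V' (0 \<odot> \<eta>) - (U' 0 + V' 0) \<le> \<phi> (z \<odot> \<eta>) - \<phi> z"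
    proof eventually_elim
      case (elim \<eta>)
      then show ?case using UV[of "z \<odot> \<eta>"] UVz by (simp add: U'_def V'_def)
    qed
  qed
  from semiconvex_gradients[OF C(2,3,1) sumUV]
  obtain a0 b0 E r2 where "0 < r2" "0 \<le> E" "\<forall>\<xi>. a0 \<xi> + b0 \<xi> = \<alpha>z z \<xi>"
    "\<forall>\<eta> a b. norm \<eta> \<le> r2 \<longrightarrow> superjet U' \<eta> a b \<longrightarrow> (\<forall>\<xi>. \<bar>a \<xi> - a0 \<xi>\<bar> \<le> E * norm \<eta> * norm \<xi>)"
    "\<forall>\<eta> a b. norm \<eta> \<le> r2 \<longrightarrow> superjet V' \<eta> a b \<longrightarrow> (\<forall>\<xi>. \<bar>a \<xi> - b0 \<xi>\<bar> \<le> E * norm \<eta> * norm \<xi>)"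
    by blast
  note grad = this[rule_format]
  have cUV: "continuous_on (cball 0 1) U'" "continuous_on (cball 0 1) V'"
    using semiconvex_continuous C by auto
  have lim0: "(F \<longlongrightarrow> F 0) (nhds 0)" if "continuous_on (cball 0 1) F" for F :: "'a \<Rightarrow> real"
    using continuous_on_interior[OF that, of 0] by (simp add: isCont_def tendsto_at_iff_tendsto_nhds)
  have "\<forall>\<^sub>F \<eta> in nhds 0. U' \<eta> > U' 0 - 1" "\<forall>\<^sub>F \<eta> in nhds 0. V' \<eta> > V' 0 - 1"
    using order_tendstoD(1)[OF lim0[OF cUV(1)]] order_tendstoD(1)[OF lim0[OF cUV(2)]] by auto
  moreover have "\<forall>\<^sub>F \<eta> in nhds 0. z \<odot> \<eta> \<in> ball 0 \<nu>"
    using zn by (intro eventually_gmult_in) auto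
  ultimately have "\<forall>\<^sub>F \<eta> in nhds 0. norm (z \<odot> \<eta>) < \<nu> \<and> U' \<eta> > U' 0 - 1 \<and> V' \<eta> > V' 0 - 1"
    by eventually_elim simp
  then obtain r3 where r3: "0 < r3" "\<And>\<eta>. norm \<eta> < r3 \<Longrightarrow> norm (z \<odot> \<eta>) < \<nu>"
    "\<And>\<eta>. norm \<eta> < r3 \<Longrightarrow> U' \<eta> > U' 0 - 1" "\<And>\<eta>. norm \<eta> < r3 \<Longrightarrow> V' \<eta> > V' 0 - 1"
    by (auto simp: eventually_nhds_metric)
  define F where "F = L * (E * (norm e1 + norm e2)) + 1"
  have F: "0 < F" using \<open>0 \<le> L\<close> grad(2) by (auto simp: F_def intro!: add_nonneg_pos mult_nonneg_nonneg)
  define R where "R = min 1 (min r2 (min r3 (\<kappa> / F)))"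
  have R: "0 < R" "R \<le> 1" "R \<le> r2" "R \<le> r3" "R \<le> \<kappa> / F"
    using grad(1) r3(1) \<kappa> F by (auto simp: R_def)
  have small: "L * (\<bar>a e1 - p\<bar> + \<bar>a e2 - q\<bar>) \<le> \<kappa>"
    if "norm \<eta> < R" "\<bar>a e1 - p\<bar> \<le> E * norm \<eta> * norm e1" "\<bar>a e2 - q\<bar> \<le> E * norm \<eta> * norm e2"
    for a :: "'a \<Rightarrow> real" and p q \<eta>
  proof -
    have "L * (\<bar>a e1 - p\<bar> + \<bar>a e2 - q\<bar>) \<le> L * (E * norm \<eta> * norm e1 + E * norm \<eta> * norm e2)"
      using that \<open>0 \<le> L\<close> by (intro mult_left_mono add_mono) auto
    also have "\<dots> = norm \<eta> * (F - 1)" by (simp add: F_def algebra_simps)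
    also have "\<dots> \<le> norm \<eta> * F" by (intro mult_left_mono) auto
    also have "\<dots> \<le> \<kappa> / F * F" using that R F by (intro mult_right_mono) auto
    finally show ?thesis using F by simp
  qed
  have lip1: "\<bar>G x p q - G x p' q'\<bar> \<le> L * (\<bar>p - p'\<bar> + \<bar>q - q'\<bar>)" for x p q p' q'
    by (rule order_trans[OF lip mult_left_mono[OF sqrt_sum_squares_le_sum_abs \<open>0 \<le> L\<close>]])
  have k1: "par a b \<le> - G 0 (a0 e1) (a0 e2) + 2 * \<kappa>"
    if "norm \<eta> < R" "superjet U' \<eta> a b" for \<eta> a b
  proof (rule supconv_frozen[OF uscr(1) m(2) \<nu>(1) x0(1) \<open>0 \<le> L\<close> _ lip1 _ \<nu>(2) x0(2) Mu])
    show "par \<alpha> \<beta> + G x (\<alpha> e1) (\<alpha> e2) \<le> 0" if "norm x < r" "superjet u x \<alpha> \<beta>" for x \<alpha> \<beta>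
      using u[OF _ that(2)] that(1) r by simp
    show "norm (z \<odot> \<eta>) < \<nu>" using r3(2) that R by simp
    show "Mu - m * x0\<^sup>2 \<le> supconv r m u (z \<odot> \<eta>)"
      using lowU r3(3)[of \<eta>] that R by (simp add: U'_def U_def)
    show "superjet (supconv r m u) (z \<odot> \<eta>) a b" using jetU[OF that(2)] by (simp add: U_def)
    show "L * (\<bar>a e1 - a0 e1\<bar> + \<bar>a e2 - a0 e2\<bar>) \<le> \<kappa>"
      using that R by (intro small[OF that(1)] grad(4)[OF _ that(2)]) auto
  qed (use \<delta>(2) \<nu> in auto)
  have k2: "par a b \<le> - (- G 0 (- b0 e1) (- b0 e2)) + 2 * \<kappa>"
    if "norm \<eta> < R" "superjet V' \<eta> a b" for \<eta> a b
  proof (rule supconv_frozen[where H = "\<lambda>x p q. - G x (- p) (- q)", OF uscr(2) m(2) \<nu>(1) x0(1) \<open>0 \<le> L\<close> _ _ _ \<nu>(2) x0(2) Mw])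
    show "par \<alpha> \<beta> + - G x (- \<alpha> e1) (- \<alpha> e2) \<le> 0" if "norm x < r" "superjet w x \<alpha> \<beta>" for x \<alpha> \<beta>
      using w[OF _ that(2)] that(1) r by simp
    show "\<bar>- G x (- p) (- q) - - G x (- p') (- q')\<bar> \<le> L * (\<bar>p - p'\<bar> + \<bar>q - q'\<bar>)" for x p q p' q'
      using lip1[of x "- p" "- q" "- p'" "- q'"] by (simp add: abs_minus_commute)
    show "\<bar>- G x (- p) (- q) - - G 0 (- p) (- q)\<bar> \<le> \<kappa>" if "norm x < 2 * \<nu>" for x p q
      using \<delta>(2)[of x "- p" "- q"] that \<nu> by (simp add: abs_minus_commute)
    show "norm (z \<odot> \<eta>) < \<nu>" using r3(2) that R by simp
    show "Mw - m * x0\<^sup>2 \<le> supconv r m w (z \<odot> \<eta>)"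
      using lowV r3(4)[of \<eta>] that R by (simp add: V'_def V_def)
    show "superjet (supconv r m w) (z \<odot> \<eta>) a b" using jetV[OF that(2)] by (simp add: V_def)
    show "L * (\<bar>a e1 - b0 e1\<bar> + \<bar>a e2 - b0 e2\<bar>) \<le> \<kappa>"
      using that R by (intro small[OF that(1)] grad(5)[OF _ that(2)]) auto
  qed
  have "cball (0::'a) R \<subseteq> cball 0 1" using R by auto
  then have "par (\<alpha>z z) (Bz z) \<le> - G 0 (a0 e1) (a0 e2) + 2 * \<kappa> + (- (- G 0 (- b0 e1) (- b0 e2)) + 2 * \<kappa>)"
    by (intro linear_sum[OF R(1) continuous_on_subset[OF cUV(1)] continuous_on_subset[OF cUV(2)] _ _ sumUV] k1 k2)
  \<comment> \<open>The gradients of the two summands satisfy a0 + b0 = \<open>\<alpha>z z\<close>,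
    so the arguments - b0 and a0 of \<open>G 0\<close> differ by exactly the gradient of the sum, up
    to sign.\<close>
  moreover have "G 0 (- b0 e1) (- b0 e2) - G 0 (a0 e1) (a0 e2) \<le> hn (\<alpha>z z e1) (\<alpha>z z e2)"
    using lip[of 0 "- b0 e1" "- b0 e2" "a0 e1" "a0 e2"]
    by (simp add: hn_def abs_le_iff flip: grad(3)) (simp add: power2_commute[of "- _"] add.commute)
  moreover have "\<theta> < par (\<alpha>z z) (Bz z) - hn (\<alpha>z z e1) (\<alpha>z z e2)"
    using d(2) zn \<nu> by simp
  ultimately show False using \<theta> by (simp add: \<kappa>_def)
qed

end

section \<open>Viscosity solutions on the Heisenberg group\<close>

lemma C2_on_quadratic:
  fixes a :: "'a::real_normed_vector \<Rightarrow> real"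
  assumes a: "bounded_linear a" and b: "bounded_bilinear b"
  shows "C2_on U (\<lambda>w. k + a w + b w w)"
proof -
  interpret b: bounded_bilinear b by (rule b)
  interpret s: bounded_bilinear "\<lambda>x y. b x y + b y x"
    by (intro bounded_bilinear_add b b.flip)
  define g' where "g' x = Blinfun a + s.prod_right x" for x
  define g'' :: "'a \<Rightarrow> 'a \<Rightarrow>\<^sub>L 'a \<Rightarrow>\<^sub>L real" where "g'' x = Blinfun s.prod_right" for x
  have g': "blinfun_apply (g' x) = (\<lambda>e. a e + (b x e + b e x))" for x
    by (rule ext) (simp add: g'_def blinfun.add_left bounded_linear_Blinfun_apply[OF a] s.prod_right.rep_eq)
  have "((\<lambda>w. k + a w + b w w) has_derivative blinfun_apply (g' x)) (at x)" for x
    unfolding g'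
    by (rule derivative_eq_intros b.FDERIV bounded_linear_imp_has_derivative[OF a] refl
        | simp add: algebra_simps)+
  moreover have "(g' has_derivative blinfun_apply (g'' x)) (at x)" for x
    unfolding g'_def[abs_def] g''_def bounded_linear_Blinfun_apply[OF s.bounded_linear_prod_right]
    by (rule derivative_eq_intros bounded_linear_imp_has_derivative[OF s.bounded_linear_prod_right] refl
        | simp)+
  moreover have "continuous_on U g''" by (simp add: g''_def[abs_def])
  ultimately show ?thesis unfolding C2_on_def by blast
qed

text \<open>The symplectic form of the horizontal coordinates. Neither the vertical coordinate nor
  time enters, so both are central.\<close>

definition hom :: "heis \<times> real \<Rightarrow> heis \<times> real \<Rightarrow> real"
  where "hom v w = fst (fst v) * fst (snd (fst w)) - fst (fst w) * fst (snd (fst v))"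

definition ex :: "heis \<times> real" where "ex = ((1, 0, 0), 0)"
definition ey :: "heis \<times> real" where "ey = ((0, 1, 0), 0)"
definition ez :: "heis \<times> real" where "ez = ((0, 0, 1), 0)"
definition et :: "heis \<times> real" where "et = ((0, 0, 0), 1)"

lemma norm_spacetime_sq: "norm ((x, y, z), t) ^ 2 = x\<^sup>2 + y\<^sup>2 + z\<^sup>2 + t\<^sup>2"
  for x y z t :: real
  by (simp add: norm_Pair)

lemma bounded_bilinear_hom: "bounded_bilinear hom"
proof -
  have f: "bounded_linear (\<lambda>v::heis \<times> real. fst (fst v))"
    by (intro bounded_linear_compose[OF bounded_linear_fst] bounded_linear_fst)
  have g: "bounded_linear (\<lambda>v::heis \<times> real. fst (snd (fst v)))"
    by (intro bounded_linear_compose[OF bounded_linear_fst] bounded_linear_compose[OF bounded_linear_snd]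
        bounded_linear_fst)
  have "bounded_bilinear (\<lambda>(v::heis \<times> real) (w::heis \<times> real). fst (fst v) * fst (snd (fst w)) + - (fst (snd (fst v)) * fst (fst w)))"
    by (intro bounded_bilinear_add bounded_bilinear_minus bounded_bilinear_product[OF f g]
        bounded_bilinear_product[OF g f])
  then show ?thesis by (simp add: hom_def[abs_def] mult.commute)
qed

text \<open>Lagrange's identity for the horizontal parts.\<close>

lemma hom_le: "\<bar>hom v w\<bar> \<le> norm v * norm w"
proof -
  obtain x y z t where v: "v = ((x, y, z), t)" by (metis prod.collapse)
  obtain x' y' z' t' where w: "w = ((x', y', z'), t')" by (metis prod.collapse)
  have "(hom v w)\<^sup>2 + (x * x' + y * y')\<^sup>2 = (x\<^sup>2 + y\<^sup>2) * (x'\<^sup>2 + y'\<^sup>2)"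
    by (simp add: hom_def v w power2_eq_square algebra_simps)
  then have "(hom v w)\<^sup>2 \<le> (x\<^sup>2 + y\<^sup>2) * (x'\<^sup>2 + y'\<^sup>2)"
    by (metis le_add_same_cancel1 zero_le_power2)
  also have "\<dots> \<le> norm v ^ 2 * norm w ^ 2"
    unfolding v w norm_spacetime_sq by (intro mult_mono) auto
  also have "\<dots> = (norm v * norm w)\<^sup>2" by (simp add: power_mult_distrib)
  finally have "\<bar>hom v w\<bar> \<le> \<bar>norm v * norm w\<bar>" by (simp only: abs_le_square_iff)
  then show ?thesis by simp
qed

lemma step_two_group_hom: "step_two_group hom ez"
proof (rule step_two_group.intro)
  show "bounded_bilinear hom" by (rule bounded_bilinear_hom)
  show "\<bar>hom v w\<bar> \<le> norm v * norm w" for v w by (rule hom_le)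
  show "norm ez \<le> 1" by (simp add: ez_def norm_Pair)
qed (auto simp: hom_def ez_def)

lemma heis_inv_eq: "heis_inv p = - p"
  by (cases p) simp

text \<open>In the increment coordinates \<open>\<eta> = (p\<^sub>0, t\<^sub>0)\<^sup>-\<^sup>1 \<cdot> (p, t)\<close>, the operators \<open>X1\<close> and \<open>X2\<close>
  become those of the group at the identity, so that the symmetrised second derivatives at
  the base point are read off the quadratic part.\<close>

lemma pde_lhs_polynomial:
  fixes x0 y0 z0 t0 :: real
  defines "X \<equiv> \<lambda>x. x - x0" and "Y \<equiv> \<lambda>y. y - y0"
    and "Z \<equiv> \<lambda>x y z. z - z0 - (x0 * y - x * y0) / 2"
  assumes \<phi>: "\<And>x y z t. \<phi> ((x, y, z), t) =
    a1 * X x + a2 * Y y + a3 * Z x y z + a4 * (t - t0)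
    + b11 * (X x)\<^sup>2 + b12 * (X x * Y y) + b13 * (X x * Z x y z) + b22 * (Y y)\<^sup>2
    + b23 * (Y y * Z x y z) + b33 * (Z x y z)\<^sup>2
    + (t - t0) * (b14 * X x + b24 * Y y + b34 * Z x y z + b44 * (t - t0))"
  shows "pde_lhs A f \<phi> (x0, y0, z0) t0 =
    a4 - (2 * A$1$1 * b11 + (A$1$2 + A$2$1) * b12 + 2 * A$2$2 * b22) + f (x0, y0, z0) (vector [a1, a2])"
proof -
  define g where "g = (\<lambda>q. \<phi> (q, t0))"
  have g: "g (x, y, z) = a1 * X x + a2 * Y y + a3 * Z x y z
    + b11 * (X x)\<^sup>2 + b12 * (X x * Y y) + b13 * (X x * Z x y z) + b22 * (Y y)\<^sup>2
    + b23 * (Y y * Z x y z) + b33 * (Z x y z)\<^sup>2" for x y z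
    by (simp add: g_def \<phi>)
  define gz where "gz x y z = a3 + b13 * X x + b23 * Y y + 2 * b33 * Z x y z" for x y z
  have dx: "partial_x g (x, y, z) = a1 + 2 * b11 * X x + b12 * Y y + b13 * Z x y z + y0 / 2 * gz x y z" for x y z
    unfolding partial_x.simps g X_def Y_def Z_def gz_def
    by (rule DERIV_imp_deriv) (auto intro!: derivative_eq_intros simp: field_simps power2_eq_square)
  have dy: "partial_y g (x, y, z) = a2 + b12 * X x + 2 * b22 * Y y + b23 * Z x y z - x0 / 2 * gz x y z" for x y z
    unfolding partial_y.simps g X_def Y_def Z_def gz_def
    by (rule DERIV_imp_deriv) (auto intro!: derivative_eq_intros simp: field_simps power2_eq_square)
  have dz: "partial_z g (x, y, z) = gz x y z" for x y z
    unfolding partial_z.simps g X_def Y_def Z_def gz_def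
    by (rule DERIV_imp_deriv) (auto intro!: derivative_eq_intros simp: field_simps power2_eq_square)
  have X1: "X1 g (x, y, z) = a1 + 2 * b11 * X x + b12 * Y y + b13 * Z x y z - Y y / 2 * gz x y z" for x y z
    unfolding X1.simps dx dz by (simp add: Y_def field_simps)
  have X2: "X2 g (x, y, z) = a2 + b12 * X x + 2 * b22 * Y y + b23 * Z x y z + X x / 2 * gz x y z" for x y z
    unfolding X2.simps dy dz by (simp add: X_def field_simps)
  have 11: "X1 (X1 g) (x0, y0, z0) = 2 * b11"
  proof -
    have "partial_x (X1 g) (x0, y0, z0) = 2 * b11 + y0 / 2 * b13"
      unfolding partial_x.simps X1 X_def Y_def Z_def gz_def
      by (rule DERIV_imp_deriv) (auto intro!: derivative_eq_intros simp: field_simps)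
    moreover have "partial_z (X1 g) (x0, y0, z0) = b13"
      unfolding partial_z.simps X1 X_def Y_def Z_def gz_def
      by (rule DERIV_imp_deriv) (auto intro!: derivative_eq_intros simp: field_simps)
    ultimately show ?thesis by simp
  qed
  have 22: "X2 (X2 g) (x0, y0, z0) = 2 * b22"
  proof -
    have "partial_y (X2 g) (x0, y0, z0) = 2 * b22 - x0 / 2 * b23"
      unfolding partial_y.simps X2 X_def Y_def Z_def gz_def
      by (rule DERIV_imp_deriv) (auto intro!: derivative_eq_intros simp: field_simps)
    moreover have "partial_z (X2 g) (x0, y0, z0) = b23"
      unfolding partial_z.simps X2 X_def Y_def Z_def gz_def
      by (rule DERIV_imp_deriv) (auto intro!: derivative_eq_intros simp: field_simps)
    ultimately show ?thesis by simp
  qed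
  \<comment> \<open>The two mixed derivatives differ by the commutator of the fields, the vertical
    derivative \<open>a3\<close>. Symmetrisation cancels it.\<close>
  have 12: "X1 (X2 g) (x0, y0, z0) = b12 + a3 / 2"
  proof -
    have "partial_x (X2 g) (x0, y0, z0) = b12 + y0 / 2 * b23 + a3 / 2"
      unfolding partial_x.simps X2 X_def Y_def Z_def gz_def
      by (rule DERIV_imp_deriv) (auto intro!: derivative_eq_intros simp: field_simps)
    moreover have "partial_z (X2 g) (x0, y0, z0) = b23"
      unfolding partial_z.simps X2 X_def Y_def Z_def gz_def
      by (rule DERIV_imp_deriv) (auto intro!: derivative_eq_intros simp: field_simps)
    ultimately show ?thesis by simp
  qed
  have 21: "X2 (X1 g) (x0, y0, z0) = b12 - a3 / 2"
  proof -
    have "partial_y (X1 g) (x0, y0, z0) = b12 - x0 / 2 * b13 - a3 / 2"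
      unfolding partial_y.simps X1 X_def Y_def Z_def gz_def
      by (rule DERIV_imp_deriv) (auto intro!: derivative_eq_intros simp: field_simps)
    moreover have "partial_z (X1 g) (x0, y0, z0) = b13"
      unfolding partial_z.simps X1 X_def Y_def Z_def gz_def
      by (rule DERIV_imp_deriv) (auto intro!: derivative_eq_intros simp: field_simps)
    ultimately show ?thesis by simp
  qed
  have t: "deriv (\<lambda>s. \<phi> ((x0, y0, z0), s)) t0 = a4"
    unfolding \<phi> X_def Y_def Z_def
    by (rule DERIV_imp_deriv) (auto intro!: derivative_eq_intros simp: field_simps)
  have grad: "hgrad g (x0, y0, z0) = vector [a1, a2]"
    unfolding hgrad_def X1 X2 by (simp add: X_def Y_def Z_def)
  have "trace (A ** hhess_sym g (x0, y0, z0)) = 2 * A$1$1 * b11 + (A$1$2 + A$2$1) * b12 + 2 * A$2$2 * b22"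
    unfolding hhess_sym_def 11 12 21 22
    by (simp add: trace_def matrix_matrix_mult_def sum_2 algebra_simps)
  then show ?thesis unfolding pde_lhs_def t g_def[symmetric] grad by simp
qed

lemma le_of_all_small:
  fixes x y K :: real
  assumes "\<And>\<epsilon>. 0 < \<epsilon> \<Longrightarrow> x - \<epsilon> * K \<le> y" "0 \<le> K"
  shows "x \<le> y"
proof (rule field_le_epsilon)
  fix d :: real assume d: "0 < d"
  have "0 < d / (K + 1)" using assms(2) d by simp
  from assms(1)[OF this] have "x - d / (K + 1) * K \<le> y" .
  moreover have "d / (K + 1) * K \<le> d" using assms(2) d by (simp add: field_simps)
  ultimately show "x \<le> y + d" by linarith
qed

text \<open>A Cholesky factorisation: \<open>A\<close> is the sum of the outer squares of (p, q) and
  (0, r), so the trace of \<open>A\<close> times a symmetric matrix is the sum of its quadratic form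
  at these two vectors.\<close>

locale heis_factor =
  fixes A :: "real ^ 2 ^ 2" and p q r :: real
  assumes A_sym: "A$2$1 = A$1$2"
    and A11: "A$1$1 = p * p" and A12: "A$1$2 = p * q" and A22: "A$2$2 = q * q + r * r"
begin

sublocale parabolic_group hom ez "((p, q, 0), 0)" "((0, r, 0), 0)" et
  by (rule parabolic_group.intro[OF step_two_group_hom])

notation gmult (infixl \<open>\<odot>\<close> 70)

lemma heis_gmult:
  "((x, y, z), t) \<odot> ((x', y', z'), t') = ((x + x', y + y', z + z' + (x * y' - x' * y) / 2), t + t')"
  unfolding gmult_def by (simp add: hom_def ez_def)

lemma fst_gmult: "fst (v \<odot> w) = fst v \<cdot>\<^sub>H fst w"
proof -
  obtain x y z t where v: "v = ((x, y, z), t)" by (metis prod.collapse)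
  obtain x' y' z' t' where w: "w = ((x', y', z'), t')" by (metis prod.collapse)
  show ?thesis by (simp add: v w heis_gmult)
qed

lemma snd_gmult: "snd (v \<odot> w) = snd v + snd w"
  unfolding gmult_def by (simp add: ez_def)

text \<open>A superjet at \<open>v\<close> made into a function of the point itself. Left
  translation is affine, so this is an ordinary quadratic polynomial and hence an admissible test
  function.\<close>

definition test :: "heis \<times> real \<Rightarrow> (heis \<times> real \<Rightarrow> real) \<Rightarrow> (heis \<times> real \<Rightarrow> heis \<times> real \<Rightarrow> real) \<Rightarrow>
    heis \<times> real \<Rightarrow> real"
  where "test v \<alpha> \<beta> w = \<alpha> (- v \<odot> w) + \<beta> (- v \<odot> w) (- v \<odot> w)"

lemma C2_on_test:
  assumes "bounded_linear \<alpha>" "bounded_bilinear \<beta>"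
  shows "C2_on U (test v \<alpha> \<beta>)"
proof -
  interpret \<beta>: bounded_bilinear \<beta> by fact
  have l: "bounded_linear (ltr (- v))" by (rule bounded_linear_ltr)
  have eq: "test v \<alpha> \<beta> = (\<lambda>w. (\<alpha> (- v) + \<beta> (- v) (- v))
    + (\<alpha> (ltr (- v) w) + \<beta> (- v) (ltr (- v) w) + \<beta> (ltr (- v) w) (- v)) + \<beta> (ltr (- v) w) (ltr (- v) w))"
    unfolding fun_eq_iff test_def gmult_ltr linear_add[OF bounded_linear.linear[OF assms(1)]]
      \<beta>.add_left \<beta>.add_right by (intro allI, linarith)
  show ?thesis
    unfolding eq by (rule C2_on_quadratic[OF bounded_linear_add[OF bounded_linear_add[OF
              bounded_linear_compose[OF assms(1) l] bounded_linear_compose[OF \<beta>.bounded_linear_right l]]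
            bounded_linear_compose[OF \<beta>.bounded_linear_left l]] \<beta>.comp[OF l l]])
qed

lemma pde_lhs_test:
  assumes \<alpha>: "bounded_linear \<alpha>" and \<beta>: "bounded_bilinear \<beta>"
  shows "pde_lhs A f (test (p0, t0) \<alpha> \<beta>) p0 t0 = par \<alpha> \<beta> + f p0 (vector [\<alpha> ex, \<alpha> ey])"
proof -
  obtain x0 y0 z0 where p0: "p0 = (x0, y0, z0)" by (cases p0) auto
  interpret \<alpha>: bounded_linear \<alpha> by fact
  interpret \<beta>: bounded_bilinear \<beta> by fact
  have dec: "((x, y, z), t) = x *\<^sub>R ex + y *\<^sub>R ey + z *\<^sub>R ez + t *\<^sub>R et" for x y z t
    by (simp add: ex_def ey_def ez_def et_def)
  have la: "\<alpha> ((x, y, z), t) = \<alpha> ex * x + \<alpha> ey * y + \<alpha> ez * z + \<alpha> et * t" for x y z t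
    by (simp only: dec \<alpha>.add \<alpha>.scaleR) simp
  have lb: "\<beta> ((x, y, z), t) ((x, y, z), t) =
      \<beta> ex ex * x\<^sup>2 + (\<beta> ex ey + \<beta> ey ex) * (x * y) + (\<beta> ex ez + \<beta> ez ex) * (x * z)
      + \<beta> ey ey * y\<^sup>2 + (\<beta> ey ez + \<beta> ez ey) * (y * z) + \<beta> ez ez * z\<^sup>2
      + t * ((\<beta> ex et + \<beta> et ex) * x + (\<beta> ey et + \<beta> et ey) * y + (\<beta> ez et + \<beta> et ez) * z
        + \<beta> et et * t)" for x y z t
    by (simp only: dec \<beta>.add_left \<beta>.add_right \<beta>.scaleR_left \<beta>.scaleR_right)
      (simp add: power2_eq_square algebra_simps)
  have "pde_lhs A f (test (p0, t0) \<alpha> \<beta>) p0 t0 = \<alpha> et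
    - (2 * A$1$1 * \<beta> ex ex + (A$1$2 + A$2$1) * (\<beta> ex ey + \<beta> ey ex) + 2 * A$2$2 * \<beta> ey ey)
    + f p0 (vector [\<alpha> ex, \<alpha> ey])"
    unfolding p0
  proof (rule pde_lhs_polynomial)
    fix x y z t
    have inc: "- ((x0, y0, z0), t0) \<odot> ((x, y, z), t) =
      ((x - x0, y - y0, z - z0 - (x0 * y - x * y0) / 2), t - t0)"
      by (simp add: heis_gmult field_simps)
    show "test ((x0, y0, z0), t0) \<alpha> \<beta> ((x, y, z), t) =
      \<alpha> ex * (x - x0) + \<alpha> ey * (y - y0) + \<alpha> ez * (z - z0 - (x0 * y - x * y0) / 2) + \<alpha> et * (t - t0)
      + \<beta> ex ex * (x - x0)\<^sup>2 + (\<beta> ex ey + \<beta> ey ex) * ((x - x0) * (y - y0))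
      + (\<beta> ex ez + \<beta> ez ex) * ((x - x0) * (z - z0 - (x0 * y - x * y0) / 2))
      + \<beta> ey ey * (y - y0)\<^sup>2 + (\<beta> ey ez + \<beta> ez ey) * ((y - y0) * (z - z0 - (x0 * y - x * y0) / 2))
      + \<beta> ez ez * (z - z0 - (x0 * y - x * y0) / 2)\<^sup>2
      + (t - t0) * ((\<beta> ex et + \<beta> et ex) * (x - x0) + (\<beta> ey et + \<beta> et ey) * (y - y0)
        + (\<beta> ez et + \<beta> et ez) * (z - z0 - (x0 * y - x * y0) / 2) + \<beta> et et * (t - t0))"
      unfolding test_def inc la lb by (simp only: add.assoc)
  qed
  moreover have "par \<alpha> \<beta> = \<alpha> et
    - 2 * (p * p * \<beta> ex ex + p * q * (\<beta> ex ey + \<beta> ey ex) + (q * q + r * r) * \<beta> ey ey)"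
    unfolding par_def lb by (simp add: power2_eq_square algebra_simps)
  ultimately show ?thesis
    by (simp add: A_sym A11 A12 A22 algebra_simps)
qed

lemma test_tendsto:
  assumes "\<forall>\<^sub>F \<eta> in nhds 0. P \<eta>"
  shows "\<forall>\<^sub>F w in nhds v. P (- v \<odot> w)"
proof -
  have "((\<lambda>w. - v \<odot> w) \<longlongrightarrow> - v \<odot> v) (nhds v)" by (intro tendsto_intros filterlim_ident)
  then show ?thesis using eventually_compose_filterlim[OF assms] by simp
qed

lemma par_add_inner: "par \<alpha> (\<lambda>\<eta> \<xi>. \<beta> \<eta> \<xi> + \<epsilon> * (\<eta> \<bullet> \<xi>)) =
    par \<alpha> \<beta> - \<epsilon> * (2 * (norm ((p, q, 0::real), 0::real) ^ 2 + norm ((0::real, r, 0::real), 0::real) ^ 2))"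
  unfolding norm_spacetime_sq by (simp add: par_def algebra_simps power2_eq_square)

text \<open>Adding \<epsilon> times the squared increment absorbs the error term of the superjet,
  and the resulting polynomial touches \<open>u\<close> from above. It changes \<open>par\<close> by
  a multiple of \<epsilon> and the gradient not at all, so \<epsilon> can tend to 0.\<close>

lemma subsolution_superjet:
  assumes "viscosity_subsolution A f u" "0 < t0" "superjet u (p0, t0) \<alpha> \<beta>"
  shows "par \<alpha> \<beta> + f p0 (vector [\<alpha> ex, \<alpha> ey]) \<le> 0"
proof (rule le_of_all_small)
  fix \<epsilon> :: real assume \<epsilon>: "0 < \<epsilon>"
  define B where "B = (\<lambda>\<eta> \<xi>. \<beta> \<eta> \<xi> + \<epsilon> * (\<eta> \<bullet> \<xi>))"
  have B: "bounded_bilinear B"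
    unfolding B_def by (intro bounded_bilinear_add bounded_bilinear_const_mult
        superjetD(2)[OF assms(3)] bounded_bilinear_inner)
  note \<alpha> = superjetD(1)[OF assms(3)]
  have t0: "test (p0, t0) \<alpha> B (p0, t0) = 0"
    using linear_0[OF bounded_linear.linear[OF \<alpha>]] bounded_bilinear.zero_left[OF B, of 0]
      gmult_minus(2)[of "(p0, t0)"] by (simp add: test_def)
  from test_tendsto[OF superjetD(3)[OF assms(3) \<epsilon>], of "(p0, t0)"]
  have "\<forall>\<^sub>F w in nhds (p0, t0). u w - test (p0, t0) \<alpha> B w \<le> u (p0, t0) - test (p0, t0) \<alpha> B (p0, t0)"
  proof eventually_elim
    case (elim w)
    then show ?case
      using gmult_cancel(1)[of "(p0, t0)" w] unfolding t0 by (simp add: test_def B_def power2_norm_eq_inner)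
  qed
  with assms(1,2) C2_on_test[OF \<alpha> B, of UNIV "(p0, t0)"]
  have "pde_lhs A f (test (p0, t0) \<alpha> B) p0 t0 \<le> 0"
    unfolding viscosity_subsolution_def by blast
  then have "par \<alpha> B + f p0 (vector [\<alpha> ex, \<alpha> ey]) \<le> 0"
    unfolding pde_lhs_test[OF \<alpha> B] .
  then show "par \<alpha> \<beta> + f p0 (vector [\<alpha> ex, \<alpha> ey])
      - \<epsilon> * (2 * (norm ((p, q, 0::real), 0::real) ^ 2 + norm ((0::real, r, 0::real), 0::real) ^ 2)) \<le> 0"
    unfolding B_def par_add_inner by simp
qed simp

text \<open>The polynomial with all signs reversed touches \<open>v\<close> from below, which
  explains the minus signs in the gradient argument of \<open>f\<close>.\<close>

lemma supersolution_superjet: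
  assumes "viscosity_supersolution A f v" "0 < t0" "superjet (\<lambda>w. - v w) (p0, t0) \<alpha> \<beta>"
  shows "par \<alpha> \<beta> - f p0 (vector [- \<alpha> ex, - \<alpha> ey]) \<le> 0"
proof (rule le_of_all_small)
  fix \<epsilon> :: real assume \<epsilon>: "0 < \<epsilon>"
  define B where "B = (\<lambda>\<eta> \<xi>. \<beta> \<eta> \<xi> + \<epsilon> * (\<eta> \<bullet> \<xi>))"
  have B: "bounded_bilinear (\<lambda>\<eta> \<xi>. - B \<eta> \<xi>)"
    unfolding B_def by (intro bounded_bilinear_minus bounded_bilinear_add bounded_bilinear_const_mult
        superjetD(2)[OF assms(3)] bounded_bilinear_inner)
  have \<alpha>: "bounded_linear (\<lambda>\<eta>. - \<alpha> \<eta>)"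
    by (intro bounded_linear_minus superjetD(1)[OF assms(3)])
  let ?T = "test (p0, t0) (\<lambda>\<eta>. - \<alpha> \<eta>) (\<lambda>\<eta> \<xi>. - B \<eta> \<xi>)"
  have t0: "?T (p0, t0) = 0"
    using linear_0[OF bounded_linear.linear[OF \<alpha>]] bounded_bilinear.zero_left[OF B, of 0]
      gmult_minus(2)[of "(p0, t0)"] by (simp add: test_def)
  from test_tendsto[OF superjetD(3)[OF assms(3) \<epsilon>], of "(p0, t0)"]
  have "\<forall>\<^sub>F w in nhds (p0, t0). v (p0, t0) - ?T (p0, t0) \<le> v w - ?T w"
  proof eventually_elim
    case (elim w)
    then show ?case
      using gmult_cancel(1)[of "(p0, t0)" w] unfolding t0 by (simp add: test_def B_def power2_norm_eq_inner)
  qed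
  with assms(1,2) C2_on_test[OF \<alpha> B, of UNIV "(p0, t0)"]
  have "0 \<le> pde_lhs A f ?T p0 t0"
    unfolding viscosity_supersolution_def by blast
  then have "0 \<le> - par \<alpha> B + f p0 (vector [- \<alpha> ex, - \<alpha> ey])"
    unfolding pde_lhs_test[OF \<alpha> B] par_minus .
  then show "par \<alpha> \<beta> - f p0 (vector [- \<alpha> ex, - \<alpha> ey])
      - \<epsilon> * (2 * (norm ((p, q, 0::real), 0::real) ^ 2 + norm ((0::real, r, 0::real), 0::real) ^ 2)) \<le> 0"
    unfolding B_def par_add_inner by simp
qed simp

end

lemma psd_factor:
  fixes A :: "real ^ 2 ^ 2"
  assumes "transpose A = A" "\<forall>\<xi>. 0 \<le> \<xi> \<bullet> (A *v \<xi>)"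
  shows "\<exists>p q r. heis_factor A p q r"
proof -
  define a b d where "a = A$1$1" and "b = A$1$2" and "d = A$2$2"
  have "A$2$1 = transpose A $ 1 $ 2" by (simp add: transpose_def)
  then have b': "A$2$1 = b" by (simp add: assms(1) b_def)
  have form: "0 \<le> a * s * s + 2 * b * s * t + d * t * t" for s t
    using assms(2)[rule_format, of "vector [s, t]"]
    by (simp add: inner_vec_def matrix_vector_mult_def sum_2 a_def b_def[symmetric] d_def b' algebra_simps)
  have a: "0 \<le> a" using form[of 1 0] by simp
  have d: "0 \<le> d" using form[of 0 1] by simp
  show ?thesis
  proof (cases "a = 0")
    case True
    have "b = 0"
    proof (rule ccontr)
      assume "b \<noteq> 0"
      \<comment> \<open>With a vanishing corner entry the form is linear in the first coordinate;
        this value makes it equal to -1.\<close>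
      have "0 \<le> 2 * b * (- (d + 1) / (2 * b)) + d" using form[of "- (d + 1) / (2 * b)" 1] True by simp
      then show False using \<open>b \<noteq> 0\<close> by (simp add: field_simps)
    qed
    then have "heis_factor A 0 0 (sqrt d)"
      using True d b' by unfold_locales (simp_all add: a_def b_def d_def)
    then show ?thesis by blast
  next
    case False
    then have a0: "0 < a" using a by simp
    have "0 \<le> a * (d - b * b / a)"
      using form[of "- b / a" 1] a0 by (simp add: field_simps)
    then have "0 \<le> d - b * b / a" using a0 by (simp add: zero_le_mult_iff)
    then have "heis_factor A (sqrt a) (b / sqrt a) (sqrt (d - b * b / a))"
      using a0 b' by unfold_locales (simp_all add: a_def[symmetric] b_def[symmetric] d_def[symmetric])
    then show ?thesis by blast
  qed
qed

section \<open>A strict supersolution of exponential growth\<close>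

text \<open>The mean value inequality is applied to \<open>F\<close> minus its first- and
  second-order terms. The derivative of that difference is the first-order remainder of
  \<open>F'\<close> at \<open>x\<close>, so differentiability of \<open>F'\<close> at this one point
  suffices.\<close>

lemma second_order_taylor:
  fixes F F' :: "real \<Rightarrow> real"
  assumes "\<forall>\<^sub>F y in nhds x. (F has_real_derivative F' y) (at y)"
    and "(F' has_real_derivative F2) (at x)" and "0 < \<epsilon>"
  shows "\<forall>\<^sub>F d in nhds 0. \<bar>F (x + d) - F x - F' x * d - F2 / 2 * d\<^sup>2\<bar> \<le> \<epsilon> * d\<^sup>2"
proof -
  obtain r1 where r1: "0 < r1" "\<And>y. \<bar>y - x\<bar> < r1 \<Longrightarrow> (F has_real_derivative F' y) (at y)"
    using assms(1) by (auto simp: eventually_nhds_metric dist_real_def)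
  have "(F' has_derivative (*) F2) (at x)" using assms(2) by (simp add: has_field_derivative_def)
  from this[unfolded has_derivative_at_alt] \<open>0 < \<epsilon>\<close>
  obtain r2 where r2: "0 < r2" "\<And>y. \<bar>y - x\<bar> < r2 \<Longrightarrow> \<bar>F' y - F' x - F2 * (y - x)\<bar> \<le> \<epsilon> * \<bar>y - x\<bar>"
    by auto
  define r where "r = min r1 r2"
  have "\<bar>F (x + d) - F x - F' x * d - F2 / 2 * d\<^sup>2\<bar> \<le> \<epsilon> * d\<^sup>2" if d: "\<bar>d\<bar> < r" for d
  proof -
    define G where "G y = F y - F' x * (y - x) - F2 / 2 * (y - x)\<^sup>2" for y
    have G': "(G has_real_derivative (F' y - F' x - F2 * (y - x))) (at y)" if "\<bar>y - x\<bar> < r" for y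
      unfolding G_def[abs_def] using r1(2)[of y] that
      by (auto simp: r_def intro!: derivative_eq_intros)
    have "norm (G (x + d) - G x) \<le> (\<epsilon> * \<bar>d\<bar>) * norm (x + d - x)"
    proof (rule field_differentiable_bound[where S = "cball x \<bar>d\<bar>"])
      fix y assume "y \<in> cball x \<bar>d\<bar>"
      then have y: "\<bar>y - x\<bar> \<le> \<bar>d\<bar>" by (simp add: dist_real_def abs_minus_commute)
      then show "(G has_real_derivative (F' y - F' x - F2 * (y - x))) (at y within cball x \<bar>d\<bar>)"
        using d by (intro has_field_derivative_at_within[OF G']) simp
      have "\<bar>F' y - F' x - F2 * (y - x)\<bar> \<le> \<epsilon> * \<bar>y - x\<bar>" using y d by (intro r2) (simp add: r_def)
      also have "\<dots> \<le> \<epsilon> * \<bar>d\<bar>" using y \<open>0 < \<epsilon>\<close> by (intro mult_left_mono) auto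
      finally show "norm (F' y - F' x - F2 * (y - x)) \<le> \<epsilon> * \<bar>d\<bar>" by simp
    qed (auto simp: dist_real_def)
    then show ?thesis by (simp add: G_def power2_eq_square abs_mult algebra_simps)
  qed
  then show ?thesis
    unfolding eventually_nhds_metric using r1 r2
    by (intro exI[of _ r]) (auto simp: r_def dist_real_def)
qed

section \<open>The chain rule for jets\<close>

context step_two_group
begin

lemma jet_bound:
  assumes "jet g z \<alpha> \<beta>" "0 < \<epsilon>"
  shows "\<forall>\<^sub>F \<eta> in nhds 0. \<bar>g (z \<odot> \<eta>) - g z - \<alpha> \<eta> - \<beta> \<eta> \<eta>\<bar> \<le> \<epsilon> * norm \<eta> ^ 2"
proof -
  have "superjet g z \<alpha> \<beta>" "superjet (\<lambda>x. - g x) z (\<lambda>\<eta>. - \<alpha> \<eta>) (\<lambda>\<eta> \<xi>. - \<beta> \<eta> \<xi>)"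
    using assms(1) by (auto simp: jet_def)
  from superjetD(3)[OF this(1) assms(2)] superjetD(3)[OF this(2) assms(2)]
  show ?thesis by eventually_elim (simp add: abs_le_iff)
qed

lemma jetI:
  assumes "bounded_linear \<alpha>" "bounded_bilinear \<beta>"
    and "\<And>\<epsilon>. 0 < \<epsilon> \<Longrightarrow> \<forall>\<^sub>F \<eta> in nhds 0. \<bar>g (z \<odot> \<eta>) - g z - \<alpha> \<eta> - \<beta> \<eta> \<eta>\<bar> \<le> \<epsilon> * norm \<eta> ^ 2"
  shows "jet g z \<alpha> \<beta>"
  unfolding jet_def superjet_def using assms(1,2)
  by (auto intro!: bounded_linear_minus bounded_bilinear_minus elim!: eventually_mono[OF assms(3)])

lemma jet_compose:
  fixes F F' :: "real \<Rightarrow> real"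
  assumes jet: "jet g z \<alpha> \<beta>"
    and F: "\<forall>\<^sub>F y in nhds (g z). (F has_real_derivative F' y) (at y)"
      "(F' has_real_derivative F2) (at (g z))"
  shows "jet (\<lambda>x. F (g x)) z (\<lambda>\<eta>. F' (g z) * \<alpha> \<eta>) (\<lambda>\<eta> \<xi>. F' (g z) * \<beta> \<eta> \<xi> + F2 / 2 * (\<alpha> \<eta> * \<alpha> \<xi>))"
proof (rule jetI)
  have ab: "bounded_linear \<alpha>" "bounded_bilinear \<beta>" using jet by (auto simp: jet_def superjet_def)
  show "bounded_linear (\<lambda>\<eta>. F' (g z) * \<alpha> \<eta>)"
    by (rule bounded_linear_const_mult[OF ab(1)])
  show "bounded_bilinear (\<lambda>\<eta> \<xi>. F' (g z) * \<beta> \<eta> \<xi> + F2 / 2 * (\<alpha> \<eta> * \<alpha> \<xi>))"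
    by (intro bounded_bilinear_add bounded_bilinear_const_mult[OF ab(2)]
        bounded_bilinear_const_mult[OF bounded_bilinear_product[OF ab(1,1)]])
  obtain Ka where Ka: "0 < Ka" "\<And>\<eta>. \<bar>\<alpha> \<eta>\<bar> \<le> norm \<eta> * Ka"
    using bounded_linear.pos_bounded[OF ab(1)] by auto
  obtain Kb where Kb: "0 < Kb" "\<And>\<eta>. \<bar>\<beta> \<eta> \<eta>\<bar> \<le> norm \<eta> * norm \<eta> * Kb"
    using bounded_bilinear.pos_bounded[OF ab(2)] by auto
  define K where "K = Ka + Kb + 1"
  have K: "1 \<le> K" using Ka Kb by (simp add: K_def)
  fix \<epsilon> :: real assume \<epsilon>: "0 < \<epsilon>"
  define d1 where "d1 = min 1 (\<epsilon> / (3 * (\<bar>F' (g z)\<bar> + 1)))"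
  define d2 where "d2 = \<epsilon> / (3 * K\<^sup>2)"
  have d1: "0 < d1" "d1 \<le> 1" "\<bar>F' (g z)\<bar> * d1 \<le> \<epsilon> / 3"
  proof -
    have d: "d1 \<le> \<epsilon> / (3 * (\<bar>F' (g z)\<bar> + 1))" by (simp add: d1_def)
    show "0 < d1" "d1 \<le> 1" using \<epsilon> by (auto simp: d1_def add_nonneg_pos)
    have "\<bar>F' (g z)\<bar> * d1 \<le> (\<bar>F' (g z)\<bar> + 1) * d1" using \<open>0 < d1\<close> by (intro mult_right_mono) auto
    also have "\<dots> \<le> (\<bar>F' (g z)\<bar> + 1) * (\<epsilon> / (3 * (\<bar>F' (g z)\<bar> + 1)))" using d by (intro mult_left_mono) auto
    also have "\<dots> = \<epsilon> / 3"
      using add_nonneg_pos[OF abs_ge_zero zero_less_one, of "F' (g z)"] by (simp add: field_simps)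
    finally show "\<bar>F' (g z)\<bar> * d1 \<le> \<epsilon> / 3" .
  qed
  have d2: "0 < d2" "d2 * K\<^sup>2 = \<epsilon> / 3" using \<epsilon> K by (auto simp: d2_def)
  define D where "D \<eta> = g (z \<odot> \<eta>) - g z" for \<eta>
  define E where "E \<eta> = F (g (z \<odot> \<eta>)) - F (g z) - F' (g z) * D \<eta> - F2 / 2 * (D \<eta>)\<^sup>2" for \<eta>
  have ev1: "\<forall>\<^sub>F \<eta> in nhds 0. \<bar>D \<eta> - \<alpha> \<eta> - \<beta> \<eta> \<eta>\<bar> \<le> d1 * norm \<eta> ^ 2"
    using jet_bound[OF jet d1(1)] by (simp add: D_def)
  have small: "\<forall>\<^sub>F \<eta>::'a in nhds 0. norm \<eta> \<le> 1"
    using eventually_nhds_ball[OF zero_less_one, of "0::'a"] by (rule eventually_mono) auto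
  have ev2: "\<forall>\<^sub>F \<eta> in nhds 0. \<bar>D \<eta> - \<alpha> \<eta>\<bar> \<le> K * norm \<eta> ^ 2 \<and> \<bar>D \<eta>\<bar> \<le> K * norm \<eta>"
    using ev1 small
  proof eventually_elim
    case (elim \<eta>)
    have "d1 * norm \<eta> ^ 2 \<le> 1 * norm \<eta> ^ 2" using d1 by (intro mult_right_mono) auto
    moreover have "norm \<eta> ^ 2 \<le> norm \<eta>" using elim by (simp add: power2_eq_square mult_left_le)
    moreover have "Kb * norm \<eta> ^ 2 \<le> Kb * norm \<eta>" using Kb \<open>norm \<eta> ^ 2 \<le> norm \<eta>\<close> by simp
    moreover have "0 \<le> Ka * norm \<eta> ^ 2" using Ka by simp
    ultimately show ?case
      using elim(1) Ka(2)[of \<eta>] Kb(2)[of \<eta>]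
      by (auto simp: K_def abs_le_iff algebra_simps power2_eq_square)
  qed
  have "(D \<longlongrightarrow> 0) (nhds 0)"
  proof (rule Lim_null_comparison)
    show "\<forall>\<^sub>F \<eta> in nhds 0. norm (D \<eta>) \<le> K * norm \<eta>" using ev2 by (auto elim: eventually_mono)
    have "((\<lambda>\<eta>::'a. K * norm \<eta>) \<longlongrightarrow> K * norm (0::'a)) (nhds 0)"
      by (rule tendsto_mult_left[OF tendsto_norm[OF filterlim_ident]])
    then show "((\<lambda>\<eta>::'a. K * norm \<eta>) \<longlongrightarrow> 0) (nhds 0)" by simp
  qed
  from eventually_compose_filterlim[OF second_order_taylor[OF F d2(1)] this]
  have ev3: "\<forall>\<^sub>F \<eta> in nhds 0. \<bar>E \<eta>\<bar> \<le> d2 * (D \<eta>)\<^sup>2" by (simp add: E_def D_def)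
  have "\<forall>\<^sub>F \<eta>::'a in nhds 0. \<bar>F2 / 2\<bar> * (K * (2 * K)) * norm \<eta> ^ 3 \<le> \<epsilon> / 3 * norm \<eta> ^ 2"
    using \<epsilon> by (intro eventually_cubic_le) auto
  with ev1 ev2 ev3
  show "\<forall>\<^sub>F \<eta> in nhds 0. \<bar>F (g (z \<odot> \<eta>)) - F (g z) - F' (g z) * \<alpha> \<eta>
      - (F' (g z) * \<beta> \<eta> \<eta> + F2 / 2 * (\<alpha> \<eta> * \<alpha> \<eta>))\<bar> \<le> \<epsilon> * norm \<eta> ^ 2"
  proof eventually_elim
    case (elim \<eta>)
    have "\<bar>F' (g z)\<bar> * \<bar>D \<eta> - \<alpha> \<eta> - \<beta> \<eta> \<eta>\<bar> \<le> \<bar>F' (g z)\<bar> * (d1 * norm \<eta> ^ 2)"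
      using elim(1) by (intro mult_left_mono) auto
    also have "\<dots> \<le> \<epsilon> / 3 * norm \<eta> ^ 2"
      using mult_right_mono[OF d1(3), of "norm \<eta> ^ 2"] by (simp add: mult.assoc)
    finally have 1: "\<bar>F' (g z) * (D \<eta> - \<alpha> \<eta> - \<beta> \<eta> \<eta>)\<bar> \<le> \<epsilon> / 3 * norm \<eta> ^ 2" by (simp add: abs_mult)
    have "\<bar>\<alpha> \<eta>\<bar> \<le> K * norm \<eta>"
      using Ka(2)[of \<eta>] mult_right_mono[of Ka K "norm \<eta>"] Kb by (simp add: K_def mult.commute)
    then have "\<bar>D \<eta> + \<alpha> \<eta>\<bar> \<le> 2 * K * norm \<eta>" using elim(2) by linarith
    with elim(2) have "\<bar>(D \<eta> - \<alpha> \<eta>) * (D \<eta> + \<alpha> \<eta>)\<bar> \<le> K * norm \<eta> ^ 2 * (2 * K * norm \<eta>)"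
      by (intro abs_mult_le) auto
    then have "\<bar>F2 / 2 * ((D \<eta> - \<alpha> \<eta>) * (D \<eta> + \<alpha> \<eta>))\<bar> \<le> \<bar>F2 / 2\<bar> * (K * norm \<eta> ^ 2 * (2 * K * norm \<eta>))"
      unfolding abs_mult[of "F2 / 2"] by (intro mult_left_mono) auto
    also have "\<dots> = \<bar>F2 / 2\<bar> * (K * (2 * K)) * norm \<eta> ^ 3"
      by (simp add: power2_eq_square power3_eq_cube)
    finally have 2: "\<bar>F2 / 2 * ((D \<eta> - \<alpha> \<eta>) * (D \<eta> + \<alpha> \<eta>))\<bar> \<le> \<epsilon> / 3 * norm \<eta> ^ 2"
      using elim(4) by linarith
    have "(D \<eta>)\<^sup>2 \<le> (K * norm \<eta>)\<^sup>2"
      using elim(2) power_mono[of "\<bar>D \<eta>\<bar>" "K * norm \<eta>" 2] by simp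
    then have "d2 * (D \<eta>)\<^sup>2 \<le> d2 * K\<^sup>2 * norm \<eta> ^ 2"
      using d2(1) by (simp add: power_mult_distrib)
    with elim(3) have 3: "\<bar>E \<eta>\<bar> \<le> \<epsilon> / 3 * norm \<eta> ^ 2" unfolding d2(2) by linarith
    \<comment> \<open>The square of the increment \<open>D\<close> is traded for that of its linear
      part through (D - \<alpha>)(D + \<alpha>), which is of third order. Each of the three errors
      has a third of \<epsilon>.\<close>
    have "F (g (z \<odot> \<eta>)) - F (g z) - F' (g z) * \<alpha> \<eta> - (F' (g z) * \<beta> \<eta> \<eta> + F2 / 2 * (\<alpha> \<eta> * \<alpha> \<eta>))
      = F' (g z) * (D \<eta> - \<alpha> \<eta> - \<beta> \<eta> \<eta>) + F2 / 2 * ((D \<eta> - \<alpha> \<eta>) * (D \<eta> + \<alpha> \<eta>)) + E \<eta>"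
      by (simp add: E_def power2_eq_square algebra_simps)
    with 1 2 3 show ?case by linarith
  qed
qed

lemma jet_linear:
  assumes "bounded_linear \<alpha>"
  shows "jet \<alpha> z (\<lambda>\<eta>. \<alpha> (ltr z \<eta>)) (\<lambda>\<eta> \<xi>. 0)"
  using jet_quadratic[OF assms bounded_bilinear_zero] by simp

lemma jet_const: "jet (\<lambda>x. k) z (\<lambda>\<eta>. 0) (\<lambda>\<eta> \<xi>. 0)"
  by (rule jetI) (auto simp: bounded_bilinear_zero)

lemma jet_power:
  assumes "jet g z \<alpha> \<beta>"
  shows "jet (\<lambda>x. g x ^ n) z (\<lambda>\<eta>. (n * g z ^ (n - 1)) * \<alpha> \<eta>)
    (\<lambda>\<eta> \<xi>. (n * g z ^ (n - 1)) * \<beta> \<eta> \<xi> + n * ((n - 1) * g z ^ (n - 1 - 1)) / 2 * (\<alpha> \<eta> * \<alpha> \<xi>))"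
  by (rule jet_compose[OF assms]) (auto intro!: derivative_eq_intros always_eventually)

end

section \<open>Horizontal derivatives of the bracket\<close>

context heis_factor
begin

definition cx :: "heis \<times> real \<Rightarrow> real" where "cx v = fst (fst v)"
definition cy :: "heis \<times> real \<Rightarrow> real" where "cy v = fst (snd (fst v))"
definition cz :: "heis \<times> real \<Rightarrow> real" where "cz v = snd (snd (fst v))"

lemma bounded_linear_coordinates:
  "bounded_linear cx" "bounded_linear cy" "bounded_linear cz"
  "bounded_linear (snd :: heis \<times> real \<Rightarrow> real)"
  unfolding cx_def[abs_def] cy_def[abs_def] cz_def[abs_def]
  by (intro bounded_linear_compose[OF bounded_linear_fst] bounded_linear_compose[OF bounded_linear_snd]
      bounded_linear_fst bounded_linear_snd)+

lemma coordinates_ltr: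
  "cx (ltr v \<eta>) = cx \<eta>" "cy (ltr v \<eta>) = cy \<eta>" "snd (ltr v \<eta>) = snd \<eta>"
  "cz (ltr v \<eta>) = cz \<eta> + (cx v * cy \<eta> - cx \<eta> * cy v) / 2"
  unfolding ltr_def by (simp_all add: cx_def cy_def cz_def hom_def ez_def)

text \<open>The fourth power of the bracket. Being a polynomial, it has an explicit jet, from which
  the chain rule gives that of the bracket.\<close>

definition bracket4 :: "heis \<times> real \<Rightarrow> real"
  where "bracket4 v = 1 + cx v ^ 4 + cy v ^ 4 + 16 * cz v ^ 2"

lemma bracket4_ge_1: "1 \<le> bracket4 v"
  by (simp add: bracket4_def)

lemma heis_bracket_eq: "heis_bracket (fst v) = bracket4 v powr (1 / 4)"
proof -
  obtain x y z t where v: "v = ((x, y, z), t)" by (metis prod.collapse)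
  have "0 < 1 + x ^ 4 + y ^ 4 + 16 * z\<^sup>2" by (intro add_pos_nonneg) auto
  then show ?thesis
    by (simp add: v bracket4_def cx_def cy_def cz_def root_powr_inverse)
qed

lemma heis_bracket_pow4: "heis_bracket (fst v) ^ 4 = bracket4 v"
  using bracket4_ge_1[of v] by (simp add: heis_bracket_eq powr_realpow[symmetric] powr_powr)

lemma heis_bracket_ge_1: "1 \<le> heis_bracket (fst v)" for v :: "heis \<times> real"
  using bracket4_ge_1[of v] by (simp add: heis_bracket_eq ge_one_powr_ge_zero)

lemma coordinates_le_bracket:
  "\<bar>cx v\<bar> \<le> heis_bracket (fst v)" "\<bar>cy v\<bar> \<le> heis_bracket (fst v)"
  "4 * \<bar>cz v\<bar> \<le> heis_bracket (fst v) ^ 2"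
proof -
  let ?b = "heis_bracket (fst v)"
  have b: "0 \<le> ?b" using heis_bracket_ge_1[of v] by simp
  have 4: "cx v ^ 4 \<le> ?b ^ 4" "cy v ^ 4 \<le> ?b ^ 4" "16 * cz v ^ 2 \<le> ?b ^ 4"
    unfolding heis_bracket_pow4 bracket4_def by simp_all
  have p4: "\<bar>a\<bar> \<le> ?b" if "a ^ 4 \<le> ?b ^ 4" for a
  proof (rule power_le_imp_le_base[of _ 3])
    show "\<bar>a\<bar> ^ Suc 3 \<le> ?b ^ Suc 3" using that by (simp add: power_even_abs)
  qed (rule b)
  show "\<bar>cx v\<bar> \<le> ?b" "\<bar>cy v\<bar> \<le> ?b" by (intro p4 4)+
  have "(4 * \<bar>cz v\<bar>)\<^sup>2 \<le> (?b\<^sup>2)\<^sup>2" using 4(3) by (simp add: power_mult_distrib flip: power_mult)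
  then show "4 * \<bar>cz v\<bar> \<le> ?b\<^sup>2" by (rule power2_le_imp_le) simp
qed

text \<open>Along horizontal directions the first derivative of the fourth power is of order
  \<open>B^3\<close> and the second of order \<open>B\<^sup>2\<close>, because the vertical
  coordinate counts as \<open>B\<^sup>2\<close> and its horizontal derivative as \<open>B\<close>.
  The derivative \<open>F1\<close> of the fourth root satisfies \<open>F1 * B^3 = 1/4\<close>, so
  both orders become bounded; the root is concave, so the \<open>F2\<close> term has the favourable
  sign. The constants 8 and 7 are generous.\<close>

lemma bracket_jet:
  "\<exists>\<alpha> \<beta>. jet (\<lambda>w. heis_bracket (fst w)) v \<alpha> \<beta> \<and> \<alpha> et = 0 \<and>
    (\<forall>a b. \<bar>\<alpha> ((a, b, 0), 0)\<bar> \<le> 8 * (\<bar>a\<bar> + \<bar>b\<bar>)) \<and>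
    (\<forall>a b. \<beta> ((a, b, 0), 0) ((a, b, 0), 0) \<le> 7 * (\<bar>a\<bar> + \<bar>b\<bar>)\<^sup>2)"
proof -
  define x y z where "x = cx v" and "y = cy v" and "z = cz v"
  define N where "N = bracket4 v"
  define B where "B = heis_bracket (fst v)"
  define l where "l \<eta> = cz (ltr v \<eta>)" for \<eta>
  define a4 where "a4 \<eta> = 4 * x^3 * cx \<eta> + 4 * y^3 * cy \<eta> + 32 * z * l \<eta>" for \<eta>
  define b4 where "b4 \<eta> \<xi> = 6 * x\<^sup>2 * (cx \<eta> * cx \<xi>) + 6 * y\<^sup>2 * (cy \<eta> * cy \<xi>) + 16 * (l \<eta> * l \<xi>)" for \<eta> \<xi>
  have jx: "jet cx v cx (\<lambda>\<eta> \<xi>. 0)" and jy: "jet cy v cy (\<lambda>\<eta> \<xi>. 0)" and jz: "jet cz v l (\<lambda>\<eta> \<xi>. 0)"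
    using jet_linear[OF bounded_linear_coordinates(1), of v] jet_linear[OF bounded_linear_coordinates(2), of v]
      jet_linear[OF bounded_linear_coordinates(3), of v]
    unfolding coordinates_ltr(1,2) l_def[abs_def] by simp_all
  have j16: "jet (\<lambda>w. 16 * g w) v (\<lambda>\<eta>. 16 * \<alpha> \<eta>) (\<lambda>\<eta> \<xi>. 16 * \<beta> \<eta> \<xi>)" if "jet g v \<alpha> \<beta>" for g \<alpha> \<beta>
    using superjet_const_mult[of g v \<alpha> \<beta> 16] that
      superjet_const_mult[of "\<lambda>w. - g w" v "\<lambda>\<eta>. - \<alpha> \<eta>" "\<lambda>\<eta> \<xi>. - \<beta> \<eta> \<xi>" 16]
    by (simp add: jet_def)
  have j4: "jet bracket4 v a4 b4"
    using jet_add[OF jet_add[OF jet_add[OF jet_const[of 1 v] jet_power[OF jx, of 4]] jet_power[OF jy, of 4]]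
        j16[OF jet_power[OF jz, of 2]]]
    by (simp add: bracket4_def[abs_def] a4_def[abs_def] b4_def[abs_def] x_def y_def z_def mult.assoc)
  have N: "1 \<le> N" by (simp add: N_def bracket4_ge_1)
  have B: "1 \<le> B" "B ^ 4 = N" "B = N powr (1/4)"
    unfolding B_def N_def by (fact heis_bracket_ge_1 heis_bracket_pow4 heis_bracket_eq)+
  define F1 where "F1 = 1/4 * N powr (1/4 - 1)"
  define F2 where "F2 = 1/4 * ((1/4 - 1) * N powr (1/4 - 1 - 1))"
  have F1: "0 \<le> F1" "F1 * B^3 = 1/4"
  proof -
    show "0 \<le> F1" by (simp add: F1_def)
    have "B^3 = N powr (3/4)"
      using N by (simp add: B(3) powr_realpow[symmetric] powr_powr)
    then have "F1 * B^3 = 1/4 * (N powr (1/4 - 1) * N powr (3/4))" by (simp add: F1_def)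
    also have "\<dots> = 1/4" using N by (simp flip: powr_add)
    finally show "F1 * B^3 = 1/4" .
  qed
  have F2: "F2 \<le> 0" using N by (simp add: F2_def mult_le_0_iff)
  have "jet (\<lambda>w. bracket4 w powr (1/4)) v (\<lambda>\<eta>. F1 * a4 \<eta>) (\<lambda>\<eta> \<xi>. F1 * b4 \<eta> \<xi> + F2 / 2 * (a4 \<eta> * a4 \<xi>))"
    unfolding F1_def F2_def N_def
  proof (rule jet_compose[OF j4, where F' = "\<lambda>s. 1/4 * s powr (1/4 - 1)"])
    have "\<forall>\<^sub>F s in nhds (bracket4 v). 0 < s"
      using bracket4_ge_1[of v] by (intro eventually_nhds_in_open[of "{0<..}", simplified]) auto
    then show "\<forall>\<^sub>F s in nhds (bracket4 v). ((\<lambda>s. s powr (1/4)) has_real_derivative 1/4 * s powr (1/4 - 1)) (at s)"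
      by eventually_elim (auto intro!: derivative_eq_intros)
    show "((\<lambda>s. 1/4 * s powr (1/4 - 1)) has_real_derivative 1/4 * ((1/4 - 1) * bracket4 v powr (1/4 - 1 - 1)))
        (at (bracket4 v))"
      using bracket4_ge_1[of v] by (intro DERIV_cmult has_real_derivative_powr) auto
  qed
  then have jet: "jet (\<lambda>w. heis_bracket (fst w)) v (\<lambda>\<eta>. F1 * a4 \<eta>) (\<lambda>\<eta> \<xi>. F1 * b4 \<eta> \<xi> + F2 / 2 * (a4 \<eta> * a4 \<xi>))"
    by (simp add: heis_bracket_eq)
  have xyz: "\<bar>x\<bar> \<le> B" "\<bar>y\<bar> \<le> B" "4 * \<bar>z\<bar> \<le> B\<^sup>2"
    unfolding x_def y_def z_def B_def by (rule coordinates_le_bracket)+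
  have le3: "\<bar>x^3\<bar> \<le> B^3" "\<bar>y^3\<bar> \<le> B^3"
    using power_mono[OF xyz(1) abs_ge_zero, of 3] power_mono[OF xyz(2) abs_ge_zero, of 3]
    by (simp_all add: power_abs)
  have le2: "x\<^sup>2 \<le> B\<^sup>2" "y\<^sup>2 \<le> B\<^sup>2"
    using power_mono[OF xyz(1) abs_ge_zero, of 2] power_mono[OF xyz(2) abs_ge_zero, of 2] by simp_all
  have lab: "l ((a, b, 0), 0) = (x * b - a * y) / 2" for a b
    unfolding l_def coordinates_ltr x_def y_def by (simp add: cx_def cy_def cz_def)
  have lab_le: "\<bar>2 * l ((a, b, 0), 0)\<bar> \<le> B * (\<bar>a\<bar> + \<bar>b\<bar>)" for a b
  proof -
    have "\<bar>x * b\<bar> \<le> B * \<bar>b\<bar>" "\<bar>a * y\<bar> \<le> \<bar>a\<bar> * B" by (intro abs_mult_le xyz order_refl)+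
    then have "\<bar>x * b - a * y\<bar> \<le> B * \<bar>b\<bar> + \<bar>a\<bar> * B" by linarith
    then show ?thesis by (simp add: lab algebra_simps)
  qed
  show ?thesis
  proof (intro exI conjI allI)
    show "jet (\<lambda>w. heis_bracket (fst w)) v (\<lambda>\<eta>. F1 * a4 \<eta>) (\<lambda>\<eta> \<xi>. F1 * b4 \<eta> \<xi> + F2 / 2 * (a4 \<eta> * a4 \<xi>))"
      by (rule jet)
    have "l et = 0" by (simp add: l_def coordinates_ltr) (simp add: et_def cx_def cy_def cz_def)
    then show "F1 * a4 et = 0" by (simp add: a4_def) (simp add: et_def cx_def cy_def)
    fix a b :: real
    let ?s = "((a, b, 0::real), 0::real)"
    have "\<bar>x^3 * a\<bar> \<le> B^3 * \<bar>a\<bar>" "\<bar>y^3 * b\<bar> \<le> B^3 * \<bar>b\<bar>"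
      by (intro abs_mult_le le3 order_refl)+
    moreover have "\<bar>4 * z * (2 * l ?s)\<bar> \<le> B\<^sup>2 * (B * (\<bar>a\<bar> + \<bar>b\<bar>))"
      using xyz(3) by (intro abs_mult_le lab_le) (simp add: abs_mult)
    moreover have "a4 ?s = 4 * (x^3 * a) + 4 * (y^3 * b) + 4 * (4 * z * (2 * l ?s))"
      by (simp add: a4_def cx_def cy_def)
    moreover have "B\<^sup>2 * (B * (\<bar>a\<bar> + \<bar>b\<bar>)) = B^3 * \<bar>a\<bar> + B^3 * \<bar>b\<bar>"
      by (simp add: power2_eq_square power3_eq_cube algebra_simps)
    ultimately have "\<bar>a4 ?s\<bar> \<le> 8 * (B^3 * \<bar>a\<bar>) + 8 * (B^3 * \<bar>b\<bar>)" by linarith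
    also have "\<dots> = B^3 * (8 * (\<bar>a\<bar> + \<bar>b\<bar>))" by (simp add: algebra_simps)
    finally have "F1 * \<bar>a4 ?s\<bar> \<le> F1 * (B^3 * (8 * (\<bar>a\<bar> + \<bar>b\<bar>)))" using F1(1) by (rule mult_left_mono)
    also have "\<dots> = F1 * B^3 * (8 * (\<bar>a\<bar> + \<bar>b\<bar>))" by simp
    also have "\<dots> \<le> 8 * (\<bar>a\<bar> + \<bar>b\<bar>)" unfolding F1(2) by simp
    finally show "\<bar>F1 * a4 ?s\<bar> \<le> 8 * (\<bar>a\<bar> + \<bar>b\<bar>)" using F1(1) by (simp add: abs_mult)
    have sq: "a * a + b * b \<le> (\<bar>a\<bar> + \<bar>b\<bar>)\<^sup>2" by (simp add: power2_eq_square algebra_simps)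
    have "6 * x\<^sup>2 * (a * a) + 6 * y\<^sup>2 * (b * b) \<le> 6 * B\<^sup>2 * (a * a) + 6 * B\<^sup>2 * (b * b)"
      using le2 by (intro add_mono mult_right_mono) auto
    also have "\<dots> = 6 * B\<^sup>2 * (a * a + b * b)" by (simp add: algebra_simps)
    also have "\<dots> \<le> 6 * B\<^sup>2 * (\<bar>a\<bar> + \<bar>b\<bar>)\<^sup>2" using sq by (intro mult_left_mono) auto
    finally have "6 * x\<^sup>2 * (a * a) + 6 * y\<^sup>2 * (b * b) \<le> 6 * (B\<^sup>2 * (\<bar>a\<bar> + \<bar>b\<bar>)\<^sup>2)" by simp
    moreover have "4 * (2 * l ?s)\<^sup>2 \<le> 4 * (B * (\<bar>a\<bar> + \<bar>b\<bar>))\<^sup>2"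
      using power_mono[OF lab_le abs_ge_zero, of a b 2] by simp
    ultimately have "b4 ?s ?s \<le> 10 * (B\<^sup>2 * (\<bar>a\<bar> + \<bar>b\<bar>)\<^sup>2)"
      by (simp add: b4_def cx_def cy_def power_mult_distrib power2_eq_square)
    also have "\<dots> \<le> 10 * (B^3 * (\<bar>a\<bar> + \<bar>b\<bar>)\<^sup>2)"
      using power_increasing[of 2 3 B] B(1) by (intro mult_left_mono mult_right_mono) auto
    finally have "F1 * b4 ?s ?s \<le> F1 * (10 * (B^3 * (\<bar>a\<bar> + \<bar>b\<bar>)\<^sup>2))" using F1(1) by (rule mult_left_mono)
    also have "\<dots> = F1 * B^3 * (10 * (\<bar>a\<bar> + \<bar>b\<bar>)\<^sup>2)" by simp
    also have "\<dots> \<le> 7 * (\<bar>a\<bar> + \<bar>b\<bar>)\<^sup>2" unfolding F1(2) by simp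
    finally have "F1 * b4 ?s ?s \<le> 7 * (\<bar>a\<bar> + \<bar>b\<bar>)\<^sup>2" .
    moreover have "F2 / 2 * (a4 ?s * a4 ?s) \<le> 0" using F2 by (simp add: mult_nonpos_nonneg)
    ultimately show "F1 * b4 ?s ?s + F2 / 2 * (a4 ?s * a4 ?s) \<le> 7 * (\<bar>a\<bar> + \<bar>b\<bar>)\<^sup>2" by linarith
  qed
qed

lemma barrier:
  assumes "0 \<le> k" "0 \<le> L"
  shows "\<exists>K\<ge>0. \<forall>T v. snd v < T \<longrightarrow>
    (\<exists>\<alpha> \<beta>. superjet (\<lambda>w. exp (2 * k * heis_bracket (fst w) + K * snd w) + 1 / (T - snd w)) v \<alpha> \<beta> \<and>
      L * sqrt ((\<alpha> ex)\<^sup>2 + (\<alpha> ey)\<^sup>2) < par \<alpha> \<beta>)"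
proof -
  define S where "S = (\<bar>p\<bar> + \<bar>q\<bar>)\<^sup>2 + r\<^sup>2"
  \<comment> \<open>\<open>K\<close> collects what the time derivative of the exponential must
    outweigh, per unit of its value: 28 is 2 times 2 times 7 from the quadratic part of the bracket,
    256 is 2 times half of 16 squared from its gradient, and 32 bounds the sum of the two gradient
    components. The 1 gives strictness; the term 1 / (T - t) only helps.\<close>
  define K where "K = 1 + (28 * k + 256 * k\<^sup>2) * S + L * (32 * k)"
  have S: "0 \<le> S" by (simp add: S_def)
  have K: "0 \<le> K" using assms S by (simp add: K_def)
  have "\<exists>\<alpha> \<beta>. superjet (\<lambda>w. exp (2 * k * heis_bracket (fst w) + K * snd w) + 1 / (T - snd w)) v \<alpha> \<beta> \<and>
      L * sqrt ((\<alpha> ex)\<^sup>2 + (\<alpha> ey)\<^sup>2) < par \<alpha> \<beta>" if vT: "snd v < T" for T v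
  proof -
    obtain a b where ab: "jet (\<lambda>w. heis_bracket (fst w)) v a b" "a et = 0"
      "\<And>x y. \<bar>a ((x, y, 0), 0)\<bar> \<le> 8 * (\<bar>x\<bar> + \<bar>y\<bar>)"
      "\<And>x y. b ((x, y, 0), 0) ((x, y, 0), 0) \<le> 7 * (\<bar>x\<bar> + \<bar>y\<bar>)\<^sup>2"
      using bracket_jet[of v] by blast
    have jt: "jet snd v snd (\<lambda>\<eta> \<xi>. 0)"
      using jet_linear[OF bounded_linear_coordinates(4), of v] by (simp add: coordinates_ltr)
    define g where "g w = 2 * k * heis_bracket (fst w) + K * snd w" for w :: "heis \<times> real"
    define ag where "ag \<eta> = 2 * k * a \<eta> + K * snd \<eta>" for \<eta>
    define bg where "bg \<eta> \<xi> = 2 * k * b \<eta> \<xi>" for \<eta> \<xi>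
    have "jet (\<lambda>w. 2 * k * heis_bracket (fst w)) v (\<lambda>\<eta>. 2 * k * a \<eta>)
        (\<lambda>\<eta> \<xi>. 2 * k * b \<eta> \<xi> + 0 / 2 * (a \<eta> * a \<xi>))"
      by (rule jet_compose[OF ab(1), where F' = "\<lambda>_. 2 * k"])
        (auto intro!: derivative_eq_intros always_eventually)
    moreover have "jet (\<lambda>w. K * snd w) v (\<lambda>\<eta>. K * snd \<eta>) (\<lambda>\<eta> \<xi>. K * 0 + 0 / 2 * (snd \<eta> * snd \<xi>))"
      by (rule jet_compose[OF jt, where F' = "\<lambda>_. K"])
        (auto intro!: derivative_eq_intros always_eventually)
    ultimately have jg: "jet g v ag bg"
      using jet_add by (fastforce simp: g_def[abs_def] ag_def[abs_def] bg_def[abs_def])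
    define M where "M = exp (g v)"
    have je: "jet (\<lambda>w. exp (g w)) v (\<lambda>\<eta>. M * ag \<eta>) (\<lambda>\<eta> \<xi>. M * bg \<eta> \<xi> + M / 2 * (ag \<eta> * ag \<xi>))"
      unfolding M_def by (rule jet_compose[OF jg, where F' = exp]) (auto intro!: DERIV_exp always_eventually)
    define c1 c2 where "c1 = 1 / (T - snd v)\<^sup>2" and "c2 = 2 / (T - snd v)^3"
    have jr: "jet (\<lambda>w. 1 / (T - snd w)) v (\<lambda>\<eta>. c1 * snd \<eta>) (\<lambda>\<eta> \<xi>. c1 * 0 + c2 / 2 * (snd \<eta> * snd \<xi>))"
      unfolding c1_def
    proof (rule jet_compose[OF jt, where F = "\<lambda>s. 1 / (T - s)" and F' = "\<lambda>s. 1 / (T - s)\<^sup>2"])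
      have "\<forall>\<^sub>F s in nhds (snd v). s < T"
        using vT by (intro eventually_nhds_in_open[of "{..<T}", simplified]) auto
      then show "\<forall>\<^sub>F s in nhds (snd v). ((\<lambda>s. 1 / (T - s)) has_real_derivative 1 / (T - s)\<^sup>2) (at s)"
        by eventually_elim (auto intro!: derivative_eq_intros simp: power2_eq_square)
      show "((\<lambda>s. 1 / (T - s)\<^sup>2) has_real_derivative c2) (at (snd v))"
        unfolding c2_def using vT
        by (auto intro!: derivative_eq_intros simp: power2_eq_square power3_eq_cube divide_simps)
    qed
    define \<alpha> where "\<alpha> \<eta> = M * ag \<eta> + c1 * snd \<eta>" for \<eta>
    define \<beta> where "\<beta> \<eta> \<xi> = M * bg \<eta> \<xi> + M / 2 * (ag \<eta> * ag \<xi>) + (c1 * 0 + c2 / 2 * (snd \<eta> * snd \<xi>))" for \<eta> \<xi>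
    have jet: "jet (\<lambda>w. exp (g w) + 1 / (T - snd w)) v \<alpha> \<beta>"
      using jet_add[OF je jr] by (simp add: \<alpha>_def[abs_def] \<beta>_def[abs_def])
    have M: "0 < M" by (simp add: M_def)
    have c1: "0 \<le> c1" by (simp add: c1_def)
    have ags: "\<bar>ag ((x, y, 0), 0)\<bar> \<le> 16 * k * (\<bar>x\<bar> + \<bar>y\<bar>)" for x y
    proof -
      have "\<bar>ag ((x, y, 0), 0)\<bar> = 2 * k * \<bar>a ((x, y, 0), 0)\<bar>"
        using \<open>0 \<le> k\<close> by (simp add: ag_def abs_mult)
      also have "\<dots> \<le> 2 * k * (8 * (\<bar>x\<bar> + \<bar>y\<bar>))"
        using \<open>0 \<le> k\<close> by (intro mult_left_mono ab) auto
      finally show ?thesis by (simp add: algebra_simps)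
    qed
    have \<beta>s: "\<beta> ((x, y, 0), 0) ((x, y, 0), 0) \<le> M * ((14 * k + 128 * k\<^sup>2) * (\<bar>x\<bar> + \<bar>y\<bar>)\<^sup>2)" for x y
    proof -
      let ?s = "((x, y, 0), 0)"
      have "bg ?s ?s \<le> 14 * k * (\<bar>x\<bar> + \<bar>y\<bar>)\<^sup>2"
        using mult_left_mono[OF ab(4)[of x y], of "2 * k"] \<open>0 \<le> k\<close> by (simp add: bg_def mult.assoc)
      moreover have "ag ?s * ag ?s \<le> 256 * k\<^sup>2 * (\<bar>x\<bar> + \<bar>y\<bar>)\<^sup>2"
        using power_mono[OF ags[of x y] abs_ge_zero, of 2] by (simp add: power_mult_distrib power2_eq_square[of "ag ?s"])
      ultimately have "M * (bg ?s ?s + ag ?s * ag ?s / 2) \<le> M * ((14 * k + 128 * k\<^sup>2) * (\<bar>x\<bar> + \<bar>y\<bar>)\<^sup>2)"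
        using M by (intro mult_left_mono) (auto simp: distrib_right)
      then show ?thesis by (simp add: \<beta>_def distrib_left)
    qed
    have "\<alpha> et = M * K + c1" by (simp add: \<alpha>_def ag_def ab(2)) (simp add: et_def)
    moreover have "\<beta> ((p, q, 0), 0) ((p, q, 0), 0) + \<beta> ((0, r, 0), 0) ((0, r, 0), 0)
        \<le> M * ((14 * k + 128 * k\<^sup>2) * S)"
      using \<beta>s[of p q] \<beta>s[of 0 r] by (simp add: S_def distrib_left)
    ultimately have "M * K - 2 * (M * ((14 * k + 128 * k\<^sup>2) * S)) \<le> par \<alpha> \<beta>"
      using c1 unfolding par_def by (simp add: field_simps)
    moreover have "M * K - 2 * (M * ((14 * k + 128 * k\<^sup>2) * S)) = M + L * (M * (32 * k))"
      by (simp add: K_def algebra_simps)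
    ultimately have p: "M + L * (M * (32 * k)) \<le> par \<alpha> \<beta>" by simp
    have e: "\<bar>\<alpha> ex\<bar> \<le> M * (16 * k)" "\<bar>\<alpha> ey\<bar> \<le> M * (16 * k)"
      using mult_left_mono[OF ags[of 1 0], of M] mult_left_mono[OF ags[of 0 1], of M] M
      by (simp_all add: \<alpha>_def ex_def ey_def abs_mult)
    have "sqrt ((\<alpha> ex)\<^sup>2 + (\<alpha> ey)\<^sup>2) \<le> \<bar>\<alpha> ex\<bar> + \<bar>\<alpha> ey\<bar>" by (rule sqrt_sum_squares_le_sum_abs)
    also have "\<dots> \<le> M * (32 * k)" using e by simp
    finally have "L * sqrt ((\<alpha> ex)\<^sup>2 + (\<alpha> ey)\<^sup>2) \<le> L * (M * (32 * k))" using \<open>0 \<le> L\<close> by (rule mult_left_mono)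
    with p M jet show ?thesis unfolding g_def jet_def by (intro exI[of _ \<alpha>] exI[of _ \<beta>]) auto
  qed
  with K show ?thesis by blast
qed

end

section \<open>The comparison principle\<close>

lemma koranyi_gauge_continuous: "continuous_on UNIV koranyi_gauge"
proof -
  have eq: "koranyi_gauge = (\<lambda>p. root 4 (((fst p)\<^sup>2 + (fst (snd p))\<^sup>2)\<^sup>2 + 16 * (snd (snd p))\<^sup>2))"
    by (simp add: fun_eq_iff)
  show ?thesis unfolding eq by (intro continuous_intros)
qed

context heis_factor
begin

lemma continuous_on_bracket: "continuous_on S (\<lambda>w::heis \<times> real. heis_bracket (fst w))"
proof -
  have "continuous_on S bracket4"
    unfolding bracket4_def[abs_def]
    by (intro continuous_intros bounded_linear.continuous_on[OF bounded_linear_coordinates(1)]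
        bounded_linear.continuous_on[OF bounded_linear_coordinates(2)]
        bounded_linear.continuous_on[OF bounded_linear_coordinates(3)])
  moreover have "\<forall>w\<in>S. bracket4 w \<noteq> 0"
    using bracket4_ge_1 by (metis not_one_le_zero)
  ultimately show ?thesis unfolding heis_bracket_eq by (intro continuous_intros)
qed

lemma norm_le_of_bracket:
  fixes v :: "heis \<times> real"
  assumes "heis_bracket (fst v) \<le> b"
  shows "norm (fst v) \<le> 2 * b + b\<^sup>2"
proof -
  have b: "0 \<le> b" using assms heis_bracket_ge_1[of v] by linarith
  have "heis_bracket (fst v) ^ 2 \<le> b\<^sup>2"
    using assms heis_bracket_ge_1[of v] by (intro power_mono) auto
  then have c: "\<bar>cx v\<bar> \<le> b" "\<bar>cy v\<bar> \<le> b" "\<bar>cz v\<bar> \<le> b\<^sup>2"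
    using coordinates_le_bracket[of v] assms by linarith+
  have "fst v = (cx v, cy v, cz v)" by (simp add: cx_def cy_def cz_def)
  then have "norm (fst v) \<le> \<bar>cx v\<bar> + (\<bar>cy v\<bar> + \<bar>cz v\<bar>)"
    using norm_Pair_le[of "cx v" "(cy v, cz v)"] norm_Pair_le[of "cy v" "cz v"] by simp
  with c show ?thesis by linarith
qed

text \<open>With \<open>p = v \<odot> z\<close> and \<open>q = v\<close>, the argument of the gauge
  in (A2) is the conjugate of \<open>z\<close> by \<open>v\<close>, which tends to 0 with
  \<open>z\<close>. For the fixed point \<open>v\<close> this is continuity uniform in the
  gradient.\<close>

lemma uniform_continuity_at:
  fixes f :: "heis \<Rightarrow> real ^ 2 \<Rightarrow> real"
  assumes A2: "\<forall>\<rho>>0. \<exists>L2>0. \<forall>p q w. norm p \<le> \<rho> \<longrightarrow> norm q \<le> \<rho> \<longrightarrow>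
               \<bar>f p w - f q w\<bar> \<le> L2 * koranyi_gauge (p \<cdot>\<^sub>H heis_inv q)"
    and "0 < \<kappa>"
  shows "\<exists>\<delta>>0. \<forall>z w. norm z < \<delta> \<longrightarrow> \<bar>f (fst (v \<odot> z)) w - f (fst v) w\<bar> \<le> \<kappa>"
proof -
  define \<rho> where "\<rho> = norm v + (1 + norm v) * 1"
  have \<rho>: "0 < \<rho>" by (simp add: \<rho>_def add_nonneg_pos)
  then obtain L2 where L2: "L2 > 0" "\<And>p q w. norm p \<le> \<rho> \<Longrightarrow> norm q \<le> \<rho> \<Longrightarrow>
      \<bar>f p w - f q w\<bar> \<le> L2 * koranyi_gauge (p \<cdot>\<^sub>H heis_inv q)"
    using A2 by blast
  define g where "g z = L2 * koranyi_gauge (fst (v \<odot> z \<odot> - v))" for z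
  have "continuous_on UNIV g"
    unfolding g_def[abs_def]
    by (intro continuous_intros continuous_on_compose2[OF koranyi_gauge_continuous]) auto
  then have "isCont g 0" using continuous_on_eq_continuous_at[OF open_UNIV, of g] by blast
  then have "(g \<longlongrightarrow> g 0) (nhds 0)"
    unfolding isCont_def tendsto_at_iff_tendsto_nhds .
  moreover have "koranyi_gauge (fst (v \<odot> 0 \<odot> - v)) = 0"
    by (simp only: gmult_0 gmult_minus) (simp add: zero_prod_def)
  then have "g 0 < \<kappa>" using \<open>0 < \<kappa>\<close> by (simp only: g_def mult_zero_right)
  ultimately have "\<forall>\<^sub>F z in nhds 0. g z < \<kappa>" by (rule order_tendstoD(2))
  then obtain d where d: "0 < d" "\<And>z. norm z < d \<Longrightarrow> g z < \<kappa>"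
    by (auto simp: eventually_nhds_metric)
  have "\<bar>f (fst (v \<odot> z)) w - f (fst v) w\<bar> \<le> \<kappa>" if z: "norm z < min d 1" for z w
  proof -
    have "norm (v \<odot> z) \<le> \<rho>"
      unfolding \<rho>_def using z by (intro order_trans[OF norm_gmult] add_left_mono mult_left_mono) auto
    then have n: "norm (fst (v \<odot> z)) \<le> \<rho>"
      using norm_fst_le[of "fst (v \<odot> z)" "snd (v \<odot> z)"] by simp
    have "norm (fst v) \<le> norm v"
      using norm_fst_le[of "fst v" "snd v"] by simp
    also have "\<dots> \<le> \<rho>"
      by (simp add: \<rho>_def)
    finally have n': "norm (fst v) \<le> \<rho>" .
    have "fst (v \<odot> z) \<cdot>\<^sub>H heis_inv (fst v) = fst (v \<odot> z \<odot> - v)"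
      by (simp add: fst_gmult[of "v \<odot> z"] heis_inv_eq)
    with L2(2)[OF n n', of w] d(2)[of z] z show ?thesis by (simp add: g_def)
  qed
  then show ?thesis using d(1) by (intro exI[of _ "min d 1"]) auto
qed

text \<open>Left translation by \<open>z\<close> puts the base point at 0, and the radius
  \<open>snd z / 2\<close> keeps all times positive, so that both viscosity conditions are available
  on the whole ball.\<close>

lemma difference_superjet:
  fixes f :: "heis \<Rightarrow> real ^ 2 \<Rightarrow> real"
  assumes "0 \<le> L" and A1: "\<And>p w1 w2. \<bar>f p w1 - f p w2\<bar> \<le> L * norm (w1 - w2)"
    and A2: "\<forall>\<rho>>0. \<exists>L2>0. \<forall>p q w. norm p \<le> \<rho> \<longrightarrow> norm q \<le> \<rho> \<longrightarrow>
               \<bar>f p w - f q w\<bar> \<le> L2 * koranyi_gauge (p \<cdot>\<^sub>H heis_inv q)"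
    and u: "viscosity_subsolution A f u" and v: "viscosity_supersolution A f v"
    and t: "0 < snd z" and jet: "superjet (\<lambda>w. u w - v w) z \<alpha> \<beta>"
  shows "par \<alpha> \<beta> \<le> L * sqrt ((\<alpha> ex)\<^sup>2 + (\<alpha> ey)\<^sup>2)"
proof (rule sum_superjet_inequality[where \<rho> = "snd z / 2" and u = "\<lambda>\<xi>. u (z \<odot> \<xi>)" and w = "\<lambda>\<xi>. - v (z \<odot> \<xi>)"
      and G = "\<lambda>\<xi> a b. f (fst (z \<odot> \<xi>)) (vector [a, b])"])
  have pos: "0 < snd (z \<odot> \<xi>)" if "norm \<xi> \<le> snd z / 2" for \<xi>
    using that t norm_snd_le[of "snd \<xi>" "fst \<xi>"] by (simp add: snd_gmult)
  have sub: "(\<lambda>\<xi>. z \<odot> \<xi>) ` cball 0 (snd z / 2) \<subseteq> UNIV \<times> {0<..}"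
    by (intro image_subsetI) (simp add: mem_Times_iff pos)
  have cont: "continuous_on (cball 0 (snd z / 2)) (\<lambda>\<xi>. z \<odot> \<xi>)" by (intro continuous_intros)
  show "usc_on (cball 0 (snd z / 2)) (\<lambda>\<xi>. u (z \<odot> \<xi>))"
    using u by (intro usc_on_compose[OF _ cont sub]) (simp add: viscosity_subsolution_def)
  have "usc_on (UNIV \<times> {0<..}) (\<lambda>w. - v w)"
    using v unfolding viscosity_supersolution_def by (auto intro: lsc_on_imp_usc_on_minus)
  then show "usc_on (cball 0 (snd z / 2)) (\<lambda>\<xi>. - v (z \<odot> \<xi>))"
    by (rule usc_on_compose[OF _ cont sub])
  show "par \<alpha> \<beta> + f (fst (z \<odot> \<xi>)) (vector [\<alpha> ex, \<alpha> ey]) \<le> 0"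
    if "norm \<xi> < snd z / 2" "superjet (\<lambda>\<xi>. u (z \<odot> \<xi>)) \<xi> \<alpha> \<beta>" for \<xi> \<alpha> \<beta>
  proof (rule subsolution_superjet[OF u])
    show "0 < snd (z \<odot> \<xi>)" using pos that(1) by simp
    show "superjet u (fst (z \<odot> \<xi>), snd (z \<odot> \<xi>)) \<alpha> \<beta>"
      by (rule superjet_touch[OF that(2)]) (simp add: gmult_assoc)
  qed
  show "par \<alpha> \<beta> - f (fst (z \<odot> \<xi>)) (vector [- \<alpha> ex, - \<alpha> ey]) \<le> 0"
    if "norm \<xi> < snd z / 2" "superjet (\<lambda>\<xi>. - v (z \<odot> \<xi>)) \<xi> \<alpha> \<beta>" for \<xi> \<alpha> \<beta>
  proof (rule supersolution_superjet[OF v])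
    show "0 < snd (z \<odot> \<xi>)" using pos that(1) by simp
    show "superjet (\<lambda>w. - v w) (fst (z \<odot> \<xi>), snd (z \<odot> \<xi>)) \<alpha> \<beta>"
      by (rule superjet_touch[OF that(2)]) (simp add: gmult_assoc)
  qed
  show "\<bar>f (fst (z \<odot> \<xi>)) (vector [a, b]) - f (fst (z \<odot> \<xi>)) (vector [a', b'])\<bar>
      \<le> L * sqrt ((a - a')\<^sup>2 + (b - b')\<^sup>2)" for \<xi> a b a' b'
    using A1[of "fst (z \<odot> \<xi>)" "vector [a, b]" "vector [a', b']"]
    by (simp add: norm_vec_def L2_set_def sum_2)
  show "\<exists>\<delta>>0. \<forall>\<xi> a b. norm \<xi> < \<delta> \<longrightarrow>
      \<bar>f (fst (z \<odot> \<xi>)) (vector [a, b]) - f (fst (z \<odot> 0)) (vector [a, b])\<bar> \<le> \<kappa>" if "0 < \<kappa>" for \<kappa>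
    using uniform_continuity_at[OF A2 that, of z] by auto
  show "superjet (\<lambda>\<xi>. u (z \<odot> \<xi>) + - v (z \<odot> \<xi>)) 0 \<alpha> \<beta>"
    by (rule superjet_touch[OF jet]) simp
qed (use t \<open>0 \<le> L\<close> in auto)

lemma comparison_principle:
  fixes f :: "heis \<Rightarrow> real ^ 2 \<Rightarrow> real"
  assumes A1: "0 < L" "\<And>p w1 w2. \<bar>f p w1 - f p w2\<bar> \<le> L * norm (w1 - w2)"
    and A2: "\<forall>\<rho>>0. \<exists>L2>0. \<forall>p q w. norm p \<le> \<rho> \<longrightarrow> norm q \<le> \<rho> \<longrightarrow>
               \<bar>f p w - f q w\<bar> \<le> L2 * koranyi_gauge (p \<cdot>\<^sub>H heis_inv q)"
    and u_usc: "usc_on (UNIV \<times> {0..}) u" and v_lsc: "lsc_on (UNIV \<times> {0..}) v"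
    and u_sub: "viscosity_subsolution A f u" and v_super: "viscosity_supersolution A f v"
    and growth: "\<forall>T>0. \<exists>k>0. \<exists>C>0. \<forall>p. \<forall>t\<in>{0..T}. u (p, t) - v (p, t) \<le> C * exp (k * heis_bracket p)"
    and initial: "\<And>p. u (p, 0) \<le> v (p, 0)"
    and "0 \<le> t1"
  shows "u (p1, t1) \<le> v (p1, t1)"
proof (rule ccontr)
  assume "\<not> u (p1, t1) \<le> v (p1, t1)"
  then have gap: "0 < u (p1, t1) - v (p1, t1)" by simp
  define T where "T = t1 + 1"
  have T: "0 < T" "t1 < T" using \<open>0 \<le> t1\<close> by (auto simp: T_def)
  obtain k C where k: "0 < k" "0 < C"
    and gr: "\<And>p t. 0 \<le> t \<Longrightarrow> t \<le> T \<Longrightarrow> u (p, t) - v (p, t) \<le> C * exp (k * heis_bracket p)"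
    using growth T(1) by fastforce
  obtain K where K: "0 \<le> K" and bar: "\<And>T v. snd v < T \<Longrightarrow>
    \<exists>\<alpha> \<beta>. superjet (\<lambda>w. exp (2 * k * heis_bracket (fst w) + K * snd w) + 1 / (T - snd w)) v \<alpha> \<beta> \<and>
      L * sqrt ((\<alpha> ex)\<^sup>2 + (\<alpha> ey)\<^sup>2) < par \<alpha> \<beta>"
    using barrier[of k L] k A1(1) by auto
  define \<Theta> where "\<Theta> w = exp (2 * k * heis_bracket (fst w) + K * snd w) + 1 / (T - snd w)" for w
  have \<Theta>: "0 < \<Theta> w" if "snd w < T" for w
    using that by (simp add: \<Theta>_def add_pos_pos)
  \<comment> \<open>Half of the gap is given to the barrier, so that \<open>H\<close> stays positive
    at the point in question.\<close>
  define m where "m = (u (p1, t1) - v (p1, t1)) / (2 * \<Theta> (p1, t1))"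
  have m: "0 < m" using gap \<Theta>[of "(p1, t1)"] T by (simp add: m_def)
  define H where "H w = u w - v w - m * \<Theta> w" for w
  have "m * \<Theta> (p1, t1) = (u (p1, t1) - v (p1, t1)) / 2"
    using \<Theta>[of "(p1, t1)"] T by (simp add: m_def)
  then have H1: "0 < H (p1, t1)" using gap by (simp add: H_def)
  \<comment> \<open>Once the bracket reaches \<open>b\<close>, the barrier term with exponent 2 k
    times the bracket exceeds the growth bound with exponent k. Below \<open>b\<close> the growth
    bound is at most \<open>c\<close>.\<close>
  define b where "b = max 1 (ln (C / m) / k)"
  define c where "c = C * exp (k * b)"
  have c: "0 < c" using k by (simp add: c_def)
  \<comment> \<open>From this time on, \<open>m / (T - t)\<close> is at least
    \<open>c\<close>.\<close>
  define T1 where "T1 = max t1 (T - m / c)"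
  have T1: "t1 \<le> T1" "T1 < T" "T - m / c \<le> T1" using T m c by (auto simp: T1_def)
  define S where "S = cball (0::heis) (2 * b + b\<^sup>2) \<times> {0..T1}"
  have S: "compact S" unfolding S_def by (intro compact_Times compact_cball compact_Icc)
  have inS: "w \<in> S" if w: "0 \<le> snd w" "snd w < T" "0 < H w" for w
  proof -
    have le: "u w - v w \<le> C * exp (k * heis_bracket (fst w))"
      using gr[of "snd w" "fst w"] w by simp
    define B where "B = heis_bracket (fst w)"
    have B: "B < b"
    proof (rule ccontr)
      assume "\<not> B < b"
      then have "ln (C / m) / k \<le> B" by (simp add: b_def)
      then have "ln (C / m) \<le> k * B" using k by (simp add: pos_divide_le_eq mult.commute)
      then have "C / m \<le> exp (k * B)" using k m exp_le_cancel_iff[of "ln (C / m)" "k * B"] by simp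
      then have "C * exp (k * B) \<le> m * (exp (k * B) * exp (k * B))"
        using m by (simp add: field_simps)
      also have "exp (k * B) * exp (k * B) \<le> exp (2 * k * B + K * snd w)"
        using K w by (simp flip: exp_add)
      also have "m * exp (2 * k * B + K * snd w) \<le> m * \<Theta> w"
        using m w by (simp add: \<Theta>_def B_def)
      finally show False using w(3) le m by (simp add: H_def B_def)
    qed
    then have "C * exp (k * B) \<le> c" using k by (simp add: c_def)
    moreover have "m * (1 / (T - snd w)) \<le> m * \<Theta> w" using m by (intro mult_left_mono) (auto simp: \<Theta>_def)
    ultimately have "m * (1 / (T - snd w)) < c" using w(3) le by (simp add: H_def B_def)
    then have "m / c < T - snd w" using w(2) c by (simp add: field_simps)
    then have "snd w \<le> T1" using T1(3) by linarith
    moreover have "norm (fst w) \<le> 2 * b + b\<^sup>2" using B by (intro norm_le_of_bracket) (simp add: B_def)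
    ultimately show ?thesis using w(1) by (simp add: S_def mem_Times_iff)
  qed
  have "usc_on S H"
  proof -
    have sub: "S \<subseteq> UNIV \<times> {0..}" by (auto simp: S_def)
    have 1: "usc_on S u" by (rule usc_on_subset[OF u_usc sub])
    have 2: "usc_on S (\<lambda>w. - v w)" by (rule usc_on_subset[OF lsc_on_imp_usc_on_minus[OF v_lsc] sub])
    have "\<forall>w\<in>S. T - snd w \<noteq> 0" using T1(2) by (auto simp: S_def)
    then have "continuous_on S (\<lambda>w. - (m * \<Theta> w))"
      unfolding \<Theta>_def by (intro continuous_intros continuous_on_bracket)
    from usc_on_add[OF usc_on_add[OF 1 2] continuous_imp_usc_on[OF this]]
    show ?thesis by (simp add: H_def[abs_def])
  qed
  moreover have p1: "(p1, t1) \<in> S" using \<open>0 \<le> t1\<close> T H1 by (intro inS) auto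
  ultimately have "\<exists>z\<in>S. \<forall>w\<in>S. H w \<le> H z" using usc_attains_sup[OF S] by blast
  then obtain z where z: "z \<in> S" "\<And>w. w \<in> S \<Longrightarrow> H w \<le> H z" by blast
  have Hz: "0 < H z" using z(2)[OF p1] H1 by linarith
  have zT: "0 \<le> snd z" "snd z < T" using z(1) T1(2) by (auto simp: S_def)
  \<comment> \<open>Outside the compact set \<open>H\<close> is not positive, so the maximum over
    \<open>S\<close> is one over all times in [0, T).\<close>
  have max: "H w \<le> H z" if "0 \<le> snd w" "snd w < T" for w
    using z(2) inS[OF that] Hz by fastforce
  have "snd z \<noteq> 0"
  proof
    assume z0: "snd z = 0"
    then have "u z \<le> v z" using initial[of "fst z"] by (metis prod.collapse)
    moreover have "0 < m * \<Theta> z" using m \<Theta>[OF zT(2)] by simp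
    ultimately show False using Hz by (simp add: H_def)
  qed
  with zT have z0: "0 < snd z" by simp
  obtain \<alpha> \<beta> where jet: "superjet \<Theta> z \<alpha> \<beta>" "L * sqrt ((\<alpha> ex)\<^sup>2 + (\<alpha> ey)\<^sup>2) < par \<alpha> \<beta>"
    using bar[OF zT(2)] unfolding \<Theta>_def[abs_def] by blast
  have "superjet (\<lambda>w. u w - v w) z (\<lambda>\<eta>. m * \<alpha> \<eta>) (\<lambda>\<eta> \<xi>. m * \<beta> \<eta> \<xi>)"
  proof (rule superjet_touch[OF superjet_const_mult[OF jet(1) m]])
    have "\<forall>\<^sub>F \<eta> in nhds 0. z \<odot> \<eta> \<in> UNIV \<times> {0<..<T}"
      using z0 zT by (intro eventually_gmult_in open_Times) (auto simp: mem_Times_iff)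
    then show "\<forall>\<^sub>F \<eta> in nhds 0. u (z \<odot> \<eta>) - v (z \<odot> \<eta>) - (u z - v z) \<le> m * \<Theta> (z \<odot> \<eta>) - m * \<Theta> z"
    proof eventually_elim
      case (elim \<eta>)
      then have "H (z \<odot> \<eta>) \<le> H z" by (intro max) (auto simp: mem_Times_iff)
      then show ?case by (simp add: H_def)
    qed
  qed
  from difference_superjet[OF less_imp_le[OF A1(1)] A1(2) A2 u_sub v_super z0 this]
  have "m * par \<alpha> \<beta> \<le> L * sqrt ((m * \<alpha> ex)\<^sup>2 + (m * \<alpha> ey)\<^sup>2)" by (simp add: par_const_mult)
  also have "(m * \<alpha> ex)\<^sup>2 + (m * \<alpha> ey)\<^sup>2 = m\<^sup>2 * ((\<alpha> ex)\<^sup>2 + (\<alpha> ey)\<^sup>2)"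
    by (simp add: power_mult_distrib distrib_left)
  also have "L * sqrt \<dots> = m * (L * sqrt ((\<alpha> ex)\<^sup>2 + (\<alpha> ey)\<^sup>2))"
    using m by (simp add: real_sqrt_mult)
  finally have "par \<alpha> \<beta> \<le> L * sqrt ((\<alpha> ex)\<^sup>2 + (\<alpha> ey)\<^sup>2)" using m by simp
  with jet(2) show False by simp
qed

end

theorem theorem1p1:
  fixes A :: "real ^ 2 ^ 2"
    and f :: "heis \<Rightarrow> real ^ 2 \<Rightarrow> real"
    and u v :: "heis \<times> real \<Rightarrow> real"
  assumes A_sym: "transpose A = A"
    and A_psd: "\<forall>\<xi>. 0 \<le> \<xi> \<bullet> (A *v \<xi>)"
    and A1: "\<exists>L1>0. \<forall>p w1 w2. \<bar>f p w1 - f p w2\<bar> \<le> L1 * norm (w1 - w2)"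
    and A2: "\<forall>\<rho>>0. \<exists>L2>0. \<forall>p q w. norm p \<le> \<rho> \<longrightarrow> norm q \<le> \<rho> \<longrightarrow>
               \<bar>f p w - f q w\<bar> \<le> L2 * koranyi_gauge (p \<cdot>\<^sub>H heis_inv q)"
    and u_usc: "usc_on (UNIV \<times> {0..}) u"
    and v_lsc: "lsc_on (UNIV \<times> {0..}) v"
    and u_sub: "viscosity_subsolution A f u"
    and v_super: "viscosity_supersolution A f v"
    and growth: "\<forall>T>0. \<exists>k>0. \<exists>C>0. \<forall>p. \<forall>t\<in>{0..T}.
                   u (p, t) - v (p, t) \<le> C * exp (k * heis_bracket p)"
    and initial: "\<forall>p. u (p, 0) \<le> v (p, 0)"
  shows "\<forall>p. \<forall>t\<ge>0. u (p, t) \<le> v (p, t)"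
proof (intro allI impI)
  fix p1 :: heis and t1 :: real assume t1: "0 \<le> t1"
  obtain p q r where "heis_factor A p q r" using psd_factor[OF A_sym A_psd] by blast
  then interpret heis_factor A p q r .
  obtain L where L: "0 < L" "\<And>p w1 w2. \<bar>f p w1 - f p w2\<bar> \<le> L * norm (w1 - w2)"
    using A1 by blast
  show "u (p1, t1) \<le> v (p1, t1)"
    by (rule comparison_principle[OF L A2 u_usc v_lsc u_sub v_super growth _ t1]) (use initial in blast)
qed

end
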